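(* Let $h\in(0,1)$, $K\in C^h([0,T])$, and let $K_n(t)=\sum_{k=0}^n\kappa_{n,k}t^k$ be its Bernstein polynomial approximation of order $n$. Let $\mathbb H=L^2(\mathbb R)$, $\mathcal A$ the shift $(\mathcal Af)(x)=f(x+1)$, $\nu=\mathbb 1_{[0,1]}$, $g_n=\sum_{k=0}^nk!\,\kappa_{n,k}\mathbb 1_{[-k,-k+1]}$, $\bar{\mathcal A}_n:=\mathcal A-\beta\langle g_n,\cdot\rangle\nu$, and $$\hat u_n(t)=\frac{\alpha a_2}{2a_1}\langle g_n,e^{(T-t)\bar{\mathcal A}_n}\nu\rangle,\quad t\in[0,T].$$ For $u\in L^2_a$ let $J(u)$ and $J_n(u)$ be as in the context. Then there exists $C>0$ such that $$\Big|J_n(\hat u_n)-\sup_{u\in L^2_a}J(u)\Big|\le Cn^{-h/2},$$ and moreover there exists $C>0$ such that $$\Big|J(\hat u_n)-\sup_{u\in L^2_a}J(u)\Big|\le Cn^{-h/2}.$$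
   Context: Fix $T>0$ and constants $\alpha,\beta,\sigma>0$, $a_1,a_2>0$, $X(0)\in\mathbb R$. $W$ is a standard one-dimensional Brownian motion; $L^2_a$ is the space of real-valued square-integrable processes on $\Omega\times[0,T]$ adapted to the filtration generated by $W$. $C^h([0,T])$ is the set of $h$-Hölder continuous functions on $[0,T]$. The Bernstein polynomial approximation is $K_n(t)=\frac{1}{T^n}\sum_{k=0}^nK\big(\frac{Tk}{n}\big)\binom nk t^k(T-t)^{n-k}=\sum_{k=0}^n\kappa_{n,k}t^k$ with $\kappa_{n,k}=\frac{1}{T^k}\sum_{i=0}^k(-1)^{k-i}K\big(\frac{iT}{n}\big)\binom ni\binom{n-i}{k-i}$. $J(u)=\mathbb E[-\int_0^Ta_1u^2(s)ds+a_2X^u(T)]$ and $J_n(u)=\mathbb E[-\int_0^Ta_1u^2(s)ds+a_2X^u_n(T)]$, where $X^u(t)=X(0)+\int_0^tK(t-s)(\alpha u(s)-\beta X^u(s))ds+\sigma\int_0^tK(t-s)dW(s)$ and $X^u_n$ solves the same equation with $K$ replaced by $K_n$. *)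

theory Defs
  imports "HOL-Probability.Probability"
begin

definition holder_on :: "real \<Rightarrow> real set \<Rightarrow> (real \<Rightarrow> real) \<Rightarrow> bool" where
  "holder_on h S f \<longleftrightarrow> (\<exists>L. \<forall>s\<in>S. \<forall>t\<in>S. \<bar>f s - f t\<bar> \<le> L * \<bar>s - t\<bar> powr h)"

definition bernstein :: "real \<Rightarrow> (real \<Rightarrow> real) \<Rightarrow> nat \<Rightarrow> real \<Rightarrow> real" where
  "bernstein T K n t = (1 / T ^ n) *
     (\<Sum>k\<le>n. K (T * real k / real n) * real (n choose k) * t ^ k * (T - t) ^ (n - k))"

text \<open>Monomial coefficients kappa_{n,k}.\<close>
definition kappa :: "real \<Rightarrow> (real \<Rightarrow> real) \<Rightarrow> nat \<Rightarrow> nat \<Rightarrow> real" where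
  "kappa T K n k = (1 / T ^ k) *
     (\<Sum>i\<le>k. (-1) ^ (k - i) * K (real i * T / real n) * real (n choose i) * real ((n - i) choose (k - i)))"

text \<open>Elements of H = L^2(R) are represented by functions real => real; the inner product.\<close>
definition l2_inner :: "(real \<Rightarrow> real) \<Rightarrow> (real \<Rightarrow> real) \<Rightarrow> real" where
  "l2_inner f g = (\<integral>x. f x * g x \<partial>lborel)"

definition nu :: "real \<Rightarrow> real" where
  "nu = indicator {0..1}"

definition g_fun :: "real \<Rightarrow> (real \<Rightarrow> real) \<Rightarrow> nat \<Rightarrow> real \<Rightarrow> real" where
  "g_fun T K n = (\<lambda>x. \<Sum>k\<le>n. fact k * kappa T K n k * indicator {- real k .. - real k + 1} x)"

definition shiftA :: "(real \<Rightarrow> real) \<Rightarrow> real \<Rightarrow> real" where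
  "shiftA f = (\<lambda>x. f (x + 1))"

definition Abar :: "real \<Rightarrow> real \<Rightarrow> (real \<Rightarrow> real) \<Rightarrow> nat \<Rightarrow> (real \<Rightarrow> real) \<Rightarrow> real \<Rightarrow> real" where
  "Abar \<beta> T K n f = (\<lambda>x. shiftA f x - \<beta> * l2_inner (g_fun T K n) f * nu x)"

definition exp_Abar_nu :: "real \<Rightarrow> real \<Rightarrow> (real \<Rightarrow> real) \<Rightarrow> nat \<Rightarrow> real \<Rightarrow> real \<Rightarrow> real" where
  "exp_Abar_nu \<beta> T K n s = (SOME F. F \<in> borel_measurable lborel \<and>
     (\<lambda>N. \<integral>\<^sup>+x. ennreal ((F x - (\<Sum>m<N. s ^ m / fact m * ((Abar \<beta> T K n ^^ m) nu) x))\<^sup>2) \<partial>lborel)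
       \<longlonglongrightarrow> 0)"

definition hat_u :: "real \<Rightarrow> real \<Rightarrow> real \<Rightarrow> real \<Rightarrow> real \<Rightarrow> (real \<Rightarrow> real) \<Rightarrow> nat \<Rightarrow> real \<Rightarrow> real" where
  "hat_u \<alpha> \<beta> a1 a2 T K n t =
     \<alpha> * a2 / (2 * a1) * l2_inner (g_fun T K n) (exp_Abar_nu \<beta> T K n (T - t))"

definition brownian_motion :: "'a measure \<Rightarrow> (real \<Rightarrow> 'a \<Rightarrow> real) \<Rightarrow> bool" where
  "brownian_motion M W \<longleftrightarrow> prob_space M \<and>
     (\<forall>t. W t \<in> borel_measurable M) \<and>
     (\<forall>\<omega>\<in>space M. W 0 \<omega> = 0) \<and>
     (\<forall>\<omega>\<in>space M. continuous_on {0..} (\<lambda>t. W t \<omega>)) \<and>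
     (\<forall>s t. 0 \<le> s \<and> s < t \<longrightarrow>
        distributed M lborel (\<lambda>\<omega>. W t \<omega> - W s \<omega>) (normal_density 0 (sqrt (t - s)))) \<and>
     (\<forall>ts::real list. sorted ts \<and> ts \<noteq> [] \<and> 0 \<le> hd ts \<longrightarrow>
        prob_space.indep_vars M (\<lambda>_. borel) (\<lambda>i \<omega>. W (ts ! Suc i) \<omega> - W (ts ! i) \<omega>) {..<length ts - 1})"

definition nat_filt :: "'a measure \<Rightarrow> (real \<Rightarrow> 'a \<Rightarrow> real) \<Rightarrow> real \<Rightarrow> 'a measure" where
  "nat_filt M W t = sigma (space M) {W s -` B \<inter> space M | s B. s \<in> {0..t} \<and> B \<in> sets (borel :: real measure)}"

definition PM :: "real \<Rightarrow> 'a measure \<Rightarrow> (real \<times> 'a) measure" where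
  "PM T M = restrict_space lborel {0..T} \<Otimes>\<^sub>M M"

definition L2a :: "'a measure \<Rightarrow> (real \<Rightarrow> 'a \<Rightarrow> real) \<Rightarrow> real \<Rightarrow> (real \<Rightarrow> 'a \<Rightarrow> real) \<Rightarrow> bool" where
  "L2a M W T u \<longleftrightarrow> (\<lambda>(t, \<omega>). u t \<omega>) \<in> borel_measurable (PM T M) \<and>
     (\<forall>t\<in>{0..T}. u t \<in> borel_measurable (nat_filt M W t)) \<and>
     integrable (PM T M) (\<lambda>(t, \<omega>). (u t \<omega>)\<^sup>2)"

text \<open>Wiener integral int_0^t f(s) dW(s) of a continuous deterministic integrand,
  as the L^2(P)-limit of Riemann sums over uniform partitions.\<close>
definition wiener_int :: "'a measure \<Rightarrow> (real \<Rightarrow> 'a \<Rightarrow> real) \<Rightarrow> (real \<Rightarrow> real) \<Rightarrow> real \<Rightarrow> 'a \<Rightarrow> real" where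
  "wiener_int M W f t = (SOME Z. Z \<in> borel_measurable M \<and>
     (\<lambda>N. \<integral>\<^sup>+\<omega>. ennreal ((Z \<omega> - (\<Sum>i<N. f (t * real i / real N) *
          (W (t * real (Suc i) / real N) \<omega> - W (t * real i / real N) \<omega>)))\<^sup>2) \<partial>M) \<longlonglongrightarrow> 0)"

definition sve_sol :: "'a measure \<Rightarrow> (real \<Rightarrow> 'a \<Rightarrow> real) \<Rightarrow> (real \<Rightarrow> real) \<Rightarrow> real \<Rightarrow> real \<Rightarrow> real \<Rightarrow> real \<Rightarrow> real
     \<Rightarrow> (real \<Rightarrow> 'a \<Rightarrow> real) \<Rightarrow> (real \<Rightarrow> 'a \<Rightarrow> real) \<Rightarrow> bool" where
  "sve_sol M W K T \<alpha> \<beta> \<sigma> X0 u X \<longleftrightarrow>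
     (\<lambda>(t, \<omega>). X t \<omega>) \<in> borel_measurable (PM T M) \<and>
     integrable (PM T M) (\<lambda>(t, \<omega>). (X t \<omega>)\<^sup>2) \<and>
     (\<forall>t\<in>{0..T}. AE \<omega> in M. X t \<omega> = X0 +
        (LINT s:{0..t}|lborel. K (t - s) * (\<alpha> * u s \<omega> - \<beta> * X s \<omega>)) +
        \<sigma> * wiener_int M W (\<lambda>s. K (t - s)) t \<omega>)"

text \<open>Performance functional J(u) (with kernel K); J_n is Jfun with K replaced by K_n.\<close>
definition Jfun :: "'a measure \<Rightarrow> (real \<Rightarrow> 'a \<Rightarrow> real) \<Rightarrow> (real \<Rightarrow> real) \<Rightarrow> real \<Rightarrow> real \<Rightarrow> real \<Rightarrow> real \<Rightarrow> real
     \<Rightarrow> real \<Rightarrow> real \<Rightarrow> (real \<Rightarrow> 'a \<Rightarrow> real) \<Rightarrow> real" where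
  "Jfun M W K T \<alpha> \<beta> \<sigma> X0 a1 a2 u =
     (let X = (SOME X. sve_sol M W K T \<alpha> \<beta> \<sigma> X0 u X) in
       (\<integral>\<omega>. - (LINT s:{0..T}|lborel. a1 * (u s \<omega>)\<^sup>2) + a2 * X T \<omega> \<partial>M))"

end

theory Submission
  imports Defs
begin

text \<open>
  Let \<open>r\<close> be the resolvent of the kernel, the solution of \<open>r = K - \<beta> (K * r)\<close>. Taking expectations in the
  Volterra equation removes the Wiener integral, and solving the resulting deterministic equation with \<open>r\<close>
  gives \<open>E X(T) = X0 (1 - \<beta> \<integral> r) + \<alpha> \<integral> r(T - s) E u(s) ds\<close>. Completing the square, \<open>J(u)\<close> equals its
  supremum minus \<open>a1 E \<integral> (u - u*)\<^sup>2\<close> with the deterministic optimal control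
  \<open>u*(s) = \<alpha> a2 / (2 a1) r(T - s)\<close>. The same holds for the Bernstein polynomial \<open>K_n\<close> of \<open>K\<close> and its
  resolvent \<open>r_n\<close>; expanding the operator exponential shows that \<open>\<langle>g_n, exp (t A_n) \<nu>\<rangle>\<close> is the power
  series of \<open>r_n\<close>, so \<open>hat_u\<close> is the optimal control for \<open>K_n\<close>. A Gronwall argument bounds \<open>|r_n - r|\<close>
  by \<open>|K_n - K|\<close>, which is of order \<open>n powr (- h / 2)\<close> for Hoelder continuous \<open>K\<close>.
\<close>

section \<open>Square-integrable functions\<close>

definition sq_norm :: "'a measure \<Rightarrow> ('a \<Rightarrow> real) \<Rightarrow> ennreal" where
  "sq_norm M f = (\<integral>\<^sup>+x. ennreal ((f x)\<^sup>2) \<partial>M)"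

definition square_integrable :: "'a measure \<Rightarrow> ('a \<Rightarrow> real) \<Rightarrow> bool" where
  "square_integrable M f \<longleftrightarrow> f \<in> borel_measurable M \<and> integrable M (\<lambda>x. (f x)\<^sup>2)"

lemma sq_norm_minus_commute: "sq_norm M (\<lambda>x. f x - g x) = sq_norm M (\<lambda>x. g x - f x)"
  by (simp add: sq_norm_def power2_commute)

lemma sq_norm_cmult:
  assumes "f \<in> borel_measurable M"
  shows "sq_norm M (\<lambda>x. c * f x) = ennreal (c\<^sup>2) * sq_norm M f"
  using assms by (simp add: sq_norm_def power_mult_distrib ennreal_mult nn_integral_cmult)

lemma sq_norm_add_le:
  assumes [measurable]: "f \<in> borel_measurable M" "g \<in> borel_measurable M"
  shows "sq_norm M (\<lambda>x. f x + g x) \<le> 2 * sq_norm M f + 2 * sq_norm M g"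
proof -
  have "ennreal ((a + b)\<^sup>2) \<le> 2 * ennreal (a\<^sup>2) + 2 * ennreal (b\<^sup>2)" for a b :: real
  proof -
    have "(a + b)\<^sup>2 \<le> 2 * a\<^sup>2 + 2 * b\<^sup>2"
      using sum_squares_bound[of a b] by (simp add: power2_sum)
    then have "ennreal ((a + b)\<^sup>2) \<le> ennreal (2 * a\<^sup>2 + 2 * b\<^sup>2)" by (rule ennreal_leI)
    then show ?thesis by (simp add: ennreal_mult)
  qed
  then have "sq_norm M (\<lambda>x. f x + g x) \<le> (\<integral>\<^sup>+x. 2 * ennreal ((f x)\<^sup>2) + 2 * ennreal ((g x)\<^sup>2) \<partial>M)"
    unfolding sq_norm_def by (intro nn_integral_mono)
  also have "\<dots> = 2 * sq_norm M f + 2 * sq_norm M g"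
    by (simp add: sq_norm_def nn_integral_add nn_integral_cmult)
  finally show ?thesis .
qed

lemma sq_norm_triangle:
  assumes [measurable]: "f \<in> borel_measurable M" "g \<in> borel_measurable M" "h \<in> borel_measurable M"
  shows "sq_norm M (\<lambda>x. f x - h x) \<le> 2 * sq_norm M (\<lambda>x. f x - g x) + 2 * sq_norm M (\<lambda>x. g x - h x)"
  using sq_norm_add_le[of "\<lambda>x. f x - g x" M "\<lambda>x. g x - h x"] by simp

lemma square_integrable_iff_sq_norm:
  "square_integrable M f \<longleftrightarrow> f \<in> borel_measurable M \<and> sq_norm M f < \<infinity>"
  by (auto simp: square_integrable_def sq_norm_def integrable_iff_bounded)

lemma square_integrable_measurable[measurable_dest]:
  "square_integrable M f \<Longrightarrow> f \<in> borel_measurable M"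
  by (simp add: square_integrable_def)

lemma sq_norm_eq_integral:
  "square_integrable M f \<Longrightarrow> sq_norm M f = ennreal (\<integral>x. (f x)\<^sup>2 \<partial>M)"
  unfolding sq_norm_def square_integrable_def by (intro nn_integral_eq_integral) auto

lemma square_integrable_add:
  assumes f: "square_integrable M f" and g: "square_integrable M g"
  shows "square_integrable M (\<lambda>x. f x + g x)"
  unfolding square_integrable_iff_sq_norm
proof
  show "sq_norm M (\<lambda>x. f x + g x) < \<infinity>"
    using f g by (intro le_less_trans[OF sq_norm_add_le])
      (auto simp: square_integrable_iff_sq_norm ennreal_mult_less_top)
qed (use f g in measurable)

lemma square_integrable_cmult:
  "square_integrable M f \<Longrightarrow> square_integrable M (\<lambda>x. c * f x)"
  by (auto simp: square_integrable_def power_mult_distrib)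

lemma square_integrable_diff:
  assumes "square_integrable M f" "square_integrable M g"
  shows "square_integrable M (\<lambda>x. f x - g x)"
  using square_integrable_add[OF assms(1) square_integrable_cmult[OF assms(2), of "- 1"]] by simp

lemma square_integrable_sum:
  assumes "\<And>i. i \<in> I \<Longrightarrow> square_integrable M (f i)"
  shows "square_integrable M (\<lambda>x. \<Sum>i\<in>I. f i x)"
  using assms
  by (induction I rule: infinite_finite_induct)
     (auto intro: square_integrable_add simp: square_integrable_def[of M "\<lambda>_. 0"])

lemma integrable_mult_square_integrable:
  assumes f: "square_integrable M f" and g: "square_integrable M g"
  shows "integrable M (\<lambda>x. f x * g x)"
proof -
  have "integrable M (\<lambda>x. ((f x + g x)\<^sup>2 - (f x)\<^sup>2 - (g x)\<^sup>2) / 2)"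
    using square_integrable_add[OF f g] f g by (simp add: square_integrable_def)
  then show ?thesis by (simp add: power2_sum)
qed

lemma integral_square_diff:
  assumes f: "square_integrable M f" and g: "square_integrable M g"
  shows "(\<integral>x. (f x - g x)\<^sup>2 \<partial>M) = (\<integral>x. (f x)\<^sup>2 \<partial>M) - 2 * (\<integral>x. g x * f x \<partial>M) + (\<integral>x. (g x)\<^sup>2 \<partial>M)"
proof -
  have "(f x - g x)\<^sup>2 = (f x)\<^sup>2 - 2 * (g x * f x) + (g x)\<^sup>2" for x
    by (simp add: power2_diff)
  then show ?thesis
    using integrable_mult_square_integrable[OF g f] f g by (simp add: square_integrable_def)
qed

lemma (in finite_measure) square_integrable_const: "square_integrable M (\<lambda>_. c)"
  by (simp add: square_integrable_def)

lemma (in finite_measure) integrable_if_square_integrable: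
  "square_integrable M f \<Longrightarrow> integrable M f"
  unfolding square_integrable_def by (blast intro: square_integrable_imp_integrable)

lemma Cauchy_Schwarz_sq_norm:
  assumes [measurable]: "f \<in> borel_measurable M" "g \<in> borel_measurable M"
  shows "ennreal ((\<integral>x. f x * g x \<partial>M)\<^sup>2) \<le> sq_norm M f * sq_norm M g"
proof -
  have "ennreal \<bar>\<integral>x. f x * g x \<partial>M\<bar> \<le> (\<integral>\<^sup>+x. ennreal \<bar>f x * g x\<bar> \<partial>M)"
    using integral_norm_bound_ennreal[of M "\<lambda>x. f x * g x"]
    by (cases "integrable M (\<lambda>x. f x * g x)") (simp_all add: not_integrable_integral_eq)
  also have "\<dots> = (\<integral>\<^sup>+x. ennreal \<bar>f x\<bar> * ennreal \<bar>g x\<bar> \<partial>M)"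
    by (simp add: abs_mult ennreal_mult)
  finally have "(ennreal \<bar>\<integral>x. f x * g x \<partial>M\<bar>)\<^sup>2 \<le> (\<integral>\<^sup>+x. ennreal \<bar>f x\<bar> * ennreal \<bar>g x\<bar> \<partial>M)\<^sup>2"
    by (rule power_mono) simp
  also have "\<dots> \<le> (\<integral>\<^sup>+x. (ennreal \<bar>f x\<bar>)\<^sup>2 \<partial>M) * (\<integral>\<^sup>+x. (ennreal \<bar>g x\<bar>)\<^sup>2 \<partial>M)"
    by (rule Cauchy_Schwarz_nn_integral) measurable
  finally show ?thesis
    by (simp add: sq_norm_def ennreal_power)
qed

section \<open>Limits in the mean square\<close>

definition L2_limit :: "'a measure \<Rightarrow> (nat \<Rightarrow> 'a \<Rightarrow> real) \<Rightarrow> ('a \<Rightarrow> real) \<Rightarrow> bool" where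
  "L2_limit M f F \<longleftrightarrow> F \<in> borel_measurable M \<and> (\<lambda>N. sq_norm M (\<lambda>x. F x - f N x)) \<longlonglongrightarrow> 0"

lemma L2_limit_unique_AE:
  assumes [measurable]: "\<And>N. f N \<in> borel_measurable M"
    and F: "L2_limit M f F" and G: "L2_limit M f G"
  shows "AE x in M. F x = G x"
proof -
  have [measurable]: "F \<in> borel_measurable M" "G \<in> borel_measurable M"
    using F G by (simp_all add: L2_limit_def)
  have "(\<lambda>N. 2 * sq_norm M (\<lambda>x. F x - f N x) + 2 * sq_norm M (\<lambda>x. G x - f N x)) \<longlonglongrightarrow> 2 * 0 + 2 * 0"
    using F G by (intro tendsto_add ennreal_tendsto_cmult) (auto simp: L2_limit_def)
  moreover have "sq_norm M (\<lambda>x. F x - G x)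
      \<le> 2 * sq_norm M (\<lambda>x. F x - f N x) + 2 * sq_norm M (\<lambda>x. G x - f N x)" for N
    using sq_norm_triangle[of F M "f N" G] by (simp add: sq_norm_minus_commute[of M G])
  ultimately have "sq_norm M (\<lambda>x. F x - G x) \<le> 2 * 0 + 2 * 0"
    by (intro LIMSEQ_le_const) auto
  then have "AE x in M. ennreal ((F x - G x)\<^sup>2) = 0"
    by (simp add: sq_norm_def nn_integral_0_iff_AE)
  then show ?thesis by eventually_elim simp
qed

lemma L2_limit_square_integrable:
  assumes f: "\<And>N. square_integrable M (f N)" and F: "L2_limit M f F"
  shows "square_integrable M F"
proof -
  have [measurable]: "F \<in> borel_measurable M" "f N \<in> borel_measurable M" for N
    using f F by (simp_all add: L2_limit_def square_integrable_def)
  have "\<forall>\<^sub>F N in sequentially. sq_norm M (\<lambda>x. F x - f N x) < 1"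
    using F by (intro order_tendstoD) (auto simp: L2_limit_def)
  then obtain N where "sq_norm M (\<lambda>x. F x - f N x) < 1"
    by (auto simp: eventually_sequentially)
  then have "square_integrable M (\<lambda>x. F x - f N x)"
    unfolding square_integrable_iff_sq_norm by (auto intro: less_trans)
  from square_integrable_add[OF this f[of N]] show ?thesis by simp
qed

lemma L2_limit_sq_norm_le:
  assumes [measurable]: "\<And>N. f N \<in> borel_measurable M"
    and F: "L2_limit M f F" and C: "\<And>N. sq_norm M (f N) \<le> C"
  shows "sq_norm M F \<le> 2 * C"
proof -
  have [measurable]: "F \<in> borel_measurable M" using F by (simp add: L2_limit_def)
  have "sq_norm M F \<le> 2 * sq_norm M (\<lambda>x. F x - f N x) + 2 * C" for N
    using order_trans[OF sq_norm_add_le add_left_mono[OF mult_left_mono[OF C]], of "\<lambda>x. F x - f N x" N] by simp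
  moreover have "(\<lambda>N. 2 * sq_norm M (\<lambda>x. F x - f N x) + 2 * C) \<longlonglongrightarrow> 2 * 0 + 2 * C"
    using F by (intro tendsto_add ennreal_tendsto_cmult tendsto_const) (auto simp: L2_limit_def)
  ultimately have "sq_norm M F \<le> 2 * 0 + 2 * C" by (intro LIMSEQ_le_const) auto
  then show ?thesis by simp
qed

lemma L2_limit_integral_mult:
  assumes g: "square_integrable M g" and f: "\<And>N. square_integrable M (f N)" and F: "L2_limit M f F"
  shows "(\<lambda>N. \<integral>x. g x * f N x \<partial>M) \<longlonglongrightarrow> (\<integral>x. g x * F x \<partial>M)"
proof -
  have [measurable]: "F \<in> borel_measurable M" "g \<in> borel_measurable M" "f N \<in> borel_measurable M" for N
    using f g F by (simp_all add: L2_limit_def square_integrable_def)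
  define d where "d N = (\<integral>x. g x * F x \<partial>M) - (\<integral>x. g x * f N x \<partial>M)" for N
  have d_eq: "d N = (\<integral>x. g x * (F x - f N x) \<partial>M)" for N
    unfolding d_def right_diff_distrib using g f L2_limit_square_integrable[OF f F]
    by (intro Bochner_Integration.integral_diff[symmetric] integrable_mult_square_integrable)
  have bound: "ennreal ((d N)\<^sup>2) \<le> sq_norm M g * sq_norm M (\<lambda>x. F x - f N x)" for N
    using Cauchy_Schwarz_sq_norm[of g M "\<lambda>x. F x - f N x"] by (simp add: d_eq)
  have "(\<lambda>N. sq_norm M g * sq_norm M (\<lambda>x. F x - f N x)) \<longlonglongrightarrow> sq_norm M g * 0"
    using g F by (intro ennreal_tendsto_cmult) (auto simp: L2_limit_def square_integrable_iff_sq_norm)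
  then have bound_0: "(\<lambda>N. sq_norm M g * sq_norm M (\<lambda>x. F x - f N x)) \<longlonglongrightarrow> ennreal 0" by simp
  have "(\<lambda>N. ennreal ((d N)\<^sup>2)) \<longlonglongrightarrow> ennreal 0"
    by (rule tendsto_sandwich[OF _ _ tendsto_const bound_0]) (simp_all add: bound)
  then have "(\<lambda>N. (d N)\<^sup>2) \<longlonglongrightarrow> 0" by (subst (asm) tendsto_ennreal_iff) auto
  then have "d \<longlonglongrightarrow> 0" by (simp add: power_tendsto_0_iff)
  from tendsto_diff[OF tendsto_const[of "\<integral>x. g x * F x \<partial>M"] this]
  show ?thesis by (simp add: d_def)
qed

lemma (in finite_measure) L2_limit_integral:
  assumes "\<And>N. square_integrable M (f N)" "L2_limit M f F"
  shows "(\<lambda>N. \<integral>x. f N x \<partial>M) \<longlonglongrightarrow> (\<integral>x. F x \<partial>M)"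
  using L2_limit_integral_mult[OF square_integrable_const[of 1] assms] by simp

lemma weighted_sum_square_le:
  fixes c d :: "'b \<Rightarrow> real"
  assumes "\<And>k. 0 < c k"
  shows "(\<Sum>k\<in>A. \<bar>d k\<bar>)\<^sup>2 \<le> (\<Sum>k\<in>A. c k) * (\<Sum>k\<in>A. (d k)\<^sup>2 / c k)"
proof -
  have "(\<Sum>k\<in>A. \<bar>d k\<bar>)\<^sup>2 = (\<Sum>k\<in>A. sqrt (c k) * (\<bar>d k\<bar> / sqrt (c k)))\<^sup>2"
    using assms by (simp add: less_imp_neq[symmetric])
  also have "\<dots> \<le> (\<Sum>k\<in>A. (sqrt (c k))\<^sup>2) * (\<Sum>k\<in>A. (\<bar>d k\<bar> / sqrt (c k))\<^sup>2)"
    by (rule Cauchy_Schwarz_ineq_sum)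
  also have "\<dots> = (\<Sum>k\<in>A. c k) * (\<Sum>k\<in>A. (d k)\<^sup>2 / c k)"
    using assms by (simp add: power_divide less_imp_le)
  finally show ?thesis .
qed

lemma lim_minus_square_le:
  fixes a c :: "nat \<Rightarrow> real"
  assumes c_pos: "\<And>k. 0 < c k" and c_summable: "summable c"
    and steps_summable: "summable (\<lambda>k. (a (Suc k) - a k)\<^sup>2 / c k)"
  shows "(lim a - a 0)\<^sup>2 \<le> (\<Sum>k. c k) * (\<Sum>k. (a (Suc k) - a k)\<^sup>2 / c k)" (is "_ \<le> ?B")
proof -
  have partial: "(\<Sum>k<n. \<bar>a (Suc k) - a k\<bar>)\<^sup>2 \<le> ?B" for n
  proof -
    have "(\<Sum>k<n. \<bar>a (Suc k) - a k\<bar>)\<^sup>2 \<le> (\<Sum>k<n. c k) * (\<Sum>k<n. (a (Suc k) - a k)\<^sup>2 / c k)"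
      by (rule weighted_sum_square_le[OF c_pos])
    also have "\<dots> \<le> ?B"
      using c_pos by (intro mult_mono sum_le_suminf suminf_nonneg sum_nonneg c_summable steps_summable)
        (auto simp: less_imp_le)
    finally show ?thesis .
  qed
  have "summable (\<lambda>k. \<bar>a (Suc k) - a k\<bar>)"
    using partial by (intro summableI_nonneg_bounded[of _ "sqrt ?B"] real_le_rsqrt) auto
  then have "convergent (\<lambda>n. a n - a 0)"
    using summable_rabs_cancel[of "\<lambda>k. a (Suc k) - a k"]
    by (simp add: summable_iff_convergent sum_lessThan_telescope)
  then have "a \<longlonglongrightarrow> lim a"
    using convergent_add[OF _ convergent_const, of "\<lambda>n. a n - a 0" "a 0"] by (simp add: convergent_LIMSEQ_iff)
  then have "(\<lambda>n. (a n - a 0)\<^sup>2) \<longlonglongrightarrow> (lim a - a 0)\<^sup>2" by (intro tendsto_intros)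
  moreover have "(a n - a 0)\<^sup>2 \<le> ?B" for n
  proof -
    have "(a n - a 0)\<^sup>2 \<le> (\<Sum>k<n. \<bar>a (Suc k) - a k\<bar>)\<^sup>2"
      unfolding sum_lessThan_telescope[symmetric] by (rule abs_le_square_iff[THEN iffD1]) (simp add: sum_nonneg)
    with partial[of n] show ?thesis by linarith
  qed
  ultimately show ?thesis by (intro LIMSEQ_le_const2) auto
qed

lemma nn_integral_suminf_square_div_le:
  fixes d :: "nat \<Rightarrow> 'a \<Rightarrow> real" and c :: "nat \<Rightarrow> real"
  assumes [measurable]: "\<And>k. d k \<in> borel_measurable M"
    and c_pos: "\<And>k. 0 < c k" and c_summable: "summable c" and d: "\<And>k. sq_norm M (d k) \<le> ennreal ((c k)\<^sup>2)"
  shows "(\<integral>\<^sup>+x. (\<Sum>k. ennreal ((d k x)\<^sup>2 / c k)) \<partial>M) \<le> ennreal (\<Sum>k. c k)"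
proof -
  have "(\<integral>\<^sup>+x. (\<Sum>k. ennreal ((d k x)\<^sup>2 / c k)) \<partial>M) = (\<Sum>k. \<integral>\<^sup>+x. ennreal ((d k x)\<^sup>2 / c k) \<partial>M)"
    by (rule nn_integral_suminf) measurable
  also have "\<dots> \<le> (\<Sum>k. ennreal (c k))"
  proof (intro suminf_le allI)
    fix k
    have "(\<integral>\<^sup>+x. ennreal ((d k x)\<^sup>2 / c k) \<partial>M) = ennreal (1 / c k) * sq_norm M (d k)"
      using c_pos[of k] by (simp add: sq_norm_def less_imp_le flip: nn_integral_cmult ennreal_mult)
    also have "\<dots> \<le> ennreal (1 / c k) * ennreal ((c k)\<^sup>2)" by (intro mult_left_mono d) simp
    also have "\<dots> = ennreal (c k)" using c_pos[of k] by (simp add: power2_eq_square flip: ennreal_mult)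
    finally show "(\<integral>\<^sup>+x. ennreal ((d k x)\<^sup>2 / c k) \<partial>M) \<le> ennreal (c k)" .
  qed auto
  also have "\<dots> = ennreal (\<Sum>k. c k)" using c_pos by (intro suminf_ennreal2 c_summable) (auto intro: less_imp_le)
  finally show ?thesis .
qed

lemma sq_norm_lim_minus_le:
  fixes f :: "nat \<Rightarrow> 'a \<Rightarrow> real" and c :: "nat \<Rightarrow> real"
  assumes f[measurable]: "\<And>k. f k \<in> borel_measurable M"
    and c_pos: "\<And>k. 0 < c k" and c_summable: "summable c"
    and step: "\<And>k. sq_norm M (\<lambda>x. f (Suc k) x - f k x) \<le> ennreal ((c k)\<^sup>2)"
  shows "sq_norm M (\<lambda>x. lim (\<lambda>k. f k x) - f 0 x) \<le> ennreal ((\<Sum>k. c k)\<^sup>2)"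
proof -
  define E where "E x = (\<Sum>k. ennreal ((f (Suc k) x - f k x)\<^sup>2 / c k))" for x
  have [measurable]: "E \<in> borel_measurable M" unfolding E_def by measurable
  have c_nonneg: "0 \<le> (\<Sum>k. c k)" using c_pos by (intro suminf_nonneg c_summable less_imp_le)
  have E_le: "(\<integral>\<^sup>+x. E x \<partial>M) \<le> ennreal (\<Sum>k. c k)"
    unfolding E_def by (rule nn_integral_suminf_square_div_le[OF _ c_pos c_summable step]) measurable
  then have E_finite: "AE x in M. E x \<noteq> \<infinity>"
    by (intro nn_integral_PInf_AE) (auto simp: top_unique)
  have "sq_norm M (\<lambda>x. lim (\<lambda>k. f k x) - f 0 x) \<le> (\<integral>\<^sup>+x. ennreal (\<Sum>k. c k) * E x \<partial>M)"
    unfolding sq_norm_def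
  proof (rule nn_integral_mono_AE, use E_finite in eventually_elim)
    fix x assume "E x \<noteq> \<infinity>"
    then have steps_summable: "summable (\<lambda>k. (f (Suc k) x - f k x)\<^sup>2 / c k)"
      unfolding E_def by (intro summable_suminf_not_top) (use c_pos in \<open>auto simp: less_imp_le\<close>)
    then have "E x = ennreal (\<Sum>k. (f (Suc k) x - f k x)\<^sup>2 / c k)"
      unfolding E_def using c_pos by (intro suminf_ennreal2) (auto simp: less_imp_le)
    with lim_minus_square_le[OF c_pos c_summable steps_summable] c_nonneg
    show "ennreal ((lim (\<lambda>k. f k x) - f 0 x)\<^sup>2) \<le> ennreal (\<Sum>k. c k) * E x"
      by (simp add: ennreal_leI flip: ennreal_mult')
  qed
  also have "\<dots> = ennreal (\<Sum>k. c k) * (\<integral>\<^sup>+x. E x \<partial>M)" by (rule nn_integral_cmult) measurable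
  also have "\<dots> \<le> ennreal (\<Sum>k. c k) * ennreal (\<Sum>k. c k)" by (intro mult_left_mono E_le) simp
  finally show ?thesis using c_nonneg by (simp add: power2_eq_square ennreal_mult)
qed

lemma L2_limit_lim_if_summable_steps:
  fixes f :: "nat \<Rightarrow> 'a \<Rightarrow> real" and c :: "nat \<Rightarrow> real"
  assumes [measurable]: "\<And>k. f k \<in> borel_measurable M"
    and c_pos: "\<And>k. 0 < c k" and c_summable: "summable c"
    and step: "\<And>k. sq_norm M (\<lambda>x. f (Suc k) x - f k x) \<le> ennreal ((c k)\<^sup>2)"
  shows "L2_limit M f (\<lambda>x. lim (\<lambda>k. f k x))"
  unfolding L2_limit_def
proof
  have bound: "sq_norm M (\<lambda>x. lim (\<lambda>k. f k x) - f N x) \<le> ennreal ((\<Sum>k. c (k + N))\<^sup>2)" for N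
  proof -
    have "lim (\<lambda>k. f (k + N) x) = lim (\<lambda>k. f k x)" for x
      unfolding lim_def
      by (intro arg_cong[where f = The] ext iffI)
         (rule LIMSEQ_offset, assumption, rule LIMSEQ_ignore_initial_segment)
    then show ?thesis
      using sq_norm_lim_minus_le[of "\<lambda>k. f (k + N)" M "\<lambda>k. c (k + N)"] c_pos c_summable step
      by (simp add: summable_iff_shift)
  qed
  have "(\<lambda>N. ennreal ((\<Sum>k. c (k + N))\<^sup>2)) \<longlonglongrightarrow> ennreal (0\<^sup>2)"
    by (intro tendsto_ennrealI tendsto_power suminf_exist_split2 c_summable)
  then have tail: "(\<lambda>N. ennreal ((\<Sum>k. c (k + N))\<^sup>2)) \<longlonglongrightarrow> 0" by simp
  show "(\<lambda>N. sq_norm M (\<lambda>x. lim (\<lambda>k. f k x) - f N x)) \<longlonglongrightarrow> 0"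
    by (rule tendsto_sandwich[OF _ _ tendsto_const tail]) (simp_all add: bound)
qed measurable

lemma ennreal_tendsto_0I:
  fixes a :: "'b \<Rightarrow> ennreal"
  assumes "\<And>e. 0 < e \<Longrightarrow> \<forall>\<^sub>F x in F. a x \<le> ennreal e"
  shows "(a \<longlongrightarrow> 0) F"
proof (rule order_tendstoI)
  fix x :: ennreal assume "0 < x"
  then obtain y where y: "0 < y" "y < x" using dense by blast
  then have "y < top" using less_top order.strict_trans by blast
  then have "\<forall>\<^sub>F z in F. a z \<le> y"
    using assms[of "enn2real y"] y(1) by (simp add: enn2real_positive_iff)
  then show "\<forall>\<^sub>F z in F. a z < x"
    by eventually_elim (rule le_less_trans[OF _ y(2)])
qed simp

lemma L2_limit_of_subsequence:
  fixes \<phi> :: "nat \<Rightarrow> nat"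
  assumes [measurable]: "\<And>N. f N \<in> borel_measurable M"
    and Cauchy: "\<And>e. 0 < e \<Longrightarrow> \<exists>N0. \<forall>N\<ge>N0. \<forall>N'\<ge>N0. sq_norm M (\<lambda>x. f N x - f N' x) \<le> ennreal e"
    and F: "L2_limit M (\<lambda>k. f (\<phi> k)) F" and \<phi>: "filterlim \<phi> at_top sequentially"
  shows "L2_limit M f F"
  unfolding L2_limit_def
proof
  show [measurable]: "F \<in> borel_measurable M" using F by (simp add: L2_limit_def)
  show "(\<lambda>N. sq_norm M (\<lambda>x. F x - f N x)) \<longlonglongrightarrow> 0"
  proof (rule ennreal_tendsto_0I)
    fix e :: real assume e: "0 < e"
    obtain N0 where N0: "\<And>N N'. N0 \<le> N \<Longrightarrow> N0 \<le> N' \<Longrightarrow> sq_norm M (\<lambda>x. f N x - f N' x) \<le> ennreal (e / 4)"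
      using Cauchy[of "e / 4"] e by auto
    have "\<forall>\<^sub>F k in sequentially. sq_norm M (\<lambda>x. F x - f (\<phi> k) x) < ennreal (e / 4)"
      using F e by (intro order_tendstoD) (auto simp: L2_limit_def)
    moreover have "\<forall>\<^sub>F k in sequentially. N0 \<le> \<phi> k" using \<phi> by (simp add: filterlim_at_top)
    ultimately obtain k where k: "sq_norm M (\<lambda>x. F x - f (\<phi> k) x) < ennreal (e / 4)" "N0 \<le> \<phi> k"
      using eventually_happens[OF eventually_conj] by force
    show "\<forall>\<^sub>F N in sequentially. sq_norm M (\<lambda>x. F x - f N x) \<le> ennreal e"
      using eventually_ge_at_top[of N0]
    proof eventually_elim
      case (elim N)
      have "sq_norm M (\<lambda>x. F x - f N x)
          \<le> 2 * sq_norm M (\<lambda>x. F x - f (\<phi> k) x) + 2 * sq_norm M (\<lambda>x. f (\<phi> k) x - f N x)"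
        by (rule sq_norm_triangle) measurable
      also have "\<dots> \<le> 2 * ennreal (e / 4) + 2 * ennreal (e / 4)"
        by (intro add_mono mult_left_mono N0 less_imp_le[OF k(1)] k(2) elim) simp_all
      also have "\<dots> = ennreal e"
        using e by (simp flip: ennreal_numeral ennreal_mult ennreal_plus)
      finally show ?case .
    qed
  qed
qed

text \<open>One subsequence serves all parameters \<open>t\<close>, so the limit inherits joint measurability from \<open>f\<close>.\<close>
lemma L2_limit_uniform_subsequence:
  fixes f :: "nat \<Rightarrow> 'b \<Rightarrow> 'a \<Rightarrow> real"
  assumes f: "\<And>N t. f N t \<in> borel_measurable M"
    and Cauchy: "\<And>e. 0 < e \<Longrightarrow>
      \<exists>N0. \<forall>N\<ge>N0. \<forall>N'\<ge>N0. \<forall>t\<in>A. sq_norm M (\<lambda>x. f N t x - f N' t x) \<le> ennreal e"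
  obtains \<phi> where "\<And>t. t \<in> A \<Longrightarrow> L2_limit M (\<lambda>N. f N t) (\<lambda>x. lim (\<lambda>k. f (\<phi> k) t x))"
proof -
  have "\<exists>N0. \<forall>N\<ge>N0. \<forall>N'\<ge>N0. \<forall>t\<in>A. sq_norm M (\<lambda>x. f N t x - f N' t x) \<le> ennreal (((1/2) ^ k)\<^sup>2)" for k
    by (rule Cauchy) simp
  then obtain N0 where N0: "\<And>k N N' t. N0 k \<le> N \<Longrightarrow> N0 k \<le> N' \<Longrightarrow> t \<in> A \<Longrightarrow>
      sq_norm M (\<lambda>x. f N t x - f N' t x) \<le> ennreal (((1/2) ^ k)\<^sup>2)"
    by metis
  define \<phi> where "\<phi> k = k + (\<Sum>j\<le>k. N0 j)" for k
  have "N0 k \<le> (\<Sum>j\<le>k. N0 j)" "N0 k \<le> (\<Sum>j\<le>Suc k. N0 j)" for k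
    by (intro member_le_sum; simp)+
  then have \<phi>: "N0 k \<le> \<phi> k" "N0 k \<le> \<phi> (Suc k)" for k
    unfolding \<phi>_def by (meson trans_le_add2)+
  have \<phi>_at_top: "filterlim \<phi> at_top sequentially"
    by (rule filterlim_at_top_mono[OF filterlim_ident]) (simp add: \<phi>_def)
  show thesis
  proof (rule that, rule L2_limit_of_subsequence[OF f _ _ \<phi>_at_top])
    fix t assume t: "t \<in> A"
    show "L2_limit M (\<lambda>k. f (\<phi> k) t) (\<lambda>x. lim (\<lambda>k. f (\<phi> k) t x))"
      by (rule L2_limit_lim_if_summable_steps[of _ _ "\<lambda>k. (1/2) ^ k"]) (auto intro: f N0 \<phi> t)
    show "\<exists>N0. \<forall>N\<ge>N0. \<forall>N'\<ge>N0. sq_norm M (\<lambda>x. f N t x - f N' t x) \<le> ennreal e" if "0 < e" for e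
      using Cauchy[OF that] t by blast
  qed
qed

section \<open>Volterra convolutions\<close>

definition vconv :: "(real \<Rightarrow> real) \<Rightarrow> (real \<Rightarrow> real) \<Rightarrow> real \<Rightarrow> real" where
  "vconv k f t = (LINT s:{0..t}|lborel. k (t - s) * f s)"

lemma continuous_on_Icc_bounded:
  fixes f :: "real \<Rightarrow> real"
  assumes "continuous_on {a..b} f"
  obtains B where "0 < B" "\<And>x. x \<in> {a..b} \<Longrightarrow> \<bar>f x\<bar> \<le> B"
  using compact_imp_bounded[OF compact_continuous_image[OF assms compact_Icc]]
  unfolding bounded_pos by (auto simp: image_iff)

lemma continuous_on_Icc_bounded_measurable_extension:
  fixes f :: "real \<Rightarrow> real"
  assumes "continuous_on {a..b} f"
  obtains g B where "g \<in> borel_measurable borel" "\<And>x. \<bar>g x\<bar> \<le> B" "\<And>x. x \<in> {a..b} \<Longrightarrow> g x = f x"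
proof -
  obtain B where B: "0 < B" "\<And>x. x \<in> {a..b} \<Longrightarrow> \<bar>f x\<bar> \<le> B"
    using continuous_on_Icc_bounded[OF assms] by blast
  show thesis
  proof (rule that[of "\<lambda>x. indicator {a..b} x *\<^sub>R f x" B])
    show "(\<lambda>x. indicator {a..b} x *\<^sub>R f x) \<in> borel_measurable borel"
      by (rule borel_measurable_continuous_on_indicator[OF _ assms]) simp
    show "\<bar>indicator {a..b} x *\<^sub>R f x\<bar> \<le> B" for x
      using B by (cases "x \<in> {a..b}") auto
  qed (use B in auto)
qed

lemma vconv_cong:
  assumes "\<And>x. x \<in> {0..t} \<Longrightarrow> k x = k' x" "\<And>x. x \<in> {0..t} \<Longrightarrow> f x = f' x"
  shows "vconv k f t = vconv k' f' t"
  unfolding vconv_def by (rule set_lebesgue_integral_cong) (use assms in auto)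

lemma vconv_commute: "vconv k f t = vconv f k t"
proof -
  have "vconv k f t = (\<integral>s. indicator {0..t} s * (k (t - s) * f s) \<partial>lborel)"
    by (simp add: vconv_def set_lebesgue_integral_def)
  also have "\<dots> = (\<integral>s. indicator {0..t} (t + (-1) * s) * (k (t - (t + (-1) * s)) * f (t + (-1) * s)) \<partial>lborel)"
    using lborel_integral_real_affine[of "-1" "\<lambda>s. indicator {0..t} s * (k (t - s) * f s)" t] by simp
  also have "\<dots> = vconv f k t"
    unfolding vconv_def set_lebesgue_integral_def
    by (rule Bochner_Integration.integral_cong) (auto simp: indicator_def)
  finally show ?thesis .
qed

lemma vconv_const: "vconv k (\<lambda>_. 1) t = (LINT s:{0..t}|lborel. k s)"
  by (subst vconv_commute) (simp add: vconv_def)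

lemma vconv_cmult_right: "vconv k (\<lambda>s. c * f s) t = c * vconv k f t"
  by (simp add: vconv_def mult.left_commute[of _ c])

lemma vconv_cmult_left: "vconv (\<lambda>x. c * k x) f t = c * vconv k f t"
  by (simp add: vconv_def mult.assoc)

lemma integral_Icc_abs_le:
  fixes f :: "real \<Rightarrow> real"
  assumes "a \<le> b" and f: "continuous_on {a..b} f" and "\<And>x. x \<in> {a..b} \<Longrightarrow> \<bar>f x\<bar> \<le> C"
  shows "\<bar>LINT x:{a..b}|lborel. f x\<bar> \<le> (b - a) * C"
  using integral_bound[of a b f C] assms set_borel_integral_eq_integral(2)[OF borel_integrable_atLeastAtMost'[OF f]]
  by (simp add: mult.commute)

lemma continuous_on_vconv_integrand:
  fixes k f :: "real \<Rightarrow> real"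
  assumes k: "continuous_on {0..T} k" and f: "continuous_on {0..T} f" and t: "t \<in> {0..T}"
  shows "continuous_on {0..t} (\<lambda>s. k (t - s) * f s)"
  by (intro continuous_on_mult continuous_on_compose2[OF k] continuous_on_subset[OF f] continuous_intros)
     (use t in auto)

lemma vconv_set_integrable:
  fixes k f :: "real \<Rightarrow> real"
  assumes k: "continuous_on {0..T} k" and f: "set_integrable lborel {0..T} f" and t: "t \<in> {0..T}"
  shows "set_integrable lborel {0..t} (\<lambda>s. k (t - s) * f s)"
proof -
  obtain k' B where [measurable]: "k' \<in> borel_measurable borel"
    and k': "\<And>x. \<bar>k' x\<bar> \<le> B" "\<And>x. x \<in> {0..T} \<Longrightarrow> k' x = k x"
    by (rule continuous_on_Icc_bounded_measurable_extension[OF k]) blast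
  have f_restricted: "set_integrable lborel {0..t} f" by (rule set_integrable_subset[OF f]) (use t in auto)
  then have [measurable]: "(\<lambda>s. indicator {0..t} s *\<^sub>R f s) \<in> borel_measurable borel"
    unfolding set_integrable_def by auto
  have "(\<lambda>s. k' (t - s) * (indicator {0..t} s *\<^sub>R f s)) \<in> borel_measurable borel" by measurable
  then have "set_integrable lborel {0..t} (\<lambda>s. k' (t - s) * f s)"
    using k'(1) order_trans[OF k'(1) abs_ge_self]
    by (intro set_integrable_bound[OF set_integrable_mult_right[OF f_restricted, of B]])
       (auto simp: set_borel_measurable_def abs_mult mult.left_commute intro!: mult_right_mono)
  then show ?thesis
    by (subst (asm) set_integrable_cong[OF refl refl, of _ _ "\<lambda>s. k (t - s) * f s"]) (use t k'(2) in auto)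
qed

lemma vconv_add_right:
  assumes "continuous_on {0..T} k" "set_integrable lborel {0..T} f" "set_integrable lborel {0..T} g" "t \<in> {0..T}"
  shows "vconv k (\<lambda>s. f s + g s) t = vconv k f t + vconv k g t"
  using set_integral_add(2)[OF vconv_set_integrable[OF assms(1,2,4)] vconv_set_integrable[OF assms(1,3,4)]]
  by (simp add: vconv_def distrib_left)

lemma vconv_diff_right:
  assumes "continuous_on {0..T} k" "set_integrable lborel {0..T} f" "set_integrable lborel {0..T} g" "t \<in> {0..T}"
  shows "vconv k (\<lambda>s. f s - g s) t = vconv k f t - vconv k g t"
  using set_integral_diff(2)[OF vconv_set_integrable[OF assms(1,2,4)] vconv_set_integrable[OF assms(1,3,4)]]
  by (simp add: vconv_def right_diff_distrib)

lemma vconv_diff_left: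
  assumes "continuous_on {0..T} k" "continuous_on {0..T} l" "set_integrable lborel {0..T} f" "t \<in> {0..T}"
  shows "vconv (\<lambda>x. k x - l x) f t = vconv k f t - vconv l f t"
  using set_integral_diff(2)[OF vconv_set_integrable[OF assms(1,3,4)] vconv_set_integrable[OF assms(2,3,4)]]
  by (simp add: vconv_def left_diff_distrib)

lemma vconv_sum_left:
  assumes "\<And>i. i \<in> I \<Longrightarrow> continuous_on {0..T} (k i)" "set_integrable lborel {0..T} f" "t \<in> {0..T}"
  shows "vconv (\<lambda>x. \<Sum>i\<in>I. k i x) f t = (\<Sum>i\<in>I. vconv (k i) f t)"
  using vconv_set_integrable[OF assms] unfolding vconv_def set_lebesgue_integral_def set_integrable_def
  by (subst Bochner_Integration.integral_sum[symmetric]) (simp_all add: sum_distrib_right sum_distrib_left)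

lemma vconv_abs_le:
  assumes k: "continuous_on {0..T} k" and f: "set_integrable lborel {0..T} f" and t: "t \<in> {0..T}"
    and B: "\<And>x. x \<in> {0..T} \<Longrightarrow> \<bar>k x\<bar> \<le> B"
  shows "\<bar>vconv k f t\<bar> \<le> B * (LINT s:{0..t}|lborel. \<bar>f s\<bar>)"
proof -
  have f_restricted: "set_integrable lborel {0..t} f" by (rule set_integrable_subset[OF f]) (use t in auto)
  have "\<bar>vconv k f t\<bar> \<le> (LINT s:{0..t}|lborel. \<bar>k (t - s) * f s\<bar>)"
    unfolding vconv_def using set_integral_norm_bound[OF vconv_set_integrable[OF k f t]] by simp
  also have "\<dots> \<le> (LINT s:{0..t}|lborel. B * \<bar>f s\<bar>)"
    using t
    by (intro set_integral_mono set_integrable_abs set_integrable_mult_right vconv_set_integrable[OF k f t]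
        f_restricted)
       (auto simp: abs_mult intro!: mult_right_mono B)
  finally show ?thesis by simp
qed

lemma vconv_abs_le_const:
  assumes k: "continuous_on {0..T} k" and f: "continuous_on {0..T} f" and t: "t \<in> {0..T}"
    and B: "\<And>x. x \<in> {0..T} \<Longrightarrow> \<bar>k x\<bar> \<le> B" and C: "\<And>x. x \<in> {0..T} \<Longrightarrow> \<bar>f x\<bar> \<le> C"
  shows "\<bar>vconv k f t\<bar> \<le> T * (B * C)"
proof -
  have nonneg: "0 \<le> B" "0 \<le> C" using B[OF t] C[OF t] by auto
  have "\<bar>vconv k f t\<bar> \<le> (t - 0) * (B * C)"
    unfolding vconv_def using t nonneg
    by (intro integral_Icc_abs_le continuous_on_vconv_integrand[OF k f t])
       (auto simp: abs_mult intro!: mult_mono B C)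
  also have "\<dots> \<le> T * (B * C)" using t nonneg by (intro mult_right_mono) auto
  finally show ?thesis .
qed

lemma vconv_integrand_pair_integrable:
  fixes k l f :: "real \<Rightarrow> real"
  assumes [measurable]: "k \<in> borel_measurable borel" "l \<in> borel_measurable borel"
    and k: "\<And>x. \<bar>k x\<bar> \<le> B" and l: "\<And>x. \<bar>l x\<bar> \<le> C" and f: "integrable lborel f"
  shows "integrable (lborel \<Otimes>\<^sub>M lborel)
    (\<lambda>(s, v). if 0 \<le> v \<and> v \<le> s \<and> s \<le> t then k (t - s) * l (s - v) * f v else 0)"
    (is "integrable _ (\<lambda>(s, v). ?F s v)")
proof -
  have [measurable]: "f \<in> borel_measurable borel" using f by auto
  have nonneg: "0 \<le> B" "0 \<le> C"
    using order_trans[OF abs_ge_zero k[of 0]] order_trans[OF abs_ge_zero l[of 0]] by auto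
  have bound: "\<bar>?F s v\<bar> \<le> indicator {0..t} s * (B * C * \<bar>f v\<bar>)" for s v
    using nonneg by (auto simp: abs_mult intro!: mult_right_mono mult_mono k l)
  have section_integrable: "integrable lborel (?F s)" for s
  proof (rule Bochner_Integration.integrable_bound)
    show "integrable lborel (\<lambda>v. indicator {0..t} s * (B * C * \<bar>f v\<bar>))"
      using f by (intro integrable_mult_right integrable_abs)
    show "AE v in lborel. norm (?F s v) \<le> norm (indicator {0..t} s * (B * C * \<bar>f v\<bar>))"
      using order_trans[OF bound abs_ge_self] by simp
  qed measurable
  show ?thesis
  proof (rule lborel_pair.Fubini_integrable)
    show "integrable lborel (\<lambda>s. \<integral>v. norm (case (s, v) of (s, v) \<Rightarrow> ?F s v) \<partial>lborel)"
    proof (rule Bochner_Integration.integrable_bound)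
      show "integrable lborel (\<lambda>s. indicator {0..t} s * (B * C * (\<integral>v. \<bar>f v\<bar> \<partial>lborel)))"
        by (intro integrable_mult_left integrable_real_indicator) (auto simp: emeasure_lborel_Icc_eq)
      have "(\<integral>v. \<bar>?F s v\<bar> \<partial>lborel) \<le> (\<integral>v. indicator {0..t} s * (B * C * \<bar>f v\<bar>) \<partial>lborel)" for s
        by (intro integral_mono integrable_abs integrable_mult_right section_integrable f bound)
      then show "AE s in lborel. norm (\<integral>v. norm (case (s, v) of (s, v) \<Rightarrow> ?F s v) \<partial>lborel)
          \<le> norm (indicator {0..t} s * (B * C * (\<integral>v. \<bar>f v\<bar> \<partial>lborel)))"
        by (auto intro!: order_trans[OF _ abs_ge_self])
    qed measurable
    show "AE s in lborel. integrable lborel (\<lambda>v. case (s, v) of (s, v) \<Rightarrow> ?F s v)"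
      using section_integrable by simp
  qed measurable
qed

lemma vconv_assoc:
  fixes k l f :: "real \<Rightarrow> real"
  assumes k: "continuous_on {0..T} k" and l: "continuous_on {0..T} l"
    and f: "set_integrable lborel {0..T} f" and t: "t \<in> {0..T}"
  shows "vconv k (vconv l f) t = vconv (vconv k l) f t"
proof -
  obtain k' B where k': "k' \<in> borel_measurable borel" "\<And>x. \<bar>k' x\<bar> \<le> B" "\<And>x. x \<in> {0..T} \<Longrightarrow> k' x = k x"
    by (rule continuous_on_Icc_bounded_measurable_extension[OF k]) blast
  obtain l' C where l': "l' \<in> borel_measurable borel" "\<And>x. \<bar>l' x\<bar> \<le> C" "\<And>x. x \<in> {0..T} \<Longrightarrow> l' x = l x"
    by (rule continuous_on_Icc_bounded_measurable_extension[OF l]) blast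
  define f' where "f' v = indicator {0..T} v *\<^sub>R f v" for v
  define F where "F s v = (if 0 \<le> v \<and> v \<le> s \<and> s \<le> t then k' (t - s) * l' (s - v) * f' v else 0)" for s v
  have "integrable lborel f'" using f by (simp add: set_integrable_def f'_def[abs_def])
  then have F: "integrable (lborel \<Otimes>\<^sub>M lborel) (\<lambda>(s, v). F s v)"
    unfolding F_def by (rule vconv_integrand_pair_integrable[OF k'(1) l'(1) k'(2) l'(2)])
  have F_eq: "F s v = indicator {0..t} s *\<^sub>R (k (t - s) * (indicator {0..s} v *\<^sub>R (l (s - v) * f v)))" for s v
    using t by (auto simp: F_def f'_def k'(3) l'(3) indicator_def)
  have "vconv k (vconv l f) t = (\<integral>s. (\<integral>v. F s v \<partial>lborel) \<partial>lborel)"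
    by (simp add: vconv_def set_lebesgue_integral_def F_eq)
  also have "\<dots> = (\<integral>v. (\<integral>s. F s v \<partial>lborel) \<partial>lborel)"
    by (rule lborel_pair.Fubini_integral[OF F, symmetric])
  also have "\<dots> = (\<integral>v. indicator {0..t} v *\<^sub>R (vconv k l (t - v) * f v) \<partial>lborel)"
  proof (rule Bochner_Integration.integral_cong[OF refl])
    fix v
    have "(\<integral>s. F s v \<partial>lborel) = (\<integral>w. F (v + w) v \<partial>lborel)"
      using lborel_integral_real_affine[of 1 "\<lambda>s. F s v" v] by simp
    also have "\<dots> = (\<integral>w. indicator {0..t - v} w *\<^sub>R (k (t - v - w) * l w) * (indicator {0..t} v *\<^sub>R f v) \<partial>lborel)"
      by (rule Bochner_Integration.integral_cong) (auto simp: F_eq indicator_def diff_diff_eq)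
    finally show "(\<integral>s. F s v \<partial>lborel) = indicator {0..t} v *\<^sub>R (vconv k l (t - v) * f v)"
      by (simp add: vconv_def set_lebesgue_integral_def)
  qed
  finally show ?thesis by (simp add: vconv_def[of "vconv k l"] set_lebesgue_integral_def)
qed

lemma tendsto_vconv:
  fixes k f :: "nat \<Rightarrow> real \<Rightarrow> real"
  assumes k: "\<And>n. continuous_on {0..T} (k n)" "uniform_limit {0..T} k k' sequentially"
    and f: "\<And>n. continuous_on {0..T} (f n)" "uniform_limit {0..T} f f' sequentially"
    and t: "t \<in> {0..T}"
  shows "(\<lambda>n. vconv (k n) (f n) t) \<longlonglongrightarrow> vconv k' f' t"
proof -
  have k': "continuous_on {0..T} k'" and f': "continuous_on {0..T} f'"
    using uniform_limit_theorem[OF _ k(2)] uniform_limit_theorem[OF _ f(2)] k(1) f(1) by simp_all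
  have LINT_eq: "vconv a b t = integral {0..t} (\<lambda>s. a (t - s) * b s)"
    if "continuous_on {0..T} a" "continuous_on {0..T} b" for a b
    unfolding vconv_def
    by (intro set_borel_integral_eq_integral borel_integrable_atLeastAtMost' continuous_on_vconv_integrand[OF that t])
  have bounded_image: "bounded (a ` {0..T})" if "continuous_on {0..T} a" for a :: "real \<Rightarrow> real"
    using that by (intro compact_imp_bounded compact_continuous_image) auto
  have "uniform_limit {0..t} (\<lambda>n s. k n (t - s) * f n s) (\<lambda>s. k' (t - s) * f' s) sequentially"
  proof (rule uniform_lim_mult)
    show "uniform_limit {0..t} (\<lambda>n s. k n (t - s)) (\<lambda>s. k' (t - s)) sequentially"
      by (rule uniform_limit_compose'[OF k(2)]) (use t in auto)
    show "uniform_limit {0..t} f f' sequentially"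
      by (rule uniform_limit_on_subset[OF f(2)]) (use t in auto)
    show "bounded ((\<lambda>s. k' (t - s)) ` {0..t})" "bounded (f' ` {0..t})"
      by (rule bounded_subset[OF bounded_image[OF k']], use t in auto)
         (rule bounded_subset[OF bounded_image[OF f']], use t in auto)
  qed
  then obtain I J where I: "\<And>n. ((\<lambda>s. k n (t - s) * f n s) has_integral I n) {0..t}"
      and J: "((\<lambda>s. k' (t - s) * f' s) has_integral J) {0..t}" and "I \<longlonglongrightarrow> J"
    by (rule uniform_limit_integral) (auto intro: continuous_on_vconv_integrand k(1) f(1) t)
  then show ?thesis
    using k(1) f(1) k' f' by (simp add: LINT_eq integral_unique[OF I] integral_unique[OF J])
qed

section \<open>Resolvents\<close>

lemma gronwall:
  fixes f :: "real \<Rightarrow> real"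
  assumes f: "continuous_on {0..T} f" and c_nonneg: "0 \<le> c"
    and bound: "\<And>t. t \<in> {0..T} \<Longrightarrow> f t \<le> \<epsilon> + c * (LINT s:{0..t}|lborel. f s)"
    and t: "t \<in> {0..T}"
  shows "f t \<le> \<epsilon> * exp (c * t)"
proof -
  define I where "I t = integral {0..t} f" for t
  have I_eq: "(LINT s:{0..x}|lborel. f s) = I x" if "x \<in> {0..T}" for x
    unfolding I_def using that
    by (intro set_borel_integral_eq_integral borel_integrable_atLeastAtMost' continuous_on_subset[OF f]) auto
  have I_deriv: "(I has_real_derivative f x) (at x within {0..T})" if "x \<in> {0..T}" for x
    unfolding I_def by (rule integral_has_real_derivative[OF f that])
  define G where "G x = exp (- c * x) * (\<epsilon> + c * I x)" for x
  have G_deriv: "(G has_real_derivative c * exp (- c * x) * (f x - (\<epsilon> + c * I x))) (at x within {0..T})"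
    if "x \<in> {0..T}" for x
    unfolding G_def by (auto intro!: derivative_eq_intros I_deriv[OF that] simp: algebra_simps)
  have "G t \<le> G 0"
  proof (rule DERIV_nonpos_imp_decreasing_open[where f = G])
    fix x assume x: "0 < x" "x < t"
    with t have "(G has_real_derivative c * exp (- c * x) * (f x - (\<epsilon> + c * I x))) (at x)"
      using G_deriv[of x] by (simp add: at_within_Icc_at)
    moreover have "c * exp (- c * x) * (f x - (\<epsilon> + c * I x)) \<le> 0"
      using c_nonneg bound[of x] I_eq[of x] x t by (intro mult_nonneg_nonpos) auto
    ultimately show "\<exists>y. (G has_real_derivative y) (at x) \<and> y \<le> 0" by blast
  qed (use t in \<open>auto intro!: continuous_on_subset[OF DERIV_continuous_on[OF G_deriv]]\<close>)
  then have "\<epsilon> + c * I t \<le> \<epsilon> * exp (c * t)"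
    by (simp add: G_def I_def exp_minus field_simps)
  with bound[OF t] I_eq[OF t] show ?thesis by simp
qed

definition resolvent_on :: "real \<Rightarrow> real \<Rightarrow> (real \<Rightarrow> real) \<Rightarrow> (real \<Rightarrow> real) \<Rightarrow> bool" where
  "resolvent_on T \<beta> K r \<longleftrightarrow> continuous_on {0..T} K \<and> continuous_on {0..T} r \<and>
     (\<forall>t\<in>{0..T}. r t = K t - \<beta> * vconv K r t)"

lemma resolvent_on_continuous_kernel: "resolvent_on T \<beta> K r \<Longrightarrow> continuous_on {0..T} K"
  by (simp add: resolvent_on_def)

lemma resolvent_on_continuous: "resolvent_on T \<beta> K r \<Longrightarrow> continuous_on {0..T} r"
  by (simp add: resolvent_on_def)

lemma resolvent_on_equation: "resolvent_on T \<beta> K r \<Longrightarrow> t \<in> {0..T} \<Longrightarrow> r t = K t - \<beta> * vconv K r t"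
  by (simp add: resolvent_on_def)

lemma resolvent_on_sym: "resolvent_on T \<beta> K r \<Longrightarrow> resolvent_on T (- \<beta>) r K"
  by (auto simp: resolvent_on_def vconv_commute[of r K])

lemma vconv_resolvent_vconv:
  assumes r: "resolvent_on T \<beta> K r" and f: "set_integrable lborel {0..T} f" and t: "t \<in> {0..T}"
  shows "\<beta> * vconv r (vconv K f) t = vconv K f t - vconv r f t"
proof -
  note cont = resolvent_on_continuous_kernel[OF r] resolvent_on_continuous[OF r]
  have "\<beta> * vconv r (vconv K f) t = vconv (\<lambda>x. \<beta> * vconv K r x) f t"
    unfolding vconv_assoc[OF cont(2,1) f t] vconv_cmult_left by (simp add: vconv_commute[of K r, abs_def])
  also have "\<dots> = vconv (\<lambda>x. K x - r x) f t"
    using resolvent_on_equation[OF r] t by (intro vconv_cong) auto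
  also have "\<dots> = vconv K f t - vconv r f t" by (rule vconv_diff_left[OF cont f t])
  finally show ?thesis .
qed

text \<open>
  Since \<open>K\<close> is in turn the resolvent of \<open>r\<close> for the parameter \<open>- \<beta>\<close>, this also yields the converse implication.
\<close>
lemma volterra_equation_solution:
  assumes r: "resolvent_on T \<beta> K r"
    and f: "set_integrable lborel {0..T} f" and x: "set_integrable lborel {0..T} x"
    and equation: "\<And>t. t \<in> {0..T} \<Longrightarrow> x t = f t - \<beta> * vconv K x t" and t: "t \<in> {0..T}"
  shows "x t = f t - \<beta> * vconv r f t"
proof -
  have "vconv r f t - vconv r x t = vconv r (\<lambda>s. f s - x s) t"
    by (rule vconv_diff_right[OF resolvent_on_continuous[OF r] f x t, symmetric])
  also have "\<dots> = vconv r (\<lambda>s. \<beta> * vconv K x s) t"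
    using t equation by (intro vconv_cong) auto
  also have "\<dots> = vconv K x t - vconv r x t"
    unfolding vconv_cmult_right by (rule vconv_resolvent_vconv[OF r x t])
  finally show ?thesis using equation[OF t] by simp
qed

lemma resolvent_on_bound:
  assumes r: "resolvent_on T \<beta> K r" and K: "\<And>x. x \<in> {0..T} \<Longrightarrow> \<bar>K x\<bar> \<le> B" and t: "t \<in> {0..T}"
  shows "\<bar>r t\<bar> \<le> B * exp (\<bar>\<beta>\<bar> * B * T)"
proof -
  have B: "0 \<le> B" using K[OF t] by simp
  have "\<bar>r t\<bar> \<le> B * exp (\<bar>\<beta>\<bar> * B * t)"
  proof (rule gronwall[OF _ _ _ t])
    fix t assume t: "t \<in> {0..T}"
    have "\<bar>\<beta> * vconv K r t\<bar> \<le> \<bar>\<beta>\<bar> * (B * (LINT s:{0..t}|lborel. \<bar>r s\<bar>))"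
      unfolding abs_mult using resolvent_on_continuous_kernel[OF r] resolvent_on_continuous[OF r] t K
      by (intro mult_left_mono vconv_abs_le borel_integrable_atLeastAtMost') auto
    with K[OF t] resolvent_on_equation[OF r t] show "\<bar>r t\<bar> \<le> B + \<bar>\<beta>\<bar> * B * (LINT s:{0..t}|lborel. \<bar>r s\<bar>)"
      by (simp add: mult.assoc)
  qed (use B in \<open>auto intro!: continuous_intros resolvent_on_continuous[OF r]\<close>)
  also have "\<dots> \<le> B * exp (\<bar>\<beta>\<bar> * B * T)" using B t by (auto intro!: mult_left_mono)
  finally show ?thesis .
qed

lemma resolvent_on_stability:
  assumes r: "resolvent_on T \<beta> K r" and q: "resolvent_on T \<beta> L q"
    and K: "\<And>x. x \<in> {0..T} \<Longrightarrow> \<bar>K x\<bar> \<le> B" and L: "\<And>x. x \<in> {0..T} \<Longrightarrow> \<bar>L x\<bar> \<le> B"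
    and kernels_close: "\<And>x. x \<in> {0..T} \<Longrightarrow> \<bar>K x - L x\<bar> \<le> \<epsilon>" and t: "t \<in> {0..T}"
  defines "E \<equiv> exp (\<bar>\<beta>\<bar> * B * T)"
  shows "\<bar>r t - q t\<bar> \<le> \<epsilon> * (1 + \<bar>\<beta>\<bar> * T * B * E) * E"
proof -
  note cont = resolvent_on_continuous_kernel[OF r] resolvent_on_continuous[OF r]
    resolvent_on_continuous_kernel[OF q] resolvent_on_continuous[OF q]
  note int = borel_integrable_atLeastAtMost'[OF cont(2)] borel_integrable_atLeastAtMost'[OF cont(4)]
  define \<delta> where "\<delta> = \<epsilon> * (1 + \<bar>\<beta>\<bar> * T * B * E)"
  have nonneg: "0 \<le> B" "0 \<le> \<epsilon>" "0 \<le> T" using K[OF t] kernels_close[OF t] t by auto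
  have "\<bar>r t - q t\<bar> \<le> \<delta> * exp (\<bar>\<beta>\<bar> * B * t)"
  proof (rule gronwall[OF _ _ _ t])
    fix t assume t: "t \<in> {0..T}"
    have "\<bar>vconv (\<lambda>s. K s - L s) r t\<bar> \<le> T * (\<epsilon> * (B * E))"
      using resolvent_on_bound[OF r K] unfolding E_def
      by (intro vconv_abs_le_const continuous_intros cont t kernels_close) auto
    then have kernel_error: "\<bar>\<beta> * vconv (\<lambda>s. K s - L s) r t\<bar> \<le> \<bar>\<beta>\<bar> * (T * (\<epsilon> * (B * E)))"
      unfolding abs_mult by (intro mult_left_mono) auto
    have "\<bar>vconv L (\<lambda>s. r s - q s) t\<bar> \<le> B * (LINT s:{0..t}|lborel. \<bar>r s - q s\<bar>)"
      by (rule vconv_abs_le[OF cont(3) set_integral_diff(1)[OF int] t L])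
    then have feedback: "\<bar>\<beta> * vconv L (\<lambda>s. r s - q s) t\<bar>
        \<le> \<bar>\<beta>\<bar> * (B * (LINT s:{0..t}|lborel. \<bar>r s - q s\<bar>))"
      unfolding abs_mult by (intro mult_left_mono) auto
    have "r t - q t = (K t - L t) - \<beta> * vconv (\<lambda>s. K s - L s) r t - \<beta> * vconv L (\<lambda>s. r s - q s) t"
      using resolvent_on_equation[OF r t] resolvent_on_equation[OF q t] cont int t
      by (simp add: vconv_diff_left vconv_diff_right algebra_simps)
    then have "\<bar>r t - q t\<bar>
        \<le> \<epsilon> + \<bar>\<beta>\<bar> * (T * (\<epsilon> * (B * E))) + \<bar>\<beta>\<bar> * (B * (LINT s:{0..t}|lborel. \<bar>r s - q s\<bar>))"
      using kernel_error feedback kernels_close[OF t] by linarith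
    then show "\<bar>r t - q t\<bar> \<le> \<delta> + \<bar>\<beta>\<bar> * B * (LINT s:{0..t}|lborel. \<bar>r s - q s\<bar>)"
      by (simp add: \<delta>_def algebra_simps)
  qed (use nonneg in \<open>auto intro!: continuous_intros cont\<close>)
  also have "\<dots> \<le> \<delta> * E"
    unfolding \<delta>_def E_def using nonneg t by (auto intro!: mult_left_mono)
  finally show ?thesis by (simp add: \<delta>_def)
qed

lemma resolvent_on_uniform_limit:
  assumes r: "\<And>n. resolvent_on T \<beta> (K n) (r n)"
    and K: "uniform_limit {0..T} K K' sequentially" and r': "uniform_limit {0..T} r r' sequentially"
  shows "resolvent_on T \<beta> K' r'"
  unfolding resolvent_on_def
proof (intro conjI ballI)
  show "continuous_on {0..T} K'" "continuous_on {0..T} r'"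
    using uniform_limit_theorem[OF _ K] uniform_limit_theorem[OF _ r']
      resolvent_on_continuous_kernel[OF r] resolvent_on_continuous[OF r] by simp_all
  fix t assume t: "t \<in> {0..T}"
  have "(\<lambda>n. K n t - \<beta> * vconv (K n) (r n) t) \<longlonglongrightarrow> K' t - \<beta> * vconv K' r' t"
    by (intro tendsto_intros tendsto_uniform_limitI[OF K t] tendsto_vconv[OF _ K _ r' t]
        resolvent_on_continuous_kernel[OF r] resolvent_on_continuous[OF r])
  moreover have "K n t - \<beta> * vconv (K n) (r n) t = r n t" for n
    using resolvent_on_equation[OF r t] by simp
  ultimately show "r' t = K' t - \<beta> * vconv K' r' t"
    using tendsto_uniform_limitI[OF r' t] LIMSEQ_unique by simp
qed

lemma resolvent_on_exists_uniform_limit: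
  assumes r: "\<And>n. resolvent_on T \<beta> (K n) (r n)" and B: "\<And>n x. x \<in> {0..T} \<Longrightarrow> \<bar>K n x\<bar> \<le> B"
    and K: "uniform_limit {0..T} K K' sequentially"
  shows "\<exists>r'. resolvent_on T \<beta> K' r'"
proof -
  define E where "E = exp (\<bar>\<beta>\<bar> * B * T)"
  define S where "S = \<bar>(1 + \<bar>\<beta>\<bar> * T * B * E) * E\<bar> + 1"
  have S: "0 < S" by (simp add: S_def)
  have "uniformly_Cauchy_on {0..T} r"
  proof (rule uniformly_Cauchy_onI)
    fix e :: real assume e: "e > 0"
    have "uniformly_Cauchy_on {0..T} K"
      using K by (auto simp: uniformly_convergent_eq_Cauchy[symmetric] uniformly_convergent_on_def)
    then obtain N where N: "\<And>x m n. x \<in> {0..T} \<Longrightarrow> m \<ge> N \<Longrightarrow> n \<ge> N \<Longrightarrow> dist (K m x) (K n x) < e / S"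
      unfolding uniformly_Cauchy_on_def using e S by (metis divide_pos_pos)
    have "dist (r m x) (r n x) < e" if x: "x \<in> {0..T}" and "N \<le> m" "N \<le> n" for x m n
    proof -
      have "\<bar>r m x - r n x\<bar> \<le> e / S * (1 + \<bar>\<beta>\<bar> * T * B * E) * E"
        unfolding E_def using N that
        by (intro resolvent_on_stability[OF r r B B _ x]) (auto simp: dist_real_def less_imp_le)
      also have "\<dots> = e / S * ((1 + \<bar>\<beta>\<bar> * T * B * E) * E)" by simp
      also have "\<dots> < e / S * S" using e S by (intro mult_strict_left_mono) (auto simp: S_def)
      also have "\<dots> = e" using S by simp
      finally show ?thesis by (simp add: dist_real_def)
    qed
    then show "\<exists>N. \<forall>x\<in>{0..T}. \<forall>m\<ge>N. \<forall>n\<ge>N. dist (r m x) (r n x) < e" by blast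
  qed
  then obtain r' where "uniform_limit {0..T} r r' sequentially"
    by (auto simp: uniformly_convergent_eq_Cauchy[symmetric] uniformly_convergent_on_def)
  from resolvent_on_uniform_limit[OF r K this] show ?thesis by blast
qed

section \<open>Bernstein approximation\<close>

lemma grid_point_mem:
  fixes T :: real
  assumes "0 \<le> T" "k \<le> n"
  shows "T * real k / real n \<in> {0..T}"
proof -
  have "real k / real n \<le> 1" using assms by (cases "n = 0") auto
  then have "T * (real k / real n) \<le> T" using assms(1) by (intro mult_left_le)
  then show ?thesis using assms by simp
qed

lemma bernstein_eq_Bernstein:
  assumes "0 < T"
  shows "bernstein T K n t = (\<Sum>k\<le>n. K (T * real k / real n) * Bernstein n k (t / T))"
  unfolding bernstein_def sum_distrib_left
proof (rule sum.cong[OF refl])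
  fix k assume "k \<in> {..n}"
  then have "T ^ n = T ^ k * T ^ (n - k)" by (simp flip: power_add)
  moreover have "1 - t / T = (T - t) / T" using assms by (simp add: field_simps)
  ultimately show "1 / T ^ n * (K (T * real k / real n) * real (n choose k) * t ^ k * (T - t) ^ (n - k)) =
      K (T * real k / real n) * Bernstein n k (t / T)"
    by (simp add: Bernstein_def power_divide)
qed

lemma bernstein_bound:
  assumes T: "0 < T" and K: "\<And>x. x \<in> {0..T} \<Longrightarrow> \<bar>K x\<bar> \<le> B" and t: "t \<in> {0..T}"
  shows "\<bar>bernstein T K n t\<bar> \<le> B"
proof -
  have "\<bar>K (T * real k / real n) * Bernstein n k (t / T)\<bar> \<le> B * Bernstein n k (t / T)" if "k \<le> n" for k
    using K[OF grid_point_mem[OF less_imp_le[OF T] that]] Bernstein_nonneg[of "t / T" n k] t T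
    by (simp add: abs_mult mult_right_mono)
  then have "\<bar>bernstein T K n t\<bar> \<le> (\<Sum>k\<le>n. B * Bernstein n k (t / T))"
    unfolding bernstein_eq_Bernstein[OF T] by (intro order_trans[OF sum_abs] sum_mono) auto
  then show ?thesis by (simp flip: sum_distrib_left)
qed

lemma uniform_limit_bernstein:
  assumes T: "0 < T" and K: "continuous_on {0..T} K"
  shows "uniform_limit {0..T} (bernstein T K) K sequentially"
proof (rule uniform_limitI)
  fix e :: real assume e: "0 < e"
  have "continuous_on {0..1} (\<lambda>x. K (T * x))"
    by (rule continuous_on_compose2[OF K]) (use T in \<open>auto intro!: continuous_intros mult_left_le\<close>)
  from Bernstein_Weierstrass[OF this e] obtain N where
    N: "\<And>n x. N \<le> n \<Longrightarrow> x \<in> {0..1} \<Longrightarrow> \<bar>K (T * x) - (\<Sum>k\<le>n. K (T * (real k / real n)) * Bernstein n k x)\<bar> < e"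
    by blast
  have "dist (bernstein T K n t) (K t) < e" if "N \<le> n" "t \<in> {0..T}" for n t
    using N[OF that(1), of "t / T"] that T
    by (simp add: bernstein_eq_Bernstein[OF T] dist_real_def abs_minus_commute)
  then show "\<forall>\<^sub>F n in sequentially. \<forall>x\<in>{0..T}. dist (bernstein T K n x) (K x) < e"
    by (intro eventually_sequentiallyI[of N]) blast
qed

lemma Bernstein_variance:
  assumes "1 \<le> n"
  shows "(\<Sum>k\<le>n. (real k / real n - x)\<^sup>2 * Bernstein n k x) = x * (1 - x) / real n"
proof -
  have "(\<Sum>k\<le>n. (real k / real n - x)\<^sup>2 * Bernstein n k x) =
     (\<Sum>k\<le>n. 1 / (real n)\<^sup>2 * (real k * (real k - 1) * Bernstein n k x)
        + (1 / (real n)\<^sup>2 - 2 * x / real n) * (real k * Bernstein n k x) + x\<^sup>2 * Bernstein n k x)"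
    by (rule sum.cong) (use assms in \<open>auto simp: power2_eq_square field_simps\<close>)
  also have "\<dots> = 1 / (real n)\<^sup>2 * (real n * (real n - 1) * x\<^sup>2)
        + (1 / (real n)\<^sup>2 - 2 * x / real n) * (real n * x) + x\<^sup>2"
    by (simp only: sum.distrib sum_distrib_left[symmetric] sum_k_Bernstein sum_kk_Bernstein sum_Bernstein
        mult_1_right)
  also have "\<dots> = x * (1 - x) / real n"
    using assms by (simp add: power2_eq_square field_simps)
  finally show ?thesis .
qed

lemma abs_powr_le_quadratic:
  fixes x d :: real
  assumes "0 < d" "0 < h" "h \<le> 2"
  shows "\<bar>x\<bar> powr h \<le> d powr h * (1 + x\<^sup>2 / d\<^sup>2)"
proof (cases "\<bar>x\<bar> \<le> d")
  case True
  then have "\<bar>x\<bar> powr h \<le> d powr h" using assms by (intro powr_mono2) auto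
  also have "\<dots> \<le> d powr h * (1 + x\<^sup>2 / d\<^sup>2)" using mult_left_mono[of 1 "1 + x\<^sup>2 / d\<^sup>2" "d powr h"] by simp
  finally show ?thesis .
next
  case False
  have "\<bar>x\<bar> powr h = d powr h * (\<bar>x\<bar> / d) powr h" using assms by (simp flip: powr_mult)
  also have "\<dots> \<le> d powr h * (\<bar>x\<bar> / d) powr 2"
    using False assms by (intro mult_left_mono powr_mono) auto
  also have "\<dots> = d powr h * (x\<^sup>2 / d\<^sup>2)"
    using False assms by (simp add: powr_numeral power_divide)
  also have "\<dots> \<le> d powr h * (1 + x\<^sup>2 / d\<^sup>2)" by (intro mult_left_mono) auto
  finally show ?thesis .
qed

lemma Bernstein_abs_moment_le:
  assumes n: "1 \<le> n" and x: "0 \<le> x" "x \<le> 1" and h: "0 < h" "h \<le> 2"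
  shows "(\<Sum>k\<le>n. \<bar>real k / real n - x\<bar> powr h * Bernstein n k x) \<le> 2 * real n powr (- h / 2)"
proof -
  define d where "d = real n powr (- 1 / 2)"
  have d: "0 < d" "d\<^sup>2 = 1 / real n"
    using n by (simp_all add: d_def powr_minus_divide power_divide powr_half_sqrt)
  have d_powr: "d powr h = real n powr (- h / 2)" by (simp add: d_def powr_powr)
  have "(\<Sum>k\<le>n. \<bar>real k / real n - x\<bar> powr h * Bernstein n k x)
      \<le> (\<Sum>k\<le>n. d powr h * (1 + (real k / real n - x)\<^sup>2 / d\<^sup>2) * Bernstein n k x)"
    by (intro sum_mono mult_right_mono abs_powr_le_quadratic d h Bernstein_nonneg x)
  also have "\<dots> = d powr h *
      ((\<Sum>k\<le>n. Bernstein n k x) + real n * (\<Sum>k\<le>n. (real k / real n - x)\<^sup>2 * Bernstein n k x))"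
    by (simp add: d(2) sum.distrib algebra_simps flip: sum_distrib_left)
  also have "\<dots> = d powr h * (1 + x * (1 - x))"
    using n by (simp add: Bernstein_variance)
  also have "\<dots> \<le> d powr h * 2"
    using x by (intro mult_left_mono) (auto intro: mult_le_one)
  finally show ?thesis by (simp add: d_powr)
qed

lemma bernstein_holder_rate:
  assumes T: "0 < T" and h: "0 < h" "h \<le> 2"
    and K: "\<And>s t. s \<in> {0..T} \<Longrightarrow> t \<in> {0..T} \<Longrightarrow> \<bar>K s - K t\<bar> \<le> L * \<bar>s - t\<bar> powr h"
    and L: "0 \<le> L" and n: "1 \<le> n" and t: "t \<in> {0..T}"
  shows "\<bar>bernstein T K n t - K t\<bar> \<le> 2 * L * T powr h * real n powr (- h / 2)"
proof -
  define x where "x = t / T"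
  have x: "0 \<le> x" "x \<le> 1" "t = T * x" using t T by (auto simp: x_def)
  have "bernstein T K n t - K t = (\<Sum>k\<le>n. (K (T * real k / real n) - K t) * Bernstein n k x)"
    unfolding bernstein_eq_Bernstein[OF T] x_def[symmetric]
    by (simp add: left_diff_distrib sum_subtractf flip: sum_distrib_left)
  also have "\<bar>\<dots>\<bar> \<le> (\<Sum>k\<le>n. L * T powr h * (\<bar>real k / real n - x\<bar> powr h * Bernstein n k x))"
  proof (rule order_trans[OF sum_abs], rule sum_mono)
    fix k assume k: "k \<in> {..n}"
    have "\<bar>K (T * real k / real n) - K t\<bar> \<le> L * \<bar>T * real k / real n - t\<bar> powr h"
      using k T by (intro K t grid_point_mem) auto
    also have "T * real k / real n - t = T * (real k / real n - x)"
      by (simp add: x(3) right_diff_distrib)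
    also have "\<bar>T * (real k / real n - x)\<bar> = T * \<bar>real k / real n - x\<bar>"
      using T by (simp add: abs_mult)
    also have "L * (T * \<bar>real k / real n - x\<bar>) powr h = L * T powr h * \<bar>real k / real n - x\<bar> powr h"
      using T by (simp add: powr_mult)
    finally have "\<bar>K (T * real k / real n) - K t\<bar> \<le> L * T powr h * \<bar>real k / real n - x\<bar> powr h" .
    from mult_right_mono[OF this Bernstein_nonneg[OF x(1,2), of n k]]
    show "\<bar>(K (T * real k / real n) - K t) * Bernstein n k x\<bar>
        \<le> L * T powr h * (\<bar>real k / real n - x\<bar> powr h * Bernstein n k x)"
      using Bernstein_nonneg[OF x(1,2), of n k] by (simp add: abs_mult mult.assoc)
  qed
  also have "\<dots> \<le> L * T powr h * (2 * real n powr (- h / 2))"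
    unfolding sum_distrib_left[symmetric] using L by (intro mult_left_mono Bernstein_abs_moment_le n x h) auto
  finally show ?thesis by (simp add: mult_ac)
qed

lemma holder_on_nonneg_constant:
  assumes "holder_on h S f"
  obtains L where "0 \<le> L" "\<And>s t. s \<in> S \<Longrightarrow> t \<in> S \<Longrightarrow> \<bar>f s - f t\<bar> \<le> L * \<bar>s - t\<bar> powr h"
proof -
  obtain L where L: "\<And>s t. s \<in> S \<Longrightarrow> t \<in> S \<Longrightarrow> \<bar>f s - f t\<bar> \<le> L * \<bar>s - t\<bar> powr h"
    using assms unfolding holder_on_def by blast
  then have "\<bar>f s - f t\<bar> \<le> \<bar>L\<bar> * \<bar>s - t\<bar> powr h" if "s \<in> S" "t \<in> S" for s t
    using that by (intro order_trans[OF L mult_right_mono]) auto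
  then show thesis using that[of "\<bar>L\<bar>"] by simp
qed

lemma holder_on_imp_continuous_on:
  assumes h: "0 < h" and f: "holder_on h S f"
  shows "continuous_on S f"
  unfolding continuous_on_def
proof
  obtain L where L: "\<And>s t. s \<in> S \<Longrightarrow> t \<in> S \<Longrightarrow> \<bar>f s - f t\<bar> \<le> L * \<bar>s - t\<bar> powr h"
    using f unfolding holder_on_def by blast
  fix t assume t: "t \<in> S"
  have "((\<lambda>s. L * \<bar>s - t\<bar> powr h) \<longlongrightarrow> L * \<bar>t - t\<bar> powr h) (at t within S)"
    using h by (intro tendsto_intros tendsto_powr') (auto intro!: eventuallyI tendsto_eq_intros)
  then have "((\<lambda>s. L * \<bar>s - t\<bar> powr h) \<longlongrightarrow> 0) (at t within S)" by simp
  then have "((\<lambda>s. f s - f t) \<longlongrightarrow> 0) (at t within S)"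
    by (rule Lim_null_comparison[rotated]) (use L t in \<open>auto simp: eventually_at_filter\<close>)
  then show "(f \<longlongrightarrow> f t) (at t within S)" by (rule LIM_zero_cancel)
qed

lemma power_mult_diff_power_eq_sum:
  fixes t T :: real
  assumes "i \<le> n"
  shows "t ^ i * (T - t) ^ (n - i) =
    (\<Sum>k\<in>{i..n}. (-1) ^ (k - i) * real ((n - i) choose (k - i)) * T ^ (n - k) * t ^ k)"
proof -
  have "(T - t) ^ (n - i) = (\<Sum>j\<le>n - i. real ((n - i) choose j) * (- t) ^ j * T ^ (n - i - j))"
    using binomial_ring[of "- t" T "n - i"] by simp
  then have "t ^ i * (T - t) ^ (n - i) =
      (\<Sum>j\<in>{0..n - i}. (-1) ^ j * real ((n - i) choose j) * T ^ (n - (j + i)) * t ^ (j + i))"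
    by (simp add: sum_distrib_left power_add power_minus[of t] mult_ac add.commute atLeast0AtMost)
  also have "\<dots> = (\<Sum>k\<in>{0 + i..(n - i) + i}.
      (-1) ^ (k - i) * real ((n - i) choose (k - i)) * T ^ (n - k) * t ^ k)"
    unfolding sum.shift_bounds_cl_nat_ivl by simp
  finally show ?thesis using assms by simp
qed

lemma bernstein_eq_kappa:
  assumes T: "0 < T"
  shows "bernstein T K n t = (\<Sum>k\<le>n. kappa T K n k * t ^ k)"
proof -
  define a where "a i k = 1 / T ^ k *
    ((-1) ^ (k - i) * K (real i * T / real n) * real (n choose i) * real ((n - i) choose (k - i))) * t ^ k" for i k
  have "bernstein T K n t = (\<Sum>i\<le>n. \<Sum>k\<in>{i..n}. a i k)"
    unfolding bernstein_def sum_distrib_left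
  proof (rule sum.cong[OF refl])
    fix i assume "i \<in> {..n}"
    then have i: "i \<le> n" by simp
    have "1 / T ^ n * (K (T * real i / real n) * real (n choose i) * t ^ i * (T - t) ^ (n - i))
       = 1 / T ^ n * K (real i * T / real n) * real (n choose i) * (t ^ i * (T - t) ^ (n - i))"
      by (simp add: mult_ac)
    also have "\<dots> = (\<Sum>k\<in>{i..n}. a i k)"
      unfolding power_mult_diff_power_eq_sum[OF i] sum_distrib_left
      by (rule sum.cong) (use T in \<open>auto simp: a_def power_diff mult_ac\<close>)
    finally show "1 / T ^ n * (K (T * real i / real n) * real (n choose i) * t ^ i * (T - t) ^ (n - i))
        = (\<Sum>k\<in>{i..n}. a i k)" .
  qed
  also have "\<dots> = (\<Sum>i\<le>n. \<Sum>k | k \<in> {..n} \<and> i \<le> k. a i k)"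
    by (intro sum.cong) auto
  also have "\<dots> = (\<Sum>k\<le>n. \<Sum>i | i \<in> {..n} \<and> i \<le> k. a i k)"
    by (rule sum.swap_restrict) simp_all
  also have "\<dots> = (\<Sum>k\<le>n. \<Sum>i\<le>k. a i k)"
    by (intro sum.cong) auto
  also have "\<dots> = (\<Sum>k\<le>n. kappa T K n k * t ^ k)"
    by (simp add: a_def kappa_def sum_distrib_left sum_distrib_right)
  finally show ?thesis .
qed

section \<open>Resolvents of polynomial kernels\<close>

definition divided_power :: "nat \<Rightarrow> real \<Rightarrow> real" where
  "divided_power k t = t ^ k / fact k"

lemma continuous_on_divided_power [continuous_intros]: "continuous_on S (divided_power k)"
  unfolding divided_power_def by (intro continuous_intros) simp

lemma vconv_divided_power:
  assumes "0 \<le> t"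
  shows "vconv (divided_power k) (divided_power m) t = divided_power (k + m + 1) t"
proof -
  have integrate: "vconv (divided_power 0) (divided_power m) t = divided_power (Suc m) t" if "0 \<le> t" for m t
  proof -
    have "vconv (divided_power 0) (divided_power m) t = (\<integral>s. s ^ m * indicator {0..t} s \<partial>lborel) / fact m"
      by (simp add: vconv_def divided_power_def set_lebesgue_integral_def mult.commute)
    then show ?thesis using that by (simp add: integral_power divided_power_def field_simps)
  qed
  show ?thesis using assms
  proof (induction k arbitrary: t)
    case 0
    then show ?case using integrate by simp
  next
    case (Suc k)
    have "vconv (divided_power (Suc k)) (divided_power m) t
        = vconv (vconv (divided_power 0) (divided_power k)) (divided_power m) t"
      by (intro vconv_cong) (simp_all add: integrate)
    also have "\<dots> = vconv (divided_power 0) (vconv (divided_power k) (divided_power m)) t"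
      using Suc.prems
      by (intro vconv_assoc[of t, symmetric] borel_integrable_atLeastAtMost' continuous_intros) auto
    also have "\<dots> = vconv (divided_power 0) (divided_power (k + m + 1)) t"
      by (intro vconv_cong) (simp_all add: Suc.IH)
    finally show ?case using integrate[OF Suc.prems] by simp
  qed
qed

fun res_coeff :: "real \<Rightarrow> (nat \<Rightarrow> real) \<Rightarrow> nat \<Rightarrow> real" where
  "res_coeff \<beta> \<gamma> m = \<gamma> m - \<beta> * (\<Sum>i<m. res_coeff \<beta> \<gamma> i * \<gamma> (m - 1 - i))"

declare res_coeff.simps [simp del]

definition res_series :: "real \<Rightarrow> (nat \<Rightarrow> real) \<Rightarrow> real \<Rightarrow> real" where
  "res_series \<beta> \<gamma> t = (\<Sum>m. res_coeff \<beta> \<gamma> m * divided_power m t)"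

lemma res_coeff_bound:
  assumes \<gamma>: "\<And>k. \<bar>\<gamma> k\<bar> \<le> G"
  shows "\<bar>res_coeff \<beta> \<gamma> m\<bar> \<le> G * (1 + \<bar>\<beta>\<bar> * G) ^ m"
proof (induction m rule: less_induct)
  case (less m)
  have G: "0 \<le> G" using \<gamma>[of 0] by linarith
  have "\<bar>\<Sum>i<m. res_coeff \<beta> \<gamma> i * \<gamma> (m - 1 - i)\<bar> \<le> (\<Sum>i<m. G * (1 + \<bar>\<beta>\<bar> * G) ^ i * G)"
    by (rule order_trans[OF sum_abs]) (use less G \<gamma> in \<open>auto simp: abs_mult intro!: sum_mono mult_mono\<close>)
  then have "\<bar>\<beta> * (\<Sum>i<m. res_coeff \<beta> \<gamma> i * \<gamma> (m - 1 - i))\<bar> \<le> \<bar>\<beta>\<bar> * (\<Sum>i<m. G * (1 + \<bar>\<beta>\<bar> * G) ^ i * G)"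
    unfolding abs_mult by (rule mult_left_mono) simp
  also have "\<dots> = G * (\<bar>\<beta>\<bar> * G * (\<Sum>i<m. (1 + \<bar>\<beta>\<bar> * G) ^ i))"
    by (simp add: sum_distrib_left mult_ac)
  also have "\<dots> = G * ((1 + \<bar>\<beta>\<bar> * G) ^ m - 1)"
    using power_diff_1_eq[of "1 + \<bar>\<beta>\<bar> * G" m] by simp
  finally have "\<bar>\<beta> * (\<Sum>i<m. res_coeff \<beta> \<gamma> i * \<gamma> (m - 1 - i))\<bar> \<le> G * (1 + \<bar>\<beta>\<bar> * G) ^ m - G"
    by (simp add: right_diff_distrib)
  then show ?case
    using \<gamma>[of m] unfolding res_coeff.simps[of \<beta> \<gamma> m] by linarith
qed

lemma uniform_limit_res_series:
  assumes \<gamma>: "\<And>k. \<bar>\<gamma> k\<bar> \<le> G"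
  shows "uniform_limit {0..T} (\<lambda>M t. \<Sum>m<M. res_coeff \<beta> \<gamma> m * divided_power m t) (res_series \<beta> \<gamma>) sequentially"
  unfolding res_series_def
proof (rule Weierstrass_m_test)
  show "summable (\<lambda>m. G * (((1 + \<bar>\<beta>\<bar> * G) * T) ^ m / fact m))"
    using summable_exp[of "(1 + \<bar>\<beta>\<bar> * G) * T"] by (intro summable_mult) (simp add: divide_inverse mult.commute)
  fix m t assume t: "t \<in> {0..T}"
  have "0 \<le> G" using \<gamma>[of 0] by linarith
  then have "\<bar>res_coeff \<beta> \<gamma> m\<bar> * (t ^ m / fact m) \<le> G * (1 + \<bar>\<beta>\<bar> * G) ^ m * (T ^ m / fact m)"
    using t by (intro mult_mono res_coeff_bound \<gamma> divide_right_mono power_mono) auto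
  then show "norm (res_coeff \<beta> \<gamma> m * divided_power m t) \<le> G * (((1 + \<bar>\<beta>\<bar> * G) * T) ^ m / fact m)"
    using t by (simp add: divided_power_def abs_mult power_mult_distrib mult_ac)
qed

lemma continuous_on_res_series:
  assumes "\<And>k. \<bar>\<gamma> k\<bar> \<le> G"
  shows "continuous_on {0..T} (res_series \<beta> \<gamma>)"
  by (rule uniform_limit_theorem[OF _ uniform_limit_res_series[OF assms]])
     (auto intro!: always_eventually continuous_intros)

lemma sums_vconv_res_series:
  assumes \<gamma>: "\<And>k. \<bar>\<gamma> k\<bar> \<le> G" and t: "0 \<le> t"
  shows "(\<lambda>m. res_coeff \<beta> \<gamma> m * divided_power (k + m + 1) t) sums vconv (divided_power k) (res_series \<beta> \<gamma>) t"
proof -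
  have "vconv (divided_power k) (\<lambda>t. \<Sum>m<M. res_coeff \<beta> \<gamma> m * divided_power m t) t
      = (\<Sum>m<M. res_coeff \<beta> \<gamma> m * divided_power (k + m + 1) t)" for M
  proof -
    have "vconv (\<lambda>t. \<Sum>m<M. res_coeff \<beta> \<gamma> m * divided_power m t) (divided_power k) t
        = (\<Sum>m<M. vconv (\<lambda>t. res_coeff \<beta> \<gamma> m * divided_power m t) (divided_power k) t)"
      using t by (intro vconv_sum_left[of _ t] continuous_intros borel_integrable_atLeastAtMost') auto
    then show ?thesis
      using t
      by (simp add: vconv_commute[of "divided_power k"] vconv_cmult_left vconv_divided_power add.commute)
  qed
  moreover have "(\<lambda>M. vconv (divided_power k) (\<lambda>t. \<Sum>m<M. res_coeff \<beta> \<gamma> m * divided_power m t) t)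
      \<longlonglongrightarrow> vconv (divided_power k) (res_series \<beta> \<gamma>) t"
    using t
    by (intro tendsto_vconv[of t] uniform_limit_res_series[OF \<gamma>] uniform_limit_const continuous_intros) auto
  ultimately show ?thesis by (simp add: sums_def)
qed

lemma sums_divided_power_convolution:
  assumes \<gamma>: "\<And>k. \<bar>\<gamma> k\<bar> \<le> G" and supp: "\<And>k. n < k \<Longrightarrow> \<gamma> k = 0" and t: "0 \<le> t"
  shows "(\<lambda>M. (\<Sum>i<M. res_coeff \<beta> \<gamma> i * \<gamma> (M - 1 - i)) * divided_power M t) sums
    vconv (\<lambda>t. \<Sum>k\<le>n. \<gamma> k * divided_power k t) (res_series \<beta> \<gamma>) t"
proof -
  let ?b = "res_coeff \<beta> \<gamma>"
  have "(\<lambda>M. if k < M then ?b (M - Suc k) * divided_power M t else 0) sums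
      vconv (divided_power k) (res_series \<beta> \<gamma>) t" for k
    using sums_zero_iff_shift[of "Suc k" "\<lambda>M. if k < M then ?b (M - Suc k) * divided_power M t else 0"]
      sums_vconv_res_series[of \<gamma> G t \<beta> k, OF \<gamma> t]
    by (simp add: add.commute)
  then have "(\<lambda>M. \<Sum>k\<le>n. \<gamma> k * (if k < M then ?b (M - Suc k) * divided_power M t else 0)) sums
      (\<Sum>k\<le>n. \<gamma> k * vconv (divided_power k) (res_series \<beta> \<gamma>) t)"
    by (intro sums_sum sums_mult)
  also have "(\<Sum>k\<le>n. \<gamma> k * vconv (divided_power k) (res_series \<beta> \<gamma>) t)
      = vconv (\<lambda>t. \<Sum>k\<le>n. \<gamma> k * divided_power k t) (res_series \<beta> \<gamma>) t"
    using t by (subst vconv_sum_left[of _ t])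
      (auto intro!: continuous_intros borel_integrable_atLeastAtMost' continuous_on_res_series[OF \<gamma>]
        simp: vconv_cmult_left)
  also have "(\<lambda>M. \<Sum>k\<le>n. \<gamma> k * (if k < M then ?b (M - Suc k) * divided_power M t else 0))
      = (\<lambda>M. (\<Sum>i<M. ?b i * \<gamma> (M - 1 - i)) * divided_power M t)"
  proof
    fix M
    have "(\<Sum>k\<le>n. \<gamma> k * (if k < M then ?b (M - Suc k) * divided_power M t else 0))
        = (\<Sum>k<M. \<gamma> k * (?b (M - Suc k) * divided_power M t))"
      by (rule sum.mono_neutral_cong) (use supp in \<open>auto simp: not_le\<close>)
    also have "\<dots> = (\<Sum>i<M. \<gamma> (M - Suc i) * (?b i * divided_power M t))"
      by (subst sum.nat_diff_reindex[symmetric]) (auto intro!: sum.cong simp: Suc_diff_Suc)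
    also have "\<dots> = (\<Sum>i<M. ?b i * \<gamma> (M - 1 - i)) * divided_power M t"
      unfolding sum_distrib_right by (rule sum.cong) simp_all
    finally show "(\<Sum>k\<le>n. \<gamma> k * (if k < M then ?b (M - Suc k) * divided_power M t else 0))
        = (\<Sum>i<M. ?b i * \<gamma> (M - 1 - i)) * divided_power M t" .
  qed
  finally show ?thesis .
qed

lemma finite_support_bounded:
  fixes \<gamma> :: "nat \<Rightarrow> real"
  assumes "\<And>k. n < k \<Longrightarrow> \<gamma> k = 0"
  shows "\<exists>G. \<forall>k. \<bar>\<gamma> k\<bar> \<le> G"
proof (intro exI allI)
  show "\<bar>\<gamma> k\<bar> \<le> (\<Sum>k\<le>n. \<bar>\<gamma> k\<bar>)" for k
    using assms[of k] by (cases "k \<le> n") (auto intro: member_le_sum simp: sum_nonneg)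
qed

lemma resolvent_on_res_series:
  assumes supp: "\<And>k. n < k \<Longrightarrow> \<gamma> k = 0"
  shows "resolvent_on T \<beta> (\<lambda>t. \<Sum>k\<le>n. \<gamma> k * divided_power k t) (res_series \<beta> \<gamma>)" (is "resolvent_on T \<beta> ?P _")
  unfolding resolvent_on_def
proof (intro conjI ballI)
  obtain G where \<gamma>: "\<And>k. \<bar>\<gamma> k\<bar> \<le> G" using finite_support_bounded[of n \<gamma>] supp by blast
  show "continuous_on {0..T} ?P" by (intro continuous_intros)
  show "continuous_on {0..T} (res_series \<beta> \<gamma>)" by (rule continuous_on_res_series[OF \<gamma>])
  fix t assume t: "t \<in> {0..T}"
  have "(\<lambda>M. \<gamma> M * divided_power M t) sums ?P t"
    by (rule sums_finite) (use supp in auto)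
  then have "(\<lambda>M. \<gamma> M * divided_power M t
        - \<beta> * ((\<Sum>i<M. res_coeff \<beta> \<gamma> i * \<gamma> (M - 1 - i)) * divided_power M t)) sums
      (?P t - \<beta> * vconv ?P (res_series \<beta> \<gamma>) t)"
    using t by (intro sums_diff sums_mult sums_divided_power_convolution[OF \<gamma> supp]) auto
  moreover have "\<gamma> M * divided_power M t - \<beta> * ((\<Sum>i<M. res_coeff \<beta> \<gamma> i * \<gamma> (M - 1 - i)) * divided_power M t)
      = res_coeff \<beta> \<gamma> M * divided_power M t" for M
    unfolding res_coeff.simps[of \<beta> \<gamma> M] by (simp only: left_diff_distrib mult.assoc)
  ultimately show "res_series \<beta> \<gamma> t = ?P t - \<beta> * vconv ?P (res_series \<beta> \<gamma>) t"
    unfolding res_series_def by (simp add: sums_unique[symmetric])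
qed

definition taylor_coeff :: "real \<Rightarrow> (real \<Rightarrow> real) \<Rightarrow> nat \<Rightarrow> nat \<Rightarrow> real" where
  "taylor_coeff T K n k = (if k \<le> n then fact k * kappa T K n k else 0)"

abbreviation bernstein_resolvent :: "real \<Rightarrow> real \<Rightarrow> (real \<Rightarrow> real) \<Rightarrow> nat \<Rightarrow> real \<Rightarrow> real" where
  "bernstein_resolvent T \<beta> K n \<equiv> res_series \<beta> (taylor_coeff T K n)"

lemma resolvent_on_bernstein:
  assumes "0 < T"
  shows "resolvent_on T \<beta> (bernstein T K n) (bernstein_resolvent T \<beta> K n)"
proof -
  have bernstein_eq: "bernstein T K n = (\<lambda>t. \<Sum>k\<le>n. taylor_coeff T K n k * divided_power k t)"
    by (auto simp: bernstein_eq_kappa[OF assms] taylor_coeff_def divided_power_def fun_eq_iff intro!: sum.cong)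
  show ?thesis unfolding bernstein_eq by (rule resolvent_on_res_series) (simp add: taylor_coeff_def)
qed

lemma resolvent_on_exists:
  assumes T: "0 < T" and K: "continuous_on {0..T} K"
  shows "\<exists>r. resolvent_on T \<beta> K r"
proof -
  obtain B where "\<And>x. x \<in> {0..T} \<Longrightarrow> \<bar>K x\<bar> \<le> B"
    using continuous_on_Icc_bounded[OF K] by blast
  then show ?thesis
    by (rule resolvent_on_exists_uniform_limit[OF resolvent_on_bernstein[OF T] bernstein_bound[OF T]
          uniform_limit_bernstein[OF T K]])
qed

lemma bernstein_resolvent_rate:
  assumes T: "0 < T" and h: "0 < h" "h \<le> 2" and K: "holder_on h {0..T} K" and r: "resolvent_on T \<beta> K r"
  obtains C where "0 \<le> C"
    "\<And>n t. 1 \<le> n \<Longrightarrow> t \<in> {0..T} \<Longrightarrow> \<bar>bernstein_resolvent T \<beta> K n t - r t\<bar> \<le> C * real n powr (- h / 2)"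
proof -
  obtain L where L: "0 \<le> L" "\<And>s t. s \<in> {0..T} \<Longrightarrow> t \<in> {0..T} \<Longrightarrow> \<bar>K s - K t\<bar> \<le> L * \<bar>s - t\<bar> powr h"
    using holder_on_nonneg_constant[OF K] by blast
  obtain B where B: "0 < B" "\<And>x. x \<in> {0..T} \<Longrightarrow> \<bar>K x\<bar> \<le> B"
    using continuous_on_Icc_bounded[OF resolvent_on_continuous_kernel[OF r]] by blast
  define E where "E = exp (\<bar>\<beta>\<bar> * B * T)"
  define C where "C = 2 * L * T powr h * (1 + \<bar>\<beta>\<bar> * T * B * E) * E"
  show thesis
  proof (rule that[of C])
    show "0 \<le> C" unfolding C_def E_def using L(1) B(1) T by simp
    fix n :: nat and t assume n: "1 \<le> n" and t: "t \<in> {0..T}"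
    have "\<bar>bernstein_resolvent T \<beta> K n t - r t\<bar>
        \<le> 2 * L * T powr h * real n powr (- h / 2) * (1 + \<bar>\<beta>\<bar> * T * B * E) * E"
      unfolding E_def
      by (rule resolvent_on_stability[OF resolvent_on_bernstein[OF T] r bernstein_bound[OF T B(2)] B(2)
            bernstein_holder_rate[OF T h L(2,1) n] t])
    also have "\<dots> = C * real n powr (- h / 2)" by (simp add: C_def)
    finally show "\<bar>bernstein_resolvent T \<beta> K n t - r t\<bar> \<le> C * real n powr (- h / 2)" .
  qed
qed

section \<open>The operator exponential\<close>

definition cell :: "nat \<Rightarrow> real \<Rightarrow> real" where
  "cell j = indicator {- real j .. - real j + 1}"

lemma cell_measurable[measurable]: "cell j \<in> borel_measurable borel"
  unfolding cell_def by measurable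

lemma nu_eq_cell: "nu = cell 0"
  by (simp add: nu_def cell_def)

lemma cell_shift: "cell j (x + 1) = cell (Suc j) x"
  by (auto simp: cell_def indicator_def)

lemma has_bochner_integral_cell_cell:
  "has_bochner_integral lborel (\<lambda>x. cell k x * cell j x) (if k = j then 1 else 0)"
proof -
  have "(\<lambda>x. cell k x * cell j x) = indicator {max (- real k) (- real j) .. min (- real k + 1) (- real j + 1)}"
    by (auto simp: cell_def indicator_def fun_eq_iff)
  moreover have "measure lborel {max (- real k) (- real j) .. min (- real k + 1) (- real j + 1)}
      = (if k = j then 1 else 0)"
  proof (cases "k = j")
    case False
    then have "real k + 1 \<le> real j \<or> real j + 1 \<le> real k" by linarith
    then have "measure lborel {max (- real k) (- real j) .. min (- real k + 1) (- real j + 1)} = 0"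
      by (auto simp: measure_def emeasure_lborel_Icc_eq)
    then show ?thesis using False by simp
  qed simp
  ultimately show ?thesis
    by (auto simp: has_bochner_integral_iff emeasure_lborel_Icc_eq)
qed

lemma square_integrable_cell: "square_integrable lborel (cell j)"
  using has_bochner_integral_cell_cell[of j j]
  by (simp add: square_integrable_def power2_eq_square has_bochner_integral_iff)

lemma sq_norm_nu: "sq_norm lborel nu = 1"
  using has_bochner_integral_cell_cell[of 0 0]
  by (simp add: nu_eq_cell sq_norm_eq_integral square_integrable_cell power2_eq_square has_bochner_integral_iff)

lemma g_fun_eq_cells: "g_fun T K n = (\<lambda>x. \<Sum>k\<le>n. taylor_coeff T K n k * cell k x)"
  by (simp add: g_fun_def taylor_coeff_def cell_def)

lemma square_integrable_g_fun: "square_integrable lborel (g_fun T K n)"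
  unfolding g_fun_eq_cells by (intro square_integrable_sum square_integrable_cmult square_integrable_cell)

lemma has_bochner_integral_g_fun_cell:
  "has_bochner_integral lborel (\<lambda>x. g_fun T K n x * cell j x) (taylor_coeff T K n j)"
proof -
  have "has_bochner_integral lborel (\<lambda>x. \<Sum>k\<le>n. taylor_coeff T K n k * (cell k x * cell j x))
      (\<Sum>k\<le>n. taylor_coeff T K n k * (if k = j then 1 else 0))"
    by (intro has_bochner_integral_sum has_bochner_integral_mult_right has_bochner_integral_cell_cell)
  also have "(\<Sum>k\<le>n. taylor_coeff T K n k * (if k = j then 1 else 0)) = taylor_coeff T K n j"
    by (simp add: if_distrib[of "\<lambda>x. _ * x"] taylor_coeff_def cong: if_cong)
  finally show ?thesis by (simp add: g_fun_eq_cells sum_distrib_right mult.assoc)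
qed

lemma has_bochner_integral_g_fun_res_coeff:
  fixes T :: real and K :: "real \<Rightarrow> real" and n :: nat
  defines "\<gamma> \<equiv> taylor_coeff T K n"
  shows "has_bochner_integral lborel
    (\<lambda>x. g_fun T K n x * (cell m x - \<beta> * (\<Sum>i<m. res_coeff \<beta> \<gamma> i * cell (m - 1 - i) x))) (res_coeff \<beta> \<gamma> m)"
proof -
  have "has_bochner_integral lborel (\<lambda>x. g_fun T K n x * cell m x
        - \<beta> * (\<Sum>i<m. res_coeff \<beta> \<gamma> i * (g_fun T K n x * cell (m - 1 - i) x)))
      (\<gamma> m - \<beta> * (\<Sum>i<m. res_coeff \<beta> \<gamma> i * \<gamma> (m - 1 - i)))"
    unfolding \<gamma>_def
    by (intro has_bochner_integral_diff has_bochner_integral_mult_right has_bochner_integral_sum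
        has_bochner_integral_g_fun_cell)
  then show ?thesis
    unfolding res_coeff.simps[of \<beta> \<gamma> m] by (simp add: right_diff_distrib sum_distrib_left mult.left_commute)
qed

text \<open>
  Duhamel's formula for the perturbation \<open>- \<beta> \<langle>g, \<cdot>\<rangle> \<nu>\<close> of the shift: the numbers \<open>\<langle>g, A^i \<nu>\<rangle>\<close>, with \<open>A\<close> the
  perturbed operator, satisfy the recursion for the Taylor coefficients of the resolvent.
\<close>
lemma Abar_funpow_nu:
  fixes T :: real and K :: "real \<Rightarrow> real" and n :: nat
  defines "\<gamma> \<equiv> taylor_coeff T K n"
  shows "(Abar \<beta> T K n ^^ m) nu = (\<lambda>x. cell m x - \<beta> * (\<Sum>i<m. res_coeff \<beta> \<gamma> i * cell (m - 1 - i) x))"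
proof (induction m)
  case 0
  then show ?case by (simp add: nu_eq_cell)
next
  case (Suc m)
  have "l2_inner (g_fun T K n) ((Abar \<beta> T K n ^^ m) nu) = res_coeff \<beta> \<gamma> m"
    using has_bochner_integral_g_fun_res_coeff[of T K n m \<beta>] unfolding Suc.IH l2_inner_def \<gamma>_def
    by (rule has_bochner_integral_integral_eq)
  then have "(Abar \<beta> T K n ^^ Suc m) nu x = ((Abar \<beta> T K n ^^ m) nu) (x + 1) - \<beta> * res_coeff \<beta> \<gamma> m * nu x" for x
    by (simp add: Abar_def shiftA_def)
  then have "(Abar \<beta> T K n ^^ Suc m) nu x = cell (Suc m) x
      - \<beta> * (\<Sum>i<m. res_coeff \<beta> \<gamma> i * cell (Suc (m - 1 - i)) x) - \<beta> * res_coeff \<beta> \<gamma> m * cell 0 x" for x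
    unfolding Suc.IH by (simp only: cell_shift nu_eq_cell)
  moreover have "(\<Sum>i<m. res_coeff \<beta> \<gamma> i * cell (Suc (m - 1 - i)) x)
      = (\<Sum>i<m. res_coeff \<beta> \<gamma> i * cell (m - i) x)" for x
    by (rule sum.cong) (auto simp: Suc_diff_Suc)
  ultimately show ?case by (simp add: fun_eq_iff distrib_left)
qed

lemma square_integrable_Abar_funpow_nu: "square_integrable lborel ((Abar \<beta> T K n ^^ m) nu)"
  unfolding Abar_funpow_nu
  by (intro square_integrable_diff square_integrable_cmult square_integrable_sum square_integrable_cell)

lemma sq_norm_shiftA: "f \<in> borel_measurable borel \<Longrightarrow> sq_norm lborel (shiftA f) = sq_norm lborel f"
  using nn_integral_real_affine[of "\<lambda>x. ennreal ((f x)\<^sup>2)" 1 1]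
  by (simp add: sq_norm_def shiftA_def add.commute)

lemma sq_norm_Abar_le:
  assumes [measurable]: "f \<in> borel_measurable borel"
  shows "sq_norm lborel (Abar \<beta> T K n f)
    \<le> (2 + 2 * ennreal (\<beta>\<^sup>2) * sq_norm lborel (g_fun T K n)) * sq_norm lborel f"
proof -
  define c where "c = l2_inner (g_fun T K n) f"
  have [measurable]: "g_fun T K n \<in> borel_measurable lborel" "shiftA f \<in> borel_measurable lborel"
    "nu \<in> borel_measurable lborel"
    unfolding g_fun_eq_cells shiftA_def nu_eq_cell by measurable
  have "sq_norm lborel (Abar \<beta> T K n f)
      \<le> 2 * sq_norm lborel (shiftA f) + 2 * sq_norm lborel (\<lambda>x. - (\<beta> * c) * nu x)"
    using sq_norm_add_le[of "shiftA f" lborel "\<lambda>x. - (\<beta> * c) * nu x"] by (simp add: Abar_def c_def)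
  also have "sq_norm lborel (\<lambda>x. - (\<beta> * c) * nu x) = ennreal (\<beta>\<^sup>2) * ennreal (c\<^sup>2)"
    by (subst sq_norm_cmult) (simp_all add: sq_norm_nu power_mult_distrib ennreal_mult)
  also have "sq_norm lborel (shiftA f) = sq_norm lborel f" by (rule sq_norm_shiftA[OF assms])
  also have "ennreal (c\<^sup>2) \<le> sq_norm lborel (g_fun T K n) * sq_norm lborel f"
    unfolding c_def l2_inner_def by (rule Cauchy_Schwarz_sq_norm) measurable
  finally show ?thesis
    by (simp add: distrib_right mult.assoc add_left_mono mult_left_mono)
qed

lemma sq_norm_Abar_funpow_nu_le:
  "sq_norm lborel ((Abar \<beta> T K n ^^ m) nu) \<le> (2 + 2 * ennreal (\<beta>\<^sup>2) * sq_norm lborel (g_fun T K n)) ^ m"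
proof (induction m)
  case (Suc m)
  show ?case
    using order_trans[OF sq_norm_Abar_le mult_left_mono[OF Suc.IH]]
      square_integrable_Abar_funpow_nu[of m \<beta> T K n]
    by (simp add: square_integrable_def)
qed (simp add: sq_norm_nu)

lemma L2_limit_exp_Abar_nu:
  "L2_limit lborel (\<lambda>N x. \<Sum>m<N. s ^ m / fact m * ((Abar \<beta> T K n ^^ m) nu) x) (exp_Abar_nu \<beta> T K n s)"
proof -
  define f where "f N x = (\<Sum>m<N. s ^ m / fact m * ((Abar \<beta> T K n ^^ m) nu) x)" for N x
  have [measurable]: "(Abar \<beta> T K n ^^ m) nu \<in> borel_measurable lborel" for m
    by (rule square_integrable_measurable[OF square_integrable_Abar_funpow_nu])
  have f_measurable: "f N \<in> borel_measurable lborel" for N unfolding f_def by measurable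
  define R where "R = 2 + 2 * \<beta>\<^sup>2 * (\<integral>x. (g_fun T K n x)\<^sup>2 \<partial>lborel)"
  have R: "0 < R" unfolding R_def by (intro add_pos_nonneg mult_nonneg_nonneg) auto
  have ennreal_R: "2 + 2 * ennreal (\<beta>\<^sup>2) * sq_norm lborel (g_fun T K n) = ennreal R"
    unfolding sq_norm_eq_integral[OF square_integrable_g_fun] R_def by (simp add: ennreal_mult)
  define c where "c k = ((\<bar>s\<bar> + 1) * sqrt R) ^ k / fact k" for k
  have "L2_limit lborel f (\<lambda>x. lim (\<lambda>k. f k x))"
  proof (rule L2_limit_lim_if_summable_steps[OF f_measurable])
    show "0 < c k" for k using R by (simp add: c_def)
    show "summable c"
      using summable_exp[of "(\<bar>s\<bar> + 1) * sqrt R"] by (simp add: c_def[abs_def] divide_inverse mult.commute)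
    fix k
    have "sq_norm lborel (\<lambda>x. f (Suc k) x - f k x)
        = sq_norm lborel (\<lambda>x. s ^ k / fact k * ((Abar \<beta> T K n ^^ k) nu) x)"
      by (simp add: f_def)
    also have "\<dots> = ennreal ((s ^ k / fact k)\<^sup>2) * sq_norm lborel ((Abar \<beta> T K n ^^ k) nu)"
      by (rule sq_norm_cmult) measurable
    also have "\<dots> \<le> ennreal ((s ^ k / fact k)\<^sup>2) * ennreal R ^ k"
      unfolding ennreal_R[symmetric] by (intro mult_left_mono sq_norm_Abar_funpow_nu_le) simp
    also have "\<dots> = ennreal ((\<bar>s\<bar> ^ k / fact k)\<^sup>2 * R ^ k)"
      using R by (simp add: ennreal_power power_divide flip: power_abs ennreal_mult)
    also have "\<dots> \<le> ennreal (((\<bar>s\<bar> + 1) ^ k / fact k)\<^sup>2 * R ^ k)"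
      using R by (intro ennreal_leI mult_right_mono power_mono divide_right_mono) auto
    also have "R ^ k = (sqrt R ^ k)\<^sup>2"
      using R by (simp flip: real_sqrt_power)
    also have "((\<bar>s\<bar> + 1) ^ k / fact k)\<^sup>2 * (sqrt R ^ k)\<^sup>2 = (c k)\<^sup>2"
      by (simp add: c_def power_mult_distrib power_divide)
    finally show "sq_norm lborel (\<lambda>x. f (Suc k) x - f k x) \<le> ennreal ((c k)\<^sup>2)" .
  qed
  then have "L2_limit lborel f (SOME F. L2_limit lborel f F)" by (rule someI[of "L2_limit lborel f"])
  then show ?thesis unfolding exp_Abar_nu_def L2_limit_def sq_norm_def f_def .
qed

lemma l2_inner_exp_Abar_nu:
  "l2_inner (g_fun T K n) (exp_Abar_nu \<beta> T K n s) = bernstein_resolvent T \<beta> K n s"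
proof -
  let ?f = "\<lambda>N x. \<Sum>m<N. s ^ m / fact m * ((Abar \<beta> T K n ^^ m) nu) x"
  have "has_bochner_integral lborel
      (\<lambda>x. \<Sum>m<N. s ^ m / fact m * (g_fun T K n x * ((Abar \<beta> T K n ^^ m) nu) x))
      (\<Sum>m<N. s ^ m / fact m * res_coeff \<beta> (taylor_coeff T K n) m)" for N
    unfolding Abar_funpow_nu
    by (intro has_bochner_integral_sum has_bochner_integral_mult_right has_bochner_integral_g_fun_res_coeff)
  from has_bochner_integral_integral_eq[OF this]
  have "(\<integral>x. g_fun T K n x * ?f N x \<partial>lborel)
      = (\<Sum>m<N. res_coeff \<beta> (taylor_coeff T K n) m * divided_power m s)" for N
    by (simp add: sum_distrib_left mult_ac divided_power_def)
  moreover have "(\<lambda>N. \<integral>x. g_fun T K n x * ?f N x \<partial>lborel) \<longlonglongrightarrow> l2_inner (g_fun T K n) (exp_Abar_nu \<beta> T K n s)"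
    unfolding l2_inner_def
    by (intro L2_limit_integral_mult L2_limit_exp_Abar_nu square_integrable_sum square_integrable_cmult
        square_integrable_Abar_funpow_nu square_integrable_g_fun)
  ultimately show ?thesis by (simp add: res_series_def sums_def[symmetric] sums_iff)
qed

section \<open>The Wiener integral\<close>

locale brownian =
  fixes M :: "'a measure" and W :: "real \<Rightarrow> 'a \<Rightarrow> real"
  assumes brownian_motion: "brownian_motion M W"
begin

sublocale prob_space M using brownian_motion by (simp add: brownian_motion_def)

lemma W_measurable[measurable]: "W t \<in> borel_measurable M"
  using brownian_motion by (simp add: brownian_motion_def)

lemma W_continuous: "\<omega> \<in> space M \<Longrightarrow> continuous_on {0..} (\<lambda>t. W t \<omega>)"
  using brownian_motion by (simp add: brownian_motion_def)

lemma distributed_increment: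
  "0 \<le> s \<Longrightarrow> s < t \<Longrightarrow> distributed M lborel (\<lambda>\<omega>. W t \<omega> - W s \<omega>) (normal_density 0 (sqrt (t - s)))"
  using brownian_motion by (simp add: brownian_motion_def)

lemma square_integrable_increment:
  assumes "0 \<le> s" "s \<le> t"
  shows "square_integrable M (\<lambda>\<omega>. W t \<omega> - W s \<omega>)"
proof (cases "s = t")
  case False
  then have s_less_t: "0 < sqrt (t - s)" "s < t" using assms by auto
  have "integrable M (\<lambda>\<omega>. (W t \<omega> - W s \<omega>)\<^sup>2)"
    using distributed_integrable[OF distributed_increment[OF assms(1) s_less_t(2)], of "\<lambda>x. x\<^sup>2"]
      integrable_normal_moment[OF s_less_t(1), of 0 2]
    by (simp add: normal_density_nonneg)
  then show ?thesis by (simp add: square_integrable_def)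
qed (simp add: square_integrable_def)

lemma expectation_increment:
  assumes "0 \<le> s" "s \<le> t"
  shows "expectation (\<lambda>\<omega>. W t \<omega> - W s \<omega>) = 0"
  using normal_distributed_expectation[OF _ distributed_increment[of s t]] assms
  by (cases "s = t") simp_all

lemma expectation_increment_square:
  assumes "0 \<le> s" "s \<le> t"
  shows "expectation (\<lambda>\<omega>. (W t \<omega> - W s \<omega>)\<^sup>2) = t - s"
  using normal_distributed_variance[OF _ distributed_increment[of s t]] expectation_increment[OF assms] assms
  by (cases "s = t") simp_all

definition grid_incr :: "real \<Rightarrow> nat \<Rightarrow> nat \<Rightarrow> 'a \<Rightarrow> real" where
  "grid_incr t N i \<omega> = W (t * real (Suc i) / real N) \<omega> - W (t * real i / real N) \<omega>"

lemma square_integrable_grid_incr: "0 \<le> t \<Longrightarrow> square_integrable M (grid_incr t N i)"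
  unfolding grid_incr_def[abs_def]
  by (intro square_integrable_increment divide_right_mono mult_left_mono) simp_all

lemma grid_incr_measurable[measurable]: "grid_incr t N i \<in> borel_measurable M"
  unfolding grid_incr_def[abs_def] by measurable

lemma expectation_grid_incr: "0 \<le> t \<Longrightarrow> expectation (grid_incr t N i) = 0"
  unfolding grid_incr_def[abs_def]
  by (intro expectation_increment divide_right_mono mult_left_mono) simp_all

lemma expectation_grid_incr_square:
  assumes "0 \<le> t"
  shows "expectation (\<lambda>\<omega>. (grid_incr t N i \<omega>)\<^sup>2) = t / real N"
proof -
  have "t * real i / real N \<le> t * real (Suc i) / real N"
    using assms by (intro divide_right_mono mult_left_mono) auto
  then have "expectation (\<lambda>\<omega>. (grid_incr t N i \<omega>)\<^sup>2) = t * real (Suc i) / real N - t * real i / real N"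
    unfolding grid_incr_def using assms by (intro expectation_increment_square) simp_all
  then show ?thesis by (simp add: diff_divide_distrib[symmetric] algebra_simps)
qed

lemma indep_vars_grid_incr:
  assumes "0 \<le> t"
  shows "indep_vars (\<lambda>_. borel) (grid_incr t N) {..<N}"
proof -
  let ?ts = "map (\<lambda>i. t * real i / real N) [0..<Suc N]"
  have "sorted ?ts"
    unfolding sorted_iff_nth_mono using assms
    by (auto simp del: upt_Suc intro!: divide_right_mono mult_left_mono)
  moreover have "?ts \<noteq> []" "0 \<le> hd ?ts" by (simp_all del: upt_Suc add: hd_map)
  ultimately have "indep_vars (\<lambda>_. borel) (\<lambda>i \<omega>. W (?ts ! Suc i) \<omega> - W (?ts ! i) \<omega>) {..<length ?ts - 1}"
    using brownian_motion unfolding brownian_motion_def by blast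
  then show ?thesis
    by (subst indep_vars_cong[OF refl _ refl, of _ _ "\<lambda>i \<omega>. W (?ts ! Suc i) \<omega> - W (?ts ! i) \<omega>"])
       (auto simp: grid_incr_def fun_eq_iff simp del: upt_Suc)
qed

lemma expectation_grid_incr_mult:
  assumes t: "0 \<le> t" and indices: "i < N" "j < N"
  shows "expectation (\<lambda>\<omega>. grid_incr t N i \<omega> * grid_incr t N j \<omega>) = (if i = j then t / real N else 0)"
proof (cases "i = j")
  case True
  then show ?thesis using expectation_grid_incr_square[OF t, of N j] by (simp add: power2_eq_square)
next
  case False
  have "indep_vars (\<lambda>_. borel) (grid_incr t N) {i, j}"
    by (rule indep_vars_subset[OF indep_vars_grid_incr[OF t]]) (use indices in auto)
  from indep_vars_lebesgue_integral[OF _ this] show ?thesis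
    using False integrable_if_square_integrable[OF square_integrable_grid_incr[OF t]]
    by (simp add: expectation_grid_incr[OF t])
qed

lemma grid_incr_isometry:
  assumes t: "0 \<le> t"
  shows "sq_norm M (\<lambda>\<omega>. \<Sum>i<N. a i * grid_incr t N i \<omega>) = ennreal (\<Sum>i<N. (a i)\<^sup>2 * (t / real N))"
proof -
  have product_integrable: "integrable M (\<lambda>\<omega>. a i * a j * (grid_incr t N i \<omega> * grid_incr t N j \<omega>))" for i j
    by (intro integrable_mult_right integrable_mult_square_integrable square_integrable_grid_incr t)
  have "expectation (\<lambda>\<omega>. (\<Sum>i<N. a i * grid_incr t N i \<omega>)\<^sup>2)
      = expectation (\<lambda>\<omega>. \<Sum>i<N. \<Sum>j<N. a i * a j * (grid_incr t N i \<omega> * grid_incr t N j \<omega>))"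
    by (simp add: power2_eq_square sum_product mult_ac)
  also have "\<dots> = (\<Sum>i<N. \<Sum>j<N. a i * a j * expectation (\<lambda>\<omega>. grid_incr t N i \<omega> * grid_incr t N j \<omega>))"
    using product_integrable by (simp add: Bochner_Integration.integral_sum Bochner_Integration.integrable_sum)
  also have "\<dots> = (\<Sum>i<N. \<Sum>j<N. if j = i then (a i)\<^sup>2 * (t / real N) else 0)"
    by (intro sum.cong refl) (auto simp: expectation_grid_incr_mult[OF t] power2_eq_square)
  also have "\<dots> = (\<Sum>i<N. (a i)\<^sup>2 * (t / real N))"
    by (simp add: sum.delta)
  finally show ?thesis
    by (subst sq_norm_eq_integral)
       (auto intro!: square_integrable_sum square_integrable_cmult square_integrable_grid_incr t)
qed

definition wiener_sum :: "(real \<Rightarrow> real) \<Rightarrow> real \<Rightarrow> nat \<Rightarrow> 'a \<Rightarrow> real" where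
  "wiener_sum f t N \<omega> = (\<Sum>i<N. f (t * real i / real N) * grid_incr t N i \<omega>)"

lemma wiener_sum_measurable[measurable]: "wiener_sum f t N \<in> borel_measurable M"
  unfolding wiener_sum_def[abs_def] by measurable

lemma wiener_sum_cong:
  assumes "0 \<le> t" "\<And>x. x \<in> {0..t} \<Longrightarrow> f x = g x"
  shows "wiener_sum f t N \<omega> = wiener_sum g t N \<omega>"
  unfolding wiener_sum_def using assms
  by (intro sum.cong refl arg_cong2[where f = "(*)"] assms(2) grid_point_mem) auto

lemma square_integrable_wiener_sum: "0 \<le> t \<Longrightarrow> square_integrable M (wiener_sum f t N)"
  unfolding wiener_sum_def[abs_def]
  by (intro square_integrable_sum square_integrable_cmult square_integrable_grid_incr)

lemma expectation_wiener_sum: "0 \<le> t \<Longrightarrow> expectation (wiener_sum f t N) = 0"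
  unfolding wiener_sum_def[abs_def]
  by (subst Bochner_Integration.integral_sum)
     (simp_all add: expectation_grid_incr integrable_if_square_integrable[OF square_integrable_grid_incr])

lemma sq_norm_wiener_sum_le:
  assumes t: "0 \<le> t" and f: "\<And>x. x \<in> {0..t} \<Longrightarrow> \<bar>f x\<bar> \<le> B"
  shows "sq_norm M (wiener_sum f t N) \<le> ennreal (B\<^sup>2 * t)"
proof -
  have "(f (t * real i / real N))\<^sup>2 \<le> B\<^sup>2" if "i < N" for i
    using f[OF grid_point_mem[OF t less_imp_le[OF that]]] abs_le_square_iff[of _ B] by simp
  then have "(\<Sum>i<N. (f (t * real i / real N))\<^sup>2 * (t / real N)) \<le> (\<Sum>i<N. B\<^sup>2 * (t / real N))"
    using t by (intro sum_mono mult_right_mono) auto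
  also have "\<dots> \<le> B\<^sup>2 * t" using t by (cases "N = 0") simp_all
  finally show ?thesis
    unfolding wiener_sum_def grid_incr_isometry[OF t] by (rule ennreal_leI)
qed

lemma sum_grid_incr_block:
  assumes "0 < k"
  shows "(\<Sum>j\<in>{i * k..<i * k + k}. grid_incr t (N * k) j \<omega>) = grid_incr t N i \<omega>"
proof -
  have "(\<Sum>j\<in>{i * k..<i * k + k}. grid_incr t (N * k) j \<omega>)
      = W (t * real (i * k + k) / real (N * k)) \<omega> - W (t * real (i * k) / real (N * k)) \<omega>"
    unfolding grid_incr_def by (rule sum_Suc_diff'[where f = "\<lambda>j. W (t * real j / real (N * k)) \<omega>"]) simp
  moreover have "t * real (i * k + k) / real (N * k) = t * real (Suc i) / real N"
    "t * real (i * k) / real (N * k) = t * real i / real N"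
    using assms by (cases "N = 0"; simp add: field_simps)+
  ultimately show ?thesis by (simp add: grid_incr_def)
qed

lemma wiener_sum_refine:
  assumes "0 < k"
  shows "wiener_sum f t N \<omega> = (\<Sum>j<N * k. f (t * real (j div k) / real N) * grid_incr t (N * k) j \<omega>)"
proof -
  have "(\<Sum>j<N * k. f (t * real (j div k) / real N) * grid_incr t (N * k) j \<omega>) =
    (\<Sum>i<N. \<Sum>j\<in>{i * k..<i * k + k}. f (t * real (j div k) / real N) * grid_incr t (N * k) j \<omega>)"
    by (rule sum.nat_group[symmetric])
  also have "\<dots> = (\<Sum>i<N. \<Sum>j\<in>{i * k..<i * k + k}. f (t * real i / real N) * grid_incr t (N * k) j \<omega>)"
  proof (intro sum.cong refl)
    fix i j assume "j \<in> {i * k..<i * k + k}"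
    then have "j div k = i" using assms by (intro div_nat_eqI) (auto simp: mult.commute)
    then show "f (t * real (j div k) / real N) * grid_incr t (N * k) j \<omega>
        = f (t * real i / real N) * grid_incr t (N * k) j \<omega>" by simp
  qed
  also have "\<dots> = wiener_sum f t N \<omega>"
    unfolding wiener_sum_def sum_distrib_left[symmetric] sum_grid_incr_block[OF assms] ..
  finally show ?thesis by (rule sym)
qed

lemma coarse_grid_point_dist:
  assumes t: "0 \<le> t" and k: "0 < k"
  shows "\<bar>t * real (j div k) / real N - t * real j / real (N * k)\<bar> \<le> t / real N"
proof -
  have "real j = real k * real (j div k) + real (j mod k)"
    by (metis mult_div_mod_eq of_nat_add of_nat_mult)
  then have "\<bar>real (j div k) - real j / real k\<bar> \<le> 1"
    using k by (simp add: field_simps less_imp_le)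
  then have "t / real N * \<bar>real (j div k) - real j / real k\<bar> \<le> t / real N"
    using t by (intro mult_left_le) auto
  moreover have "t * real (j div k) / real N - t * real j / real (N * k)
      = t / real N * (real (j div k) - real j / real k)"
    by (simp add: right_diff_distrib)
  ultimately show ?thesis using t by (simp add: abs_mult)
qed

lemma sq_norm_wiener_sum_refine_le:
  assumes t: "0 \<le> t" and k: "0 < k"
    and f: "\<And>x y. x \<in> {0..t} \<Longrightarrow> y \<in> {0..t} \<Longrightarrow> \<bar>x - y\<bar> \<le> t / real N \<Longrightarrow> \<bar>f x - f y\<bar> \<le> e"
  shows "sq_norm M (\<lambda>\<omega>. wiener_sum f t N \<omega> - wiener_sum f t (N * k) \<omega>) \<le> ennreal (e\<^sup>2 * t)"
proof -
  define a where "a j = f (t * real (j div k) / real N) - f (t * real j / real (N * k))" for j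
  have "(a j)\<^sup>2 \<le> e\<^sup>2" if "j < N * k" for j
  proof -
    have "j div k \<le> N" using less_mult_imp_div_less[OF that] by simp
    then have "\<bar>a j\<bar> \<le> e"
      unfolding a_def using that by (intro f grid_point_mem coarse_grid_point_dist t k) auto
    then show ?thesis using abs_le_square_iff[of "a j" e] by simp
  qed
  then have "(\<Sum>j<N * k. (a j)\<^sup>2 * (t / real (N * k))) \<le> (\<Sum>j<N * k. e\<^sup>2 * (t / real (N * k)))"
    using t by (intro sum_mono mult_right_mono) auto
  also have "\<dots> \<le> e\<^sup>2 * t" using t by (cases "N * k = 0") simp_all
  finally have "ennreal (\<Sum>j<N * k. (a j)\<^sup>2 * (t / real (N * k))) \<le> ennreal (e\<^sup>2 * t)" by (rule ennreal_leI)
  moreover have "wiener_sum f t N \<omega> - wiener_sum f t (N * k) \<omega>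
      = (\<Sum>j<N * k. a j * grid_incr t (N * k) j \<omega>)" for \<omega>
    unfolding wiener_sum_refine[OF k, of f t N]
    by (simp add: wiener_sum_def a_def sum_subtractf left_diff_distrib)
  ultimately show ?thesis by (simp only: grid_incr_isometry[OF t])
qed

lemma sq_norm_wiener_sum_diff_le:
  assumes t: "0 \<le> t" and N: "0 < N" "0 < N'"
    and f: "\<And>x y. x \<in> {0..t} \<Longrightarrow> y \<in> {0..t} \<Longrightarrow> \<bar>x - y\<bar> \<le> t / real (min N N') \<Longrightarrow> \<bar>f x - f y\<bar> \<le> e"
  shows "sq_norm M (\<lambda>\<omega>. wiener_sum f t N \<omega> - wiener_sum f t N' \<omega>) \<le> ennreal (4 * (e\<^sup>2 * t))"
proof -
  have "t / real N \<le> t / real (min N N')" "t / real N' \<le> t / real (min N N')"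
    using t N by (auto intro!: divide_left_mono)
  then have refine: "sq_norm M (\<lambda>\<omega>. wiener_sum f t N \<omega> - wiener_sum f t (N * N') \<omega>) \<le> ennreal (e\<^sup>2 * t)"
    and refine': "sq_norm M (\<lambda>\<omega>. wiener_sum f t N' \<omega> - wiener_sum f t (N' * N) \<omega>) \<le> ennreal (e\<^sup>2 * t)"
    by (auto intro!: sq_norm_wiener_sum_refine_le t N f)
  have "sq_norm M (\<lambda>\<omega>. wiener_sum f t N \<omega> - wiener_sum f t N' \<omega>) \<le>
     2 * sq_norm M (\<lambda>\<omega>. wiener_sum f t N \<omega> - wiener_sum f t (N * N') \<omega>)
     + 2 * sq_norm M (\<lambda>\<omega>. wiener_sum f t (N * N') \<omega> - wiener_sum f t N' \<omega>)"
    by (rule sq_norm_triangle) measurable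
  also have "\<dots> \<le> 2 * ennreal (e\<^sup>2 * t) + 2 * ennreal (e\<^sup>2 * t)"
    using refine refine' by (intro add_mono mult_left_mono) (auto simp: sq_norm_minus_commute mult.commute)
  also have "\<dots> = ennreal (4 * (e\<^sup>2 * t))"
    using t by (simp flip: ennreal_numeral ennreal_mult ennreal_plus)
  finally show ?thesis .
qed

lemma wiener_sum_convolution_uniformly_Cauchy:
  assumes T: "0 \<le> T" and K: "continuous_on {0..T} K" and e: "0 < e"
  shows "\<exists>N0. \<forall>N\<ge>N0. \<forall>N'\<ge>N0. \<forall>t\<in>{0..T}.
    sq_norm M (\<lambda>\<omega>. wiener_sum (\<lambda>s. K (t - s)) t N \<omega> - wiener_sum (\<lambda>s. K (t - s)) t N' \<omega>) \<le> ennreal e"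
proof -
  define \<eta> where "\<eta> = sqrt (e / (4 * (T + 1)))"
  have \<eta>: "0 < \<eta>" "\<eta>\<^sup>2 = e / (4 * (T + 1))" using T e by (auto simp: \<eta>_def)
  have "uniformly_continuous_on {0..T} K" using K by (intro compact_uniformly_continuous) auto
  from this[unfolded uniformly_continuous_on_def, rule_format, OF \<eta>(1)]
  obtain d where d: "0 < d" "\<forall>x\<in>{0..T}. \<forall>y\<in>{0..T}. dist y x < d \<longrightarrow> dist (K y) (K x) < \<eta>" by blast
  obtain N0 where N0: "T / d < real N0" using reals_Archimedean2 by blast
  show ?thesis
  proof (intro exI[of _ "Suc N0"] allI ballI impI)
    fix N N' t assume N: "Suc N0 \<le> N" "Suc N0 \<le> N'" and t: "t \<in> {0..T}"
    have "t < d * real (min N N')"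
    proof -
      have "T < d * real N0" using N0 d(1) by (simp add: pos_divide_less_eq mult.commute)
      also have "\<dots> \<le> d * real (min N N')" using N d(1) by (intro mult_left_mono) auto
      finally show ?thesis using t by simp
    qed
    then have mesh: "t / real (min N N') < d"
      using N by (simp add: pos_divide_less_eq)
    have "sq_norm M (\<lambda>\<omega>. wiener_sum (\<lambda>s. K (t - s)) t N \<omega> - wiener_sum (\<lambda>s. K (t - s)) t N' \<omega>)
        \<le> ennreal (4 * (\<eta>\<^sup>2 * t))"
    proof (rule sq_norm_wiener_sum_diff_le)
      fix x y assume xy: "x \<in> {0..t}" "y \<in> {0..t}" "\<bar>x - y\<bar> \<le> t / real (min N N')"
      then have "dist (t - x) (t - y) < d" using mesh by (simp add: dist_real_def)
      then show "\<bar>K (t - x) - K (t - y)\<bar> \<le> \<eta>"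
        using d(2)[rule_format, of "t - y" "t - x"] xy t by (simp add: dist_real_def)
    qed (use t N in auto)
    also have "4 * (\<eta>\<^sup>2 * t) \<le> e"
      using t e T mult_left_mono[of t "T + 1" e] by (simp add: \<eta>(2) field_simps)
    finally show "sq_norm M (\<lambda>\<omega>. wiener_sum (\<lambda>s. K (t - s)) t N \<omega> - wiener_sum (\<lambda>s. K (t - s)) t N' \<omega>)
        \<le> ennreal e"
      by (simp add: ennreal_leI)
  qed
qed

lemma wiener_int_AE_eq:
  assumes "L2_limit M (wiener_sum f t) Y"
  shows "AE \<omega> in M. wiener_int M W f t \<omega> = Y \<omega>"
proof (rule L2_limit_unique_AE[OF wiener_sum_measurable _ assms])
  have "L2_limit M (wiener_sum f t) (SOME Z. L2_limit M (wiener_sum f t) Z)"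
    using assms by (rule someI[of "L2_limit M (wiener_sum f t)"])
  then show "L2_limit M (wiener_sum f t) (wiener_int M W f t)"
    unfolding wiener_int_def L2_limit_def sq_norm_def wiener_sum_def grid_incr_def .
qed

end

lemma tendsto_floor_grid:
  fixes x :: real
  shows "(\<lambda>n. real_of_int \<lfloor>x * real (Suc n)\<rfloor> / real (Suc n)) \<longlonglongrightarrow> x"
proof (rule real_tendsto_sandwich)
  have "(\<lambda>n. x - 1 / real (Suc n)) \<longlonglongrightarrow> x - 0"
    by (intro tendsto_diff tendsto_const LIMSEQ_Suc lim_1_over_n)
  then show "(\<lambda>n. x - 1 / real (Suc n)) \<longlonglongrightarrow> x" by simp
  have "x - 1 / real (Suc n) \<le> real_of_int \<lfloor>x * real (Suc n)\<rfloor> / real (Suc n)" for n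
  proof -
    have "x * real (Suc n) - 1 \<le> real_of_int \<lfloor>x * real (Suc n)\<rfloor>" by linarith
    then have "(x * real (Suc n) - 1) / real (Suc n) \<le> real_of_int \<lfloor>x * real (Suc n)\<rfloor> / real (Suc n)"
      by (rule divide_right_mono) simp
    then show ?thesis by (simp add: diff_divide_distrib del: of_nat_Suc)
  qed
  then show "\<forall>\<^sub>F n in sequentially. x - 1 / real (Suc n) \<le> real_of_int \<lfloor>x * real (Suc n)\<rfloor> / real (Suc n)"
    by simp
  show "\<forall>\<^sub>F n in sequentially. real_of_int \<lfloor>x * real (Suc n)\<rfloor> / real (Suc n) \<le> x"
    by (auto simp: pos_divide_le_eq simp del: of_nat_Suc)
qed (rule tendsto_const)

text \<open>The paths are continuous on the nonnegative half-line only, hence the truncation of the time argument.\<close>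
lemma (in brownian) W_joint_measurable:
  assumes [measurable]: "p \<in> borel_measurable N" "q \<in> measurable N M"
  shows "(\<lambda>x. W (max 0 (p x)) (q x)) \<in> borel_measurable N"
proof (rule borel_measurable_LIMSEQ_metric)
  let ?p = "\<lambda>n x. real_of_int \<lfloor>p x * real (Suc n)\<rfloor> / real (Suc n)"
  show "(\<lambda>x. W (max 0 (?p n x)) (q x)) \<in> borel_measurable N" for n
    using measurable_compose_countable[of "\<lambda>(i::int) x. W (max 0 (real_of_int i / real (Suc n))) (q x)" N borel
        "\<lambda>x. \<lfloor>p x * real (Suc n)\<rfloor>"]
    by simp
  fix x assume "x \<in> space N"
  then have "q x \<in> space M" by (rule measurable_space[OF assms(2)])
  from continuous_on_tendsto_compose[OF W_continuous[OF this]
      tendsto_max[OF tendsto_const tendsto_floor_grid], of 0 "p x"]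
  show "(\<lambda>n. W (max 0 (?p n x)) (q x)) \<longlonglongrightarrow> W (max 0 (p x)) (q x)" by simp
qed

lemma finite_measure_Icc: "finite_measure (restrict_space lborel {a..b::real})"
  by (rule finite_measureI)
     (auto simp: emeasure_lborel_Icc_eq emeasure_restrict_space space_restrict_space)

lemma (in sigma_finite_measure) sq_norm_pair:
  "f \<in> borel_measurable (N \<Otimes>\<^sub>M M) \<Longrightarrow> sq_norm (N \<Otimes>\<^sub>M M) f = (\<integral>\<^sup>+x. sq_norm M (\<lambda>y. f (x, y)) \<partial>N)"
  unfolding sq_norm_def by (subst nn_integral_fst[symmetric]) simp_all

locale brownian_horizon = brownian +
  fixes T :: real
  assumes T_pos: "0 < T"
begin

abbreviation L :: "real measure" where "L \<equiv> restrict_space lborel {0..T}"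

sublocale L: finite_measure L by (rule finite_measure_Icc)
sublocale LM: pair_sigma_finite L M ..
sublocale PM: finite_measure "PM T M"
  unfolding PM_def by (intro finite_measure_pair_measure L.finite_measure_axioms finite_measure_axioms)

lemma space_L: "space L = {0..T}"
  by (simp add: space_restrict_space)

lemma emeasure_L: "emeasure L {0..T} = ennreal T"
  using T_pos by (simp add: emeasure_restrict_space)

lemma ident_L_measurable[measurable]: "(\<lambda>x. x) \<in> borel_measurable L"
  by (intro measurable_restrict_space1) simp

lemma fst_PM_measurable[measurable]: "fst \<in> borel_measurable (PM T M)"
  unfolding PM_def by (intro measurable_compose[OF measurable_fst ident_L_measurable])

lemma snd_PM_measurable[measurable]: "snd \<in> measurable (PM T M) M"
  unfolding PM_def by simp

lemma wiener_sum_joint_measurable: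
  assumes K: "continuous_on {0..T} K"
  shows "(\<lambda>x. wiener_sum (\<lambda>s. K (fst x - s)) (fst x) N (snd x)) \<in> borel_measurable (PM T M)"
proof -
  obtain K' B where [measurable]: "K' \<in> borel_measurable borel"
    and K': "\<And>x. \<bar>K' x\<bar> \<le> B" "\<And>x. x \<in> {0..T} \<Longrightarrow> K' x = K x"
    by (rule continuous_on_Icc_bounded_measurable_extension[OF K]) blast
  have [measurable]: "(\<lambda>x. W (max 0 (fst x * real i / real N)) (snd x)) \<in> borel_measurable (PM T M)" for i
    by (rule W_joint_measurable) measurable
  let ?S = "\<lambda>x. \<Sum>i<N. K' (fst x - fst x * real i / real N) *
    (W (max 0 (fst x * real (Suc i) / real N)) (snd x) - W (max 0 (fst x * real i / real N)) (snd x))"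
  have "?S \<in> borel_measurable (PM T M)" by measurable
  also have "?this \<longleftrightarrow> ?thesis"
  proof (rule measurable_cong)
    fix x assume "x \<in> space (PM T M)"
    then have x: "fst x \<in> {0..T}" by (auto simp: PM_def space_pair_measure space_L)
    then have "wiener_sum (\<lambda>s. K (fst x - s)) (fst x) N (snd x)
        = wiener_sum (\<lambda>s. K' (fst x - s)) (fst x) N (snd x)"
      by (intro wiener_sum_cong) (auto simp: K'(2))
    moreover have "max 0 (fst x * real i / real N) = fst x * real i / real N" for i
      using x by (intro max_absorb2) simp
    ultimately show "?S x = wiener_sum (\<lambda>s. K (fst x - s)) (fst x) N (snd x)"
      by (simp only: wiener_sum_def grid_incr_def)
  qed
  finally show ?thesis .
qed

lemma square_integrable_PM_if_sections_bounded:
  assumes f: "(\<lambda>(t, \<omega>). f t \<omega>) \<in> borel_measurable (PM T M)"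
    and bound: "\<And>t. t \<in> {0..T} \<Longrightarrow> sq_norm M (f t) \<le> C" and C: "C < \<infinity>"
  shows "square_integrable (PM T M) (\<lambda>(t, \<omega>). f t \<omega>)"
  unfolding square_integrable_iff_sq_norm
proof (intro conjI f)
  have "sq_norm (PM T M) (\<lambda>(t, \<omega>). f t \<omega>) = (\<integral>\<^sup>+t. sq_norm M (f t) \<partial>L)"
    using f unfolding PM_def by (subst sq_norm_pair) simp_all
  also have "\<dots> \<le> (\<integral>\<^sup>+t. C \<partial>L)"
    by (intro nn_integral_mono bound) (simp add: space_L)
  also have "\<dots> < \<infinity>"
    using C by (simp add: space_L emeasure_L ennreal_mult_less_top)
  finally show "sq_norm (PM T M) (\<lambda>(t, \<omega>). f t \<omega>) < \<infinity>" .
qed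

lemma wiener_int_version:
  assumes K: "continuous_on {0..T} K"
  obtains Y where "square_integrable (PM T M) (\<lambda>(t, \<omega>). Y t \<omega>)"
    "\<And>t. t \<in> {0..T} \<Longrightarrow> integrable M (Y t)" "\<And>t. t \<in> {0..T} \<Longrightarrow> expectation (Y t) = 0"
    "\<And>t. t \<in> {0..T} \<Longrightarrow> AE \<omega> in M. wiener_int M W (\<lambda>s. K (t - s)) t \<omega> = Y t \<omega>"
proof -
  let ?S = "\<lambda>N t. wiener_sum (\<lambda>s. K (t - s)) t N"
  obtain \<phi> where \<phi>: "\<And>t. t \<in> {0..T} \<Longrightarrow> L2_limit M (\<lambda>N. ?S N t) (\<lambda>\<omega>. lim (\<lambda>k. ?S (\<phi> k) t \<omega>))"
    using L2_limit_uniform_subsequence[where f = ?S, OF wiener_sum_measurable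
        wiener_sum_convolution_uniformly_Cauchy[OF less_imp_le[OF T_pos] K]]
    by blast
  define Y where "Y t \<omega> = lim (\<lambda>k. ?S (\<phi> k) t \<omega>)" for t \<omega>
  have limit: "L2_limit M (wiener_sum (\<lambda>s. K (t - s)) t) (Y t)" if "t \<in> {0..T}" for t
    using \<phi>[OF that] unfolding Y_def[abs_def] .
  obtain B where B: "\<And>x. x \<in> {0..T} \<Longrightarrow> \<bar>K x\<bar> \<le> B"
    using continuous_on_Icc_bounded[OF K] by blast
  have sq_norm_Y: "sq_norm M (Y t) \<le> 2 * ennreal (B\<^sup>2 * T)" if t: "t \<in> {0..T}" for t
  proof (rule L2_limit_sq_norm_le[OF wiener_sum_measurable limit[OF t]])
    have "sq_norm M (?S N t) \<le> ennreal (B\<^sup>2 * t)" for N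
      by (rule sq_norm_wiener_sum_le) (use t B in auto)
    also have "ennreal (B\<^sup>2 * t) \<le> ennreal (B\<^sup>2 * T)" using t by (intro ennreal_leI mult_left_mono) auto
    finally show "sq_norm M (?S N t) \<le> ennreal (B\<^sup>2 * T)" for N .
  qed
  have "(\<lambda>(t, \<omega>). Y t \<omega>) \<in> borel_measurable (PM T M)"
    unfolding Y_def case_prod_beta' by (intro borel_measurable_lim_metric wiener_sum_joint_measurable K)
  then have joint: "square_integrable (PM T M) (\<lambda>(t, \<omega>). Y t \<omega>)"
    by (rule square_integrable_PM_if_sections_bounded) (use sq_norm_Y in \<open>auto simp: ennreal_mult_less_top\<close>)
  show thesis
  proof (rule that[OF joint])
    fix t assume t: "t \<in> {0..T}"
    have S: "square_integrable M (?S N t)" for N using t by (intro square_integrable_wiener_sum) simp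
    show "integrable M (Y t)"
      by (rule integrable_if_square_integrable[OF L2_limit_square_integrable[OF S limit[OF t]]])
    show "expectation (Y t) = 0"
      using L2_limit_integral[OF S limit[OF t]] t by (simp add: expectation_wiener_sum LIMSEQ_const_iff)
    show "AE \<omega> in M. wiener_int M W (\<lambda>s. K (t - s)) t \<omega> = Y t \<omega>"
      by (rule wiener_int_AE_eq[OF limit[OF t]])
  qed
qed

end

section \<open>Square-integrable processes\<close>

context brownian_horizon
begin

abbreviation L2_process :: "(real \<Rightarrow> 'a \<Rightarrow> real) \<Rightarrow> bool" where
  "L2_process f \<equiv> square_integrable (PM T M) (\<lambda>(t, \<omega>). f t \<omega>)"

lemma L2_process_measurable:
  "L2_process f \<Longrightarrow> (\<lambda>x. f (fst x) (snd x)) \<in> borel_measurable (L \<Otimes>\<^sub>M M)"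
  by (simp add: square_integrable_def PM_def case_prod_beta')

lemma L2_process_section_measurable:
  assumes "L2_process f" "\<omega> \<in> space M"
  shows "(\<lambda>s. f s \<omega>) \<in> borel_measurable L"
  using measurable_compose[OF measurable_Pair2'[OF assms(2)] L2_process_measurable[OF assms(1)]] by simp

lemma L2_process_value_measurable:
  assumes "L2_process f" "t \<in> {0..T}"
  shows "f t \<in> borel_measurable M"
  using measurable_compose[OF measurable_Pair1' L2_process_measurable[OF assms(1)], of t] assms(2)
  by (simp add: space_L)

lemma L2_process_add: "L2_process f \<Longrightarrow> L2_process g \<Longrightarrow> L2_process (\<lambda>t \<omega>. f t \<omega> + g t \<omega>)"
  using square_integrable_add[of "PM T M" "\<lambda>(t, \<omega>). f t \<omega>" "\<lambda>(t, \<omega>). g t \<omega>"] by (simp add: case_prod_beta')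

lemma L2_process_cmult: "L2_process f \<Longrightarrow> L2_process (\<lambda>t \<omega>. c * f t \<omega>)"
  using square_integrable_cmult[of "PM T M" "\<lambda>(t, \<omega>). f t \<omega>" c] by (simp add: case_prod_beta')

lemma L2_process_diff: "L2_process f \<Longrightarrow> L2_process g \<Longrightarrow> L2_process (\<lambda>t \<omega>. f t \<omega> - g t \<omega>)"
  using square_integrable_diff[of "PM T M" "\<lambda>(t, \<omega>). f t \<omega>" "\<lambda>(t, \<omega>). g t \<omega>"] by (simp add: case_prod_beta')

lemma L2_process_deterministic:
  assumes c: "continuous_on {0..T} c"
  shows "L2_process (\<lambda>t \<omega>. c t)"
proof -
  obtain c' B where [measurable]: "c' \<in> borel_measurable borel"
    and c': "\<And>x. \<bar>c' x\<bar> \<le> B" "\<And>x. x \<in> {0..T} \<Longrightarrow> c' x = c x"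
    by (rule continuous_on_Icc_bounded_measurable_extension[OF c]) blast
  have "(\<lambda>x. c' (fst x)) \<in> borel_measurable (PM T M)" by measurable
  also have "?this \<longleftrightarrow> (\<lambda>(t, \<omega>). c t) \<in> borel_measurable (PM T M)"
    by (rule measurable_cong) (auto simp: PM_def space_pair_measure space_L c'(2))
  finally have "(\<lambda>(t, \<omega>). c t) \<in> borel_measurable (PM T M)" .
  then show ?thesis
  proof (rule square_integrable_PM_if_sections_bounded)
    show "sq_norm M (\<lambda>\<omega>. c t) \<le> ennreal (B\<^sup>2)" if "t \<in> {0..T}" for t
      using c'(1)[of t] c'(2)[OF that] power_mono[of "\<bar>c t\<bar>" B 2]
      by (simp add: sq_norm_def emeasure_space_1 ennreal_leI)
  qed simp
qed

lemma integrable_L_iff: "integrable L f \<longleftrightarrow> set_integrable lborel {0..T} f" for f :: "real \<Rightarrow> real"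
  by (simp add: integrable_restrict_space set_integrable_def)

lemma integral_L_eq: "(\<integral>s. f s \<partial>L) = (LINT s:{0..T}|lborel. f s)" for f :: "real \<Rightarrow> real"
  by (simp add: integral_restrict_space set_lebesgue_integral_def)

lemma L2_process_integrable: "L2_process f \<Longrightarrow> integrable (L \<Otimes>\<^sub>M M) (\<lambda>(t, \<omega>). f t \<omega>)"
  using PM.integrable_if_square_integrable by (simp add: PM_def)

lemma L2_process_path_integrable:
  "L2_process f \<Longrightarrow> AE \<omega> in M. set_integrable lborel {0..T} (\<lambda>s. f s \<omega>)"
  using LM.AE_integrable_snd[OF L2_process_integrable] unfolding integrable_L_iff .

lemma L2_process_mean_integrable:
  "L2_process f \<Longrightarrow> set_integrable lborel {0..T} (\<lambda>s. expectation (f s))"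
  using LM.integrable_fst[OF L2_process_integrable, of f] by (simp add: integrable_L_iff)

lemma sq_norm_PM_eq_path_integral:
  assumes "L2_process f"
  shows "sq_norm (PM T M) (\<lambda>(t, \<omega>). f t \<omega>) = (\<integral>\<^sup>+\<omega>. sq_norm L (\<lambda>s. f s \<omega>) \<partial>M)"
proof -
  have [measurable]: "(\<lambda>x. f (fst x) (snd x)) \<in> borel_measurable (L \<Otimes>\<^sub>M M)"
    by (rule L2_process_measurable[OF assms])
  show ?thesis
    using LM.nn_integral_snd[of "\<lambda>x. ennreal ((f (fst x) (snd x))\<^sup>2)"]
    by (simp add: sq_norm_def PM_def case_prod_beta')
qed

lemma L2_process_path_sq_norm_measurable:
  assumes "L2_process f"
  shows "(\<lambda>\<omega>. sq_norm L (\<lambda>s. f s \<omega>)) \<in> borel_measurable M"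
proof -
  have [measurable]: "(\<lambda>(\<omega>, s). f s \<omega>) \<in> borel_measurable (M \<Otimes>\<^sub>M L)"
    using measurable_pair_swap[OF L2_process_measurable[OF assms]] by simp
  show ?thesis unfolding sq_norm_def by measurable
qed

lemma vconv_eq_integral_L:
  assumes "t \<in> {0..T}"
  shows "vconv k f t = (\<integral>s. indicator {0..t} s * k (t - s) * f s \<partial>L)"
  unfolding vconv_def integral_L_eq set_lebesgue_integral_def
  by (rule Bochner_Integration.integral_cong) (use assms in \<open>auto simp: indicator_def\<close>)

lemma convolution_kernel_extension:
  assumes k: "continuous_on {0..T} k"
  obtains w B where "0 \<le> B" "\<And>t s. \<bar>w t s\<bar> \<le> B" "(\<lambda>(t, s). w t s) \<in> borel_measurable (borel \<Otimes>\<^sub>M borel)"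
    "\<And>f t. t \<in> {0..T} \<Longrightarrow> vconv k f t = (\<integral>s. w t s * f s \<partial>L)"
proof -
  obtain k' B where [measurable]: "k' \<in> borel_measurable borel"
    and k': "\<And>x. \<bar>k' x\<bar> \<le> B" "\<And>x. x \<in> {0..T} \<Longrightarrow> k' x = k x"
    by (rule continuous_on_Icc_bounded_measurable_extension[OF k]) blast
  have B: "0 \<le> B" using order_trans[OF abs_ge_zero k'(1)[of 0]] .
  show thesis
  proof (rule that[of B "\<lambda>t s. if 0 \<le> s \<and> s \<le> t then k' (t - s) else 0"])
    fix f t assume t: "t \<in> {0..T}"
    show "vconv k f t = (\<integral>s. (if 0 \<le> s \<and> s \<le> t then k' (t - s) else 0) * f s \<partial>L)"
      unfolding vconv_eq_integral_L[OF t]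
      by (rule Bochner_Integration.integral_cong) (use t in \<open>auto simp: k'(2) space_L\<close>)
  qed (use B k'(1) in \<open>auto, measurable\<close>)
qed

lemma L2_process_vconv_measurable:
  assumes f: "L2_process f" and k: "continuous_on {0..T} k"
  shows "(\<lambda>(t, \<omega>). vconv k (\<lambda>s. f s \<omega>) t) \<in> borel_measurable (PM T M)"
proof -
  obtain w B where [measurable]: "(\<lambda>(t, s). w t s) \<in> borel_measurable (borel \<Otimes>\<^sub>M borel)"
    and w: "\<And>f t. t \<in> {0..T} \<Longrightarrow> vconv k f t = (\<integral>s. w t s * f s \<partial>L)"
    by (rule convolution_kernel_extension[OF k]) blast
  have [measurable]: "(\<lambda>x. fst (fst x)) \<in> borel_measurable (PM T M \<Otimes>\<^sub>M L)"
    "(\<lambda>x. snd x) \<in> borel_measurable (PM T M \<Otimes>\<^sub>M L)"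
    by (auto intro: measurable_compose[OF measurable_fst] measurable_compose[OF measurable_snd])
  have "(\<lambda>x. (snd x, snd (fst x))) \<in> measurable (PM T M \<Otimes>\<^sub>M L) (L \<Otimes>\<^sub>M M)"
    by measurable
  from measurable_compose[OF this L2_process_measurable[OF f]]
  have [measurable]: "(\<lambda>x. f (snd x) (snd (fst x))) \<in> borel_measurable (PM T M \<Otimes>\<^sub>M L)" by simp
  have "(\<lambda>x. w (fst (fst x)) (snd x) * f (snd x) (snd (fst x))) \<in> borel_measurable (PM T M \<Otimes>\<^sub>M L)"
    by measurable
  then have "(\<lambda>y. \<integral>s. w (fst y) s * f s (snd y) \<partial>L) \<in> borel_measurable (PM T M)"
    by (intro L.borel_measurable_lebesgue_integral) (simp add: case_prod_beta')
  also have "?this \<longleftrightarrow> ?thesis"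
    by (rule measurable_cong) (auto simp: PM_def space_pair_measure space_L w)
  finally show ?thesis .
qed

lemma L2_process_vconv:
  assumes f: "L2_process f" and k: "continuous_on {0..T} k"
  shows "L2_process (\<lambda>t \<omega>. vconv k (\<lambda>s. f s \<omega>) t)"
proof -
  obtain w B where B: "0 \<le> B" "\<And>t s. \<bar>w t s\<bar> \<le> B"
    and [measurable]: "(\<lambda>(t, s). w t s) \<in> borel_measurable (borel \<Otimes>\<^sub>M borel)"
    and w: "\<And>f t. t \<in> {0..T} \<Longrightarrow> vconv k f t = (\<integral>s. w t s * f s \<partial>L)"
    by (rule convolution_kernel_extension[OF k]) blast
  have w_measurable: "w t \<in> borel_measurable L" for t by measurable
  have "sq_norm L (w t) \<le> (\<integral>\<^sup>+s. ennreal (B\<^sup>2) \<partial>L)" for t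
    unfolding sq_norm_def using B abs_le_square_iff[of _ B] by (intro nn_integral_mono ennreal_leI) auto
  then have sq_norm_w: "sq_norm L (w t) \<le> ennreal (B\<^sup>2 * T)" for t
    using T_pos by (simp add: space_L emeasure_L ennreal_mult)
  have "sq_norm M (\<lambda>\<omega>. vconv k (\<lambda>s. f s \<omega>) t) \<le> ennreal (B\<^sup>2 * T) * sq_norm (PM T M) (\<lambda>(t, \<omega>). f t \<omega>)"
    if t: "t \<in> {0..T}" for t
  proof -
    have "sq_norm M (\<lambda>\<omega>. vconv k (\<lambda>s. f s \<omega>) t) \<le> (\<integral>\<^sup>+\<omega>. ennreal (B\<^sup>2 * T) * sq_norm L (\<lambda>s. f s \<omega>) \<partial>M)"
      unfolding sq_norm_def[of M] w[OF t]
      by (intro nn_integral_mono order_trans[OF Cauchy_Schwarz_sq_norm mult_right_mono[OF sq_norm_w]]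
          w_measurable L2_process_section_measurable[OF f]) auto
    then show ?thesis
      by (simp add: sq_norm_PM_eq_path_integral[OF f] nn_integral_cmult L2_process_path_sq_norm_measurable[OF f])
  qed
  then show ?thesis
    by (rule square_integrable_PM_if_sections_bounded[OF L2_process_vconv_measurable[OF f k]])
       (use f in \<open>auto simp: square_integrable_iff_sq_norm ennreal_mult_less_top\<close>)
qed

lemma L2_process_vconv_mean:
  assumes f: "L2_process f" and k: "continuous_on {0..T} k" and t: "t \<in> {0..T}"
  shows "integrable M (\<lambda>\<omega>. vconv k (\<lambda>s. f s \<omega>) t)"
    "expectation (\<lambda>\<omega>. vconv k (\<lambda>s. f s \<omega>) t) = vconv k (\<lambda>s. expectation (f s)) t"
proof -
  obtain w B where B: "0 \<le> B" "\<And>t s. \<bar>w t s\<bar> \<le> B"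
    and [measurable]: "(\<lambda>(t, s). w t s) \<in> borel_measurable (borel \<Otimes>\<^sub>M borel)"
    and w: "\<And>f t. t \<in> {0..T} \<Longrightarrow> vconv k f t = (\<integral>s. w t s * f s \<partial>L)"
    by (rule convolution_kernel_extension[OF k]) blast
  have "square_integrable (PM T M) (\<lambda>x. w t (fst x))"
    using B abs_le_square_iff[of _ B]
    by (auto simp: square_integrable_def intro!: PM.integrable_const_bound[where B = "B\<^sup>2"])
  from integrable_mult_square_integrable[OF this f]
  have integrand: "integrable (L \<Otimes>\<^sub>M M) (\<lambda>(s, \<omega>). w t s * f s \<omega>)"
    by (simp add: PM_def case_prod_beta')
  show "integrable M (\<lambda>\<omega>. vconv k (\<lambda>s. f s \<omega>) t)"
    using LM.integrable_snd[OF integrand] by (simp add: w[OF t])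
  show "expectation (\<lambda>\<omega>. vconv k (\<lambda>s. f s \<omega>) t) = vconv k (\<lambda>s. expectation (f s)) t"
    using LM.Fubini_integral[OF integrand] by (simp add: w[OF t])
qed

end

section \<open>The controlled Volterra equation\<close>

locale volterra_control = brownian_horizon +
  fixes \<alpha> \<beta> \<sigma> X0 a1 a2 :: real
  assumes a1_pos: "0 < a1"
begin

abbreviation solution :: "(real \<Rightarrow> real) \<Rightarrow> (real \<Rightarrow> 'a \<Rightarrow> real) \<Rightarrow> (real \<Rightarrow> 'a \<Rightarrow> real) \<Rightarrow> bool" where
  "solution K u X \<equiv> sve_sol M W K T \<alpha> \<beta> \<sigma> X0 u X"

lemma solution_L2_process: "solution K u X \<Longrightarrow> L2_process X"
  by (simp add: sve_sol_def square_integrable_def case_prod_beta')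

lemma drift_AE_eq:
  assumes K: "continuous_on {0..T} K" and u: "L2_process u" and X: "L2_process X" and t: "t \<in> {0..T}"
  shows "AE \<omega> in M. (LINT s:{0..t}|lborel. K (t - s) * (\<alpha> * u s \<omega> - \<beta> * X s \<omega>))
    = \<alpha> * vconv K (\<lambda>s. u s \<omega>) t - \<beta> * vconv K (\<lambda>s. X s \<omega>) t"
  using L2_process_path_integrable[OF u] L2_process_path_integrable[OF X]
proof eventually_elim
  case (elim \<omega>)
  then show ?case
    using vconv_diff_right[OF K set_integrable_mult_right set_integrable_mult_right t,
        of \<alpha> "\<lambda>s. u s \<omega>" \<beta> "\<lambda>s. X s \<omega>"]
    by (simp add: vconv_cmult_right) (simp add: vconv_def)
qed

lemma solution_iff:
  assumes K: "continuous_on {0..T} K" and u: "L2_process u"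
  shows "solution K u X \<longleftrightarrow> L2_process X \<and> (\<forall>t\<in>{0..T}. AE \<omega> in M. X t \<omega> = X0
    + \<alpha> * vconv K (\<lambda>s. u s \<omega>) t - \<beta> * vconv K (\<lambda>s. X s \<omega>) t + \<sigma> * wiener_int M W (\<lambda>s. K (t - s)) t \<omega>)"
proof (cases "L2_process X")
  case True
  have "(AE \<omega> in M. X t \<omega> = X0 + (LINT s:{0..t}|lborel. K (t - s) * (\<alpha> * u s \<omega> - \<beta> * X s \<omega>))
        + \<sigma> * wiener_int M W (\<lambda>s. K (t - s)) t \<omega>)
    \<longleftrightarrow> (AE \<omega> in M. X t \<omega> = X0 + \<alpha> * vconv K (\<lambda>s. u s \<omega>) t - \<beta> * vconv K (\<lambda>s. X s \<omega>) t
        + \<sigma> * wiener_int M W (\<lambda>s. K (t - s)) t \<omega>)" if t: "t \<in> {0..T}" for t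
    using drift_AE_eq[OF K u True t] by (rule eventually_subst[OF eventually_mono]) (auto simp: algebra_simps)
  with True show ?thesis by (simp add: sve_sol_def square_integrable_def case_prod_beta')
qed (use solution_L2_process in blast)

lemma solution_exists:
  assumes r: "resolvent_on T \<beta> K r" and u: "L2_process u"
  shows "\<exists>X. solution K u X"
proof -
  note K = resolvent_on_continuous_kernel[OF r]
  obtain Y where Y: "L2_process Y"
    and Y_version: "\<And>t. t \<in> {0..T} \<Longrightarrow> AE \<omega> in M. wiener_int M W (\<lambda>s. K (t - s)) t \<omega> = Y t \<omega>"
    by (rule wiener_int_version[OF K]) blast
  define f where "f t \<omega> = X0 + \<alpha> * vconv K (\<lambda>s. u s \<omega>) t + \<sigma> * Y t \<omega>" for t \<omega>
  have f: "L2_process f"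
    unfolding f_def
    by (intro L2_process_add L2_process_cmult L2_process_vconv L2_process_deterministic u Y K continuous_intros)
  define X where "X t \<omega> = f t \<omega> - \<beta> * vconv r (\<lambda>s. f s \<omega>) t" for t \<omega>
  have X: "L2_process X"
    unfolding X_def by (intro L2_process_diff L2_process_cmult L2_process_vconv f resolvent_on_continuous[OF r])
  have "AE \<omega> in M. X t \<omega> = X0 + \<alpha> * vconv K (\<lambda>s. u s \<omega>) t - \<beta> * vconv K (\<lambda>s. X s \<omega>) t
      + \<sigma> * wiener_int M W (\<lambda>s. K (t - s)) t \<omega>" if t: "t \<in> {0..T}" for t
    using L2_process_path_integrable[OF f] L2_process_path_integrable[OF X] Y_version[OF t]
  proof eventually_elim
    case (elim \<omega>)
    have "f t \<omega> = X t \<omega> - - \<beta> * vconv K (\<lambda>s. X s \<omega>) t"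
      by (rule volterra_equation_solution[OF resolvent_on_sym[OF r] elim(2,1) _ t]) (simp add: X_def)
    then show ?case by (simp add: f_def elim(3))
  qed
  with X show ?thesis using solution_iff[OF K u] by blast
qed

lemma solution_mean_equation:
  assumes K: "continuous_on {0..T} K" and u: "L2_process u" and X: "solution K u X" and t: "t \<in> {0..T}"
  shows "integrable M (X t)"
    "expectation (X t) = X0 + \<alpha> * vconv K (\<lambda>s. expectation (u s)) t - \<beta> * vconv K (\<lambda>s. expectation (X s)) t"
proof -
  note X_L2 = solution_L2_process[OF X]
  obtain Y where Y: "integrable M (Y t)" "expectation (Y t) = 0"
    and Y_version: "AE \<omega> in M. wiener_int M W (\<lambda>s. K (t - s)) t \<omega> = Y t \<omega>"
    by (rule wiener_int_version[OF K]) (use t in blast)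
  let ?R = "\<lambda>\<omega>. X0 + \<alpha> * vconv K (\<lambda>s. u s \<omega>) t - \<beta> * vconv K (\<lambda>s. X s \<omega>) t + \<sigma> * Y t \<omega>"
  have "AE \<omega> in M. X t \<omega> = X0 + \<alpha> * vconv K (\<lambda>s. u s \<omega>) t - \<beta> * vconv K (\<lambda>s. X s \<omega>) t
      + \<sigma> * wiener_int M W (\<lambda>s. K (t - s)) t \<omega>"
    using X t solution_iff[OF K u] by blast
  with Y_version have X_eq: "AE \<omega> in M. X t \<omega> = ?R \<omega>" by eventually_elim simp
  note mean = L2_process_vconv_mean[OF u K t] L2_process_vconv_mean[OF X_L2 K t]
  have R_integrable: "integrable M ?R" using mean Y(1) by simp
  note X_measurable = L2_process_value_measurable[OF X_L2 t]
  show "integrable M (X t)"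
    using integrable_cong_AE[OF X_measurable _ X_eq] R_integrable by auto
  have "expectation (X t) = expectation ?R"
    by (rule integral_cong_AE[OF X_measurable _ X_eq]) (use R_integrable in auto)
  then show "expectation (X t)
      = X0 + \<alpha> * vconv K (\<lambda>s. expectation (u s)) t - \<beta> * vconv K (\<lambda>s. expectation (X s)) t"
    using mean Y by (simp add: prob_space)
qed

lemma solution_expectation:
  assumes r: "resolvent_on T \<beta> K r" and u: "L2_process u" and X: "solution K u X"
  shows "expectation (X T) = X0 * (1 - \<beta> * (LINT s:{0..T}|lborel. r s)) + \<alpha> * vconv r (\<lambda>s. expectation (u s)) T"
proof -
  note K = resolvent_on_continuous_kernel[OF r] and r_cont = resolvent_on_continuous[OF r]
  have T: "T \<in> {0..T}" using T_pos by simp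
  let ?v = "\<lambda>s. expectation (u s)"
  let ?f = "\<lambda>t. X0 + \<alpha> * vconv K ?v t"
  have v_integrable: "set_integrable lborel {0..T} ?v" by (rule L2_process_mean_integrable[OF u])
  have "set_integrable lborel {0..T} (\<lambda>t. expectation (\<lambda>\<omega>. vconv K (\<lambda>s. u s \<omega>) t))"
    by (rule L2_process_mean_integrable[OF L2_process_vconv[OF u K]])
  then have Kv_integrable: "set_integrable lborel {0..T} (vconv K ?v)"
    by (subst (asm) set_integrable_cong[OF refl refl L2_process_vconv_mean(2)[OF u K]])
  have const_integrable: "set_integrable lborel {0..T} (\<lambda>_. X0)"
    by (intro borel_integrable_atLeastAtMost' continuous_intros)
  have f_integrable: "set_integrable lborel {0..T} ?f"
    by (intro set_integral_add const_integrable set_integrable_mult_right Kv_integrable)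
  have "expectation (X T) = ?f T - \<beta> * vconv r ?f T"
    by (rule volterra_equation_solution[OF r f_integrable
          L2_process_mean_integrable[OF solution_L2_process[OF X]] _ T])
       (rule solution_mean_equation(2)[OF K u X])
  also have "vconv r ?f T = X0 * (LINT s:{0..T}|lborel. r s) + \<alpha> * vconv r (vconv K ?v) T"
    using vconv_cmult_right[of r X0 "\<lambda>_. 1" T]
    by (subst vconv_add_right[OF r_cont const_integrable set_integrable_mult_right[OF Kv_integrable] T])
       (simp add: vconv_cmult_right vconv_const)
  finally have "expectation (X T) = X0 * (1 - \<beta> * (LINT s:{0..T}|lborel. r s))
      + \<alpha> * (vconv K ?v T - \<beta> * vconv r (vconv K ?v) T)"
    by (simp add: algebra_simps)
  then show ?thesis by (simp add: vconv_resolvent_vconv[OF r v_integrable T])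
qed

end

section \<open>The performance functional\<close>

lemma ex_positive_constant:
  fixes f g :: "nat \<Rightarrow> real"
  assumes bound: "\<And>n. P n \<Longrightarrow> f n \<le> C * g n" and g: "\<And>n. P n \<Longrightarrow> 0 \<le> g n"
  shows "\<exists>C>0. \<forall>n. P n \<longrightarrow> f n \<le> C * g n"
proof (intro exI[of _ "\<bar>C\<bar> + 1"] conjI allI impI)
  fix n assume "P n"
  then show "f n \<le> (\<bar>C\<bar> + 1) * g n"
    using mult_right_mono[of C "\<bar>C\<bar> + 1" "g n"] bound[of n] g[of n] by linarith
qed simp

context volterra_control
begin

abbreviation performance :: "(real \<Rightarrow> real) \<Rightarrow> (real \<Rightarrow> 'a \<Rightarrow> real) \<Rightarrow> real" where
  "performance K u \<equiv> Jfun M W K T \<alpha> \<beta> \<sigma> X0 a1 a2 u"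

definition optimal_control :: "(real \<Rightarrow> real) \<Rightarrow> real \<Rightarrow> real" where
  "optimal_control r t = \<alpha> * a2 / (2 * a1) * r (T - t)"

definition optimal_value :: "(real \<Rightarrow> real) \<Rightarrow> real" where
  "optimal_value r = a2 * X0 * (1 - \<beta> * (LINT s:{0..T}|lborel. r s))
     + a1 * (LINT s:{0..T}|lborel. (optimal_control r s)\<^sup>2)"

lemma hat_u_eq_optimal_control:
  "hat_u \<alpha> \<beta> a1 a2 T K n = optimal_control (bernstein_resolvent T \<beta> K n)"
  by (simp add: fun_eq_iff hat_u_def l2_inner_exp_Abar_nu optimal_control_def)

lemma continuous_on_optimal_control:
  "continuous_on {0..T} r \<Longrightarrow> continuous_on {0..T} (optimal_control r)"
  unfolding optimal_control_def
  by (rule continuous_on_mult_left, erule continuous_on_compose2) (auto intro!: continuous_intros)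

lemma integral_PM_deterministic:
  fixes g :: "real \<Rightarrow> real"
  assumes "continuous_on {0..T} g"
  shows "(\<integral>(s, \<omega>). g s \<partial>PM T M) = (LINT s:{0..T}|lborel. g s)"
  using LM.integral_fst[OF L2_process_integrable[OF L2_process_deterministic[OF assms]]]
  by (simp add: prob_space PM_def integral_L_eq)

lemma performance_eq:
  assumes r: "resolvent_on T \<beta> K r" and u: "L2_process u"
  shows "performance K u = a2 * (X0 * (1 - \<beta> * (LINT s:{0..T}|lborel. r s))
    + \<alpha> * vconv r (\<lambda>s. expectation (u s)) T) - a1 * (\<integral>(s, \<omega>). (u s \<omega>)\<^sup>2 \<partial>PM T M)"
proof -
  define X where "X = (SOME X. solution K u X)"
  have X: "solution K u X" unfolding X_def by (rule someI_ex[OF solution_exists[OF r u]])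
  have T: "T \<in> {0..T}" using T_pos by simp
  have u_square_integrable: "integrable (L \<Otimes>\<^sub>M M) (\<lambda>(s, \<omega>). (u s \<omega>)\<^sup>2)"
    using u by (simp add: square_integrable_def PM_def case_prod_beta')
  have "performance K u = expectation (\<lambda>\<omega>. - (a1 * (\<integral>s. (u s \<omega>)\<^sup>2 \<partial>L)) + a2 * X T \<omega>)"
    unfolding Jfun_def X_def[symmetric] Let_def by (simp add: integral_L_eq)
  also have "\<dots> = - (a1 * expectation (\<lambda>\<omega>. \<integral>s. (u s \<omega>)\<^sup>2 \<partial>L)) + a2 * expectation (X T)"
    using LM.integrable_snd[OF u_square_integrable]
      solution_mean_equation(1)[OF resolvent_on_continuous_kernel[OF r] u X T] by simp
  also have "expectation (\<lambda>\<omega>. \<integral>s. (u s \<omega>)\<^sup>2 \<partial>L) = (\<integral>(s, \<omega>). (u s \<omega>)\<^sup>2 \<partial>PM T M)"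
    unfolding PM_def by (rule LM.integral_snd[OF u_square_integrable])
  finally show ?thesis by (simp add: solution_expectation[OF r u X])
qed

lemma vconv_mean_eq_integral_PM:
  assumes r: "continuous_on {0..T} r" and u: "L2_process u"
  shows "a2 * (\<alpha> * vconv r (\<lambda>s. expectation (u s)) T) = 2 * a1 * (\<integral>(s, \<omega>). optimal_control r s * u s \<omega> \<partial>PM T M)"
proof -
  have product: "integrable (L \<Otimes>\<^sub>M M) (\<lambda>(s, \<omega>). optimal_control r s * u s \<omega>)"
    using integrable_mult_square_integrable[OF L2_process_deterministic[OF continuous_on_optimal_control[OF r]] u]
    by (simp add: PM_def case_prod_beta')
  have "2 * a1 * (\<integral>(s, \<omega>). optimal_control r s * u s \<omega> \<partial>PM T M)
      = 2 * a1 * (LINT s:{0..T}|lborel. optimal_control r s * expectation (u s))"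
    unfolding PM_def integral_L_eq[symmetric] using LM.integral_fst[OF product] by simp
  also have "\<dots> = a2 * (\<alpha> * vconv r (\<lambda>s. expectation (u s)) T)"
    using a1_pos by (simp add: vconv_def optimal_control_def mult.assoc)
  finally show ?thesis by simp
qed

lemma performance_complete_square:
  assumes r: "resolvent_on T \<beta> K r" and u: "L2_process u"
  shows "performance K u = optimal_value r - a1 * (\<integral>(s, \<omega>). (u s \<omega> - optimal_control r s)\<^sup>2 \<partial>PM T M)"
proof -
  note control_cont = continuous_on_optimal_control[OF resolvent_on_continuous[OF r]]
  have expand: "(\<integral>(s, \<omega>). (u s \<omega> - optimal_control r s)\<^sup>2 \<partial>PM T M) = (\<integral>(s, \<omega>). (u s \<omega>)\<^sup>2 \<partial>PM T M)
      - 2 * (\<integral>(s, \<omega>). optimal_control r s * u s \<omega> \<partial>PM T M) + (\<integral>(s, \<omega>). (optimal_control r s)\<^sup>2 \<partial>PM T M)"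
    using integral_square_diff[OF u L2_process_deterministic[OF control_cont]] by (simp add: case_prod_beta')
  show ?thesis
    unfolding expand using vconv_mean_eq_integral_PM[OF resolvent_on_continuous[OF r] u]
    by (simp add: performance_eq[OF r u] optimal_value_def integral_PM_deterministic continuous_on_power
        control_cont algebra_simps)
qed

lemma performance_deterministic:
  assumes r: "resolvent_on T \<beta> K r" and c: "continuous_on {0..T} c"
  shows "performance K (\<lambda>t \<omega>. c t)
    = optimal_value r - a1 * (LINT s:{0..T}|lborel. (c s - optimal_control r s)\<^sup>2)"
  unfolding performance_complete_square[OF r L2_process_deterministic[OF c]]
  by (simp add: integral_PM_deterministic continuous_intros c
      continuous_on_optimal_control[OF resolvent_on_continuous[OF r]])

lemma performance_optimal_control:
  assumes "resolvent_on T \<beta> K r"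
  shows "performance K (\<lambda>t \<omega>. optimal_control r t) = optimal_value r"
  using performance_deterministic[OF assms
      continuous_on_optimal_control[OF resolvent_on_continuous[OF assms]]] by simp

lemma performance_le_optimal_value:
  assumes r: "resolvent_on T \<beta> K r" and u: "L2_process u"
  shows "performance K u \<le> optimal_value r"
proof -
  have "0 \<le> (\<integral>(s, \<omega>). (u s \<omega> - optimal_control r s)\<^sup>2 \<partial>PM T M)"
    by (rule Bochner_Integration.integral_nonneg) auto
  then show ?thesis using a1_pos by (simp add: performance_complete_square[OF r u])
qed

lemma L2a_imp_L2_process: "L2a M W T u \<Longrightarrow> L2_process u"
  by (simp add: L2a_def square_integrable_def case_prod_beta')

lemma L2a_deterministic:
  assumes "continuous_on {0..T} c"
  shows "L2a M W T (\<lambda>t \<omega>. c t)"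
  using L2_process_deterministic[OF assms] by (simp add: L2a_def square_integrable_def case_prod_beta')

lemma bdd_above_performance:
  assumes "resolvent_on T \<beta> K r"
  shows "bdd_above (performance K ` {u. L2a M W T u})"
  using performance_le_optimal_value[OF assms] L2a_imp_L2_process
  by (intro bdd_aboveI[of _ "optimal_value r"]) auto

lemma Sup_performance:
  assumes r: "resolvent_on T \<beta> K r"
  shows "(SUP u\<in>{u. L2a M W T u}. performance K u) = optimal_value r"
proof (rule cSup_eq_maximum)
  show "optimal_value r \<in> performance K ` {u. L2a M W T u}"
    using L2a_deterministic[OF continuous_on_optimal_control[OF resolvent_on_continuous[OF r]]]
    by (auto simp: performance_optimal_control[OF r] intro!: image_eqI[of _ _ "\<lambda>t \<omega>. optimal_control r t"])
qed (auto intro: performance_le_optimal_value[OF r] L2a_imp_L2_process)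

lemma optimal_value_diff_le:
  assumes q: "continuous_on {0..T} q" and r: "continuous_on {0..T} r"
    and B: "\<And>t. t \<in> {0..T} \<Longrightarrow> \<bar>q t\<bar> \<le> B" "\<And>t. t \<in> {0..T} \<Longrightarrow> \<bar>r t\<bar> \<le> B"
    and \<epsilon>: "\<And>t. t \<in> {0..T} \<Longrightarrow> \<bar>q t - r t\<bar> \<le> \<epsilon>"
  shows "\<bar>optimal_value q - optimal_value r\<bar>
    \<le> (\<bar>a2 * X0 * \<beta>\<bar> * T + a1 * (T * ((\<alpha> * a2 / (2 * a1))\<^sup>2 * (2 * B)))) * \<epsilon>"
proof -
  let ?c = "\<alpha> * a2 / (2 * a1)"
  let ?I = "LINT s:{0..T}|lborel. q s - r s"
  let ?D = "LINT s:{0..T}|lborel. (optimal_control q s)\<^sup>2 - (optimal_control r s)\<^sup>2"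
  note int = borel_integrable_atLeastAtMost'
  note cont = continuous_on_optimal_control[OF q] continuous_on_optimal_control[OF r]
  have diff: "optimal_value q - optimal_value r = - (a2 * X0 * \<beta>) * ?I + a1 * ?D"
    using q r cont
    by (simp add: optimal_value_def set_integral_diff(2) int continuous_on_power algebra_simps)
  have mean: "\<bar>?I\<bar> \<le> T * \<epsilon>"
    using integral_Icc_abs_le[OF less_imp_le[OF T_pos] continuous_on_diff[OF q r] \<epsilon>] by simp
  have "\<bar>(optimal_control q s)\<^sup>2 - (optimal_control r s)\<^sup>2\<bar> \<le> ?c\<^sup>2 * (2 * B) * \<epsilon>" if s: "s \<in> {0..T}" for s
  proof -
    have "\<bar>q (T - s) + r (T - s)\<bar> * \<bar>q (T - s) - r (T - s)\<bar> \<le> 2 * B * \<epsilon>"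
      using B[of "T - s"] \<epsilon>[of "T - s"] s by (intro mult_mono) auto
    then have "?c\<^sup>2 * \<bar>(q (T - s))\<^sup>2 - (r (T - s))\<^sup>2\<bar> \<le> ?c\<^sup>2 * (2 * B * \<epsilon>)"
      by (intro mult_left_mono) (auto simp: power2_eq_square square_diff_square_factored abs_mult)
    moreover have "(optimal_control q s)\<^sup>2 - (optimal_control r s)\<^sup>2 = ?c\<^sup>2 * ((q (T - s))\<^sup>2 - (r (T - s))\<^sup>2)"
      unfolding optimal_control_def by (simp only: power_mult_distrib right_diff_distrib)
    ultimately show ?thesis by (simp add: abs_mult mult.assoc)
  qed
  from integral_Icc_abs_le[OF less_imp_le[OF T_pos] _ this]
  have energy: "\<bar>?D\<bar> \<le> T * (?c\<^sup>2 * (2 * B) * \<epsilon>)"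
    using cont by (simp add: continuous_on_diff continuous_on_power)
  have "\<bar>optimal_value q - optimal_value r\<bar> \<le> \<bar>a2 * X0 * \<beta>\<bar> * \<bar>?I\<bar> + a1 * \<bar>?D\<bar>"
    unfolding diff using a1_pos abs_triangle_ineq[of "- (a2 * X0 * \<beta>) * ?I" "a1 * ?D"] by (simp add: abs_mult)
  also have "\<dots> \<le> \<bar>a2 * X0 * \<beta>\<bar> * (T * \<epsilon>) + a1 * (T * (?c\<^sup>2 * (2 * B) * \<epsilon>))"
    using a1_pos by (intro add_mono mult_left_mono mean energy) auto
  finally show ?thesis by (simp add: algebra_simps)
qed

lemma performance_optimal_control_diff_le:
  assumes r: "resolvent_on T \<beta> K r" and q: "continuous_on {0..T} q"
    and \<epsilon>: "\<And>t. t \<in> {0..T} \<Longrightarrow> \<bar>q t - r t\<bar> \<le> \<epsilon>"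
  shows "\<bar>performance K (\<lambda>t \<omega>. optimal_control q t) - optimal_value r\<bar>
    \<le> a1 * (T * (\<alpha> * a2 / (2 * a1))\<^sup>2) * \<epsilon>\<^sup>2"
proof -
  let ?c = "\<alpha> * a2 / (2 * a1)"
  let ?D = "LINT s:{0..T}|lborel. (optimal_control q s - optimal_control r s)\<^sup>2"
  note cont = continuous_on_optimal_control[OF q] continuous_on_optimal_control[OF resolvent_on_continuous[OF r]]
  have "\<bar>(optimal_control q s - optimal_control r s)\<^sup>2\<bar> \<le> ?c\<^sup>2 * \<epsilon>\<^sup>2" if s: "s \<in> {0..T}" for s
  proof -
    have "(q (T - s) - r (T - s))\<^sup>2 \<le> \<epsilon>\<^sup>2"
      using \<epsilon>[of "T - s"] s power_mono[of "\<bar>q (T - s) - r (T - s)\<bar>" \<epsilon> 2] by simp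
    then have "(?c * (q (T - s) - r (T - s)))\<^sup>2 \<le> ?c\<^sup>2 * \<epsilon>\<^sup>2"
      unfolding power_mult_distrib by (rule mult_left_mono) simp
    then show ?thesis
      unfolding optimal_control_def right_diff_distrib[symmetric] by simp
  qed
  from integral_Icc_abs_le[OF less_imp_le[OF T_pos] _ this]
  have "a1 * \<bar>?D\<bar> \<le> a1 * (T * (?c\<^sup>2 * \<epsilon>\<^sup>2))"
    using cont a1_pos by (intro mult_left_mono) (auto simp: continuous_on_diff continuous_on_power)
  then show ?thesis
    unfolding performance_deterministic[OF r cont(1)] using a1_pos by (simp add: abs_mult mult.assoc)
qed

lemma optimal_value_bernstein_rate:
  assumes h: "0 < h" "h \<le> 2" and K: "holder_on h {0..T} K" and r: "resolvent_on T \<beta> K r"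
  shows "\<exists>C>0. \<forall>n\<ge>1. \<bar>optimal_value (bernstein_resolvent T \<beta> K n) - optimal_value r\<bar>
    \<le> C * real n powr (- h / 2)"
proof -
  obtain C where C: "0 \<le> C"
    "\<And>n t. 1 \<le> n \<Longrightarrow> t \<in> {0..T} \<Longrightarrow> \<bar>bernstein_resolvent T \<beta> K n t - r t\<bar> \<le> C * real n powr (- h / 2)"
    by (rule bernstein_resolvent_rate[OF T_pos h K r]) blast
  obtain B where B: "\<And>t. t \<in> {0..T} \<Longrightarrow> \<bar>r t\<bar> \<le> B"
    using continuous_on_Icc_bounded[OF resolvent_on_continuous[OF r]] by blast
  let ?A = "\<bar>a2 * X0 * \<beta>\<bar> * T + a1 * (T * ((\<alpha> * a2 / (2 * a1))\<^sup>2 * (2 * (B + C))))"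
  have "\<bar>optimal_value (bernstein_resolvent T \<beta> K n) - optimal_value r\<bar> \<le> ?A * (C * real n powr (- h / 2))"
    if n: "1 \<le> n" for n
  proof (rule optimal_value_diff_le)
    fix t assume t: "t \<in> {0..T}"
    have "C * real n powr (- h / 2) \<le> C * 1"
      using C(1) h n powr_mono[of "- h / 2" 0 "real n"] by (intro mult_left_mono) auto
    with C(2)[OF n t] B[OF t] C(1)
    show "\<bar>bernstein_resolvent T \<beta> K n t\<bar> \<le> B + C" "\<bar>r t\<bar> \<le> B + C" by linarith+
  qed (use C(2)[OF n] resolvent_on_continuous[OF r]
      resolvent_on_continuous[OF resolvent_on_bernstein[OF T_pos]] in auto)
  then show ?thesis
    unfolding mult.assoc[symmetric] by (intro ex_positive_constant) auto
qed

lemma performance_bernstein_control_rate: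
  assumes h: "0 < h" "h \<le> 2" and K: "holder_on h {0..T} K" and r: "resolvent_on T \<beta> K r"
  shows "\<exists>C>0. \<forall>n\<ge>1. \<bar>performance K (\<lambda>t \<omega>. optimal_control (bernstein_resolvent T \<beta> K n) t) - optimal_value r\<bar>
    \<le> C * real n powr (- h / 2)"
proof -
  obtain C where C: "0 \<le> C"
    "\<And>n t. 1 \<le> n \<Longrightarrow> t \<in> {0..T} \<Longrightarrow> \<bar>bernstein_resolvent T \<beta> K n t - r t\<bar> \<le> C * real n powr (- h / 2)"
    by (rule bernstein_resolvent_rate[OF T_pos h K r]) blast
  let ?A = "a1 * (T * (\<alpha> * a2 / (2 * a1))\<^sup>2)"
  have "\<bar>performance K (\<lambda>t \<omega>. optimal_control (bernstein_resolvent T \<beta> K n) t) - optimal_value r\<bar>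
      \<le> ?A * C\<^sup>2 * real n powr (- h / 2)" if n: "1 \<le> n" for n
  proof -
    have "\<bar>performance K (\<lambda>t \<omega>. optimal_control (bernstein_resolvent T \<beta> K n) t) - optimal_value r\<bar>
        \<le> ?A * (C * real n powr (- h / 2))\<^sup>2"
      by (intro performance_optimal_control_diff_le r C(2) n
          resolvent_on_continuous[OF resolvent_on_bernstein[OF T_pos]])
    also have "\<dots> = ?A * C\<^sup>2 * (real n powr (- h / 2) * real n powr (- h / 2))"
      by (simp add: power2_eq_square)
    also have "\<dots> \<le> ?A * C\<^sup>2 * (real n powr (- h / 2) * 1)"
      using a1_pos T_pos h n powr_mono[of "- h / 2" 0 "real n"] by (intro mult_left_mono mult_nonneg_nonneg) auto
    finally show ?thesis by simp
  qed
  then show ?thesis by (intro ex_positive_constant) auto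
qed

end

theorem theorem3p2:
  fixes M :: "'a measure" and W :: "real \<Rightarrow> 'a \<Rightarrow> real" and K :: "real \<Rightarrow> real"
    and T \<alpha> \<beta> \<sigma> a1 a2 X0 h :: real
  assumes "T > 0" and "\<alpha> > 0" and "\<beta> > 0" and "\<sigma> > 0" and "a1 > 0" and "a2 > 0"
    and "0 < h" and "h < 1"
    and "holder_on h {0..T} K"
    and "brownian_motion M W"
  shows "bdd_above (Jfun M W K T \<alpha> \<beta> \<sigma> X0 a1 a2 ` {u. L2a M W T u}) \<and>
    (\<exists>C>0. \<forall>n\<ge>1. \<bar>Jfun M W (bernstein T K n) T \<alpha> \<beta> \<sigma> X0 a1 a2 (\<lambda>t \<omega>. hat_u \<alpha> \<beta> a1 a2 T K n t)
        - (SUP u\<in>{u. L2a M W T u}. Jfun M W K T \<alpha> \<beta> \<sigma> X0 a1 a2 u)\<bar> \<le> C * real n powr (- h / 2)) \<and>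
    (\<exists>C>0. \<forall>n\<ge>1. \<bar>Jfun M W K T \<alpha> \<beta> \<sigma> X0 a1 a2 (\<lambda>t \<omega>. hat_u \<alpha> \<beta> a1 a2 T K n t)
        - (SUP u\<in>{u. L2a M W T u}. Jfun M W K T \<alpha> \<beta> \<sigma> X0 a1 a2 u)\<bar> \<le> C * real n powr (- h / 2))"
proof -
  interpret volterra_control M W T \<alpha> \<beta> \<sigma> X0 a1 a2
    using assms by unfold_locales auto
  have h: "0 < h" "h \<le> 2" using assms by auto
  obtain r where r: "resolvent_on T \<beta> K r"
    using resolvent_on_exists[OF \<open>T > 0\<close> holder_on_imp_continuous_on[OF h(1) \<open>holder_on h {0..T} K\<close>]] by blast
  have "performance (bernstein T K n) (\<lambda>t \<omega>. hat_u \<alpha> \<beta> a1 a2 T K n t)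
      = optimal_value (bernstein_resolvent T \<beta> K n)" for n
    unfolding hat_u_eq_optimal_control
    by (rule performance_optimal_control[OF resolvent_on_bernstein[OF \<open>T > 0\<close>]])
  then show ?thesis
    using bdd_above_performance[OF r] optimal_value_bernstein_rate[OF h \<open>holder_on h {0..T} K\<close> r]
      performance_bernstein_control_rate[OF h \<open>holder_on h {0..T} K\<close> r]
    by (simp only: Sup_performance[OF r] hat_u_eq_optimal_control)
qed

end
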